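(* Let $(X,\Sigma,\mu)$ and $(Y,\Gamma,\nu)$ be strictly localizable measure spaces, and let $T: L_1(X,\Sigma,\mu)\to L_1(Y,\Gamma,\nu)$ be a bounded linear operator. Then there exists a weakly compact operator $W: L_1(X,\Sigma,\mu)\to L_1(Y,\Gamma,\nu)$ such that $$\|T\|_w=\|T-W\|=\inf_{\Theta\subseteq Y,\ \nu(\Theta)<\infty}\alpha_\Theta(T),$$ where the infimum is over measurable sets $\Theta\subseteq Y$ of finite measure and $$\alpha_\Theta(T)=\limsup_{\nu(B)\to 0,\ B\subseteq\Theta}\|\chi_{Y\setminus\Theta}T+\chi_BT\|.$$
   Context: Scalars are real or complex. Operator means bounded linear map. A measure space $(X,\Sigma,\mu)$ is strictly localizable if there is a family $(X_i)_{i\in I}$ of mutually disjoint measurable sets with $X=\bigcup_{i\in I}X_i$ and $\mu(X_i)<\infty$ for all $i$, such that a set $A\subseteq X$ is measurable if and only if $A\cap X_i$ is measurable for every $i\in I$, and $\mu(A)=\sum_{i\in I}\mu(A\cap X_i)$ for every $A\in\Sigma$. An operator is weakly compact if the image of the unit ball is relatively weakly compact. $\mathscr{W}(E,F)$ denotes the weakly compact operators $E\to F$, and the weak essential norm of an operator $T:E\to F$ is $\|T\|_w=\inf\{\|T-W\|: W\in\mathscr{W}(E,F)\}$. For a measurable set $A\subseteq Y$, $\chi_A$ is the operator $f\mapsto \mathds{1}_Af$ of multiplication by the indicator function of $A$ (with values regarded in $L_1(Y,\Gamma,\nu)$). The limsup means $\lim_{\delta\to0^+}\sup\{\|\chi_{Y\setminus\Theta}T+\chi_BT\|: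 B\in\Gamma,\ B\subseteq\Theta,\ \nu(B)<\delta\}$. *)

theory Defs
  imports "HOL-Analysis.Analysis"
begin

text \<open>The mutually disjoint family is given as the set of its nonempty members; empty members of
  an indexed family contribute nothing to any of the conditions.\<close>

definition strictly_localizable :: "'a measure \<Rightarrow> bool" where
  "strictly_localizable M \<longleftrightarrow> (\<exists>P. partition_on (space M) P \<and> P \<subseteq> sets M \<and>
     (\<forall>X\<in>P. emeasure M X < \<infinity>) \<and>
     (\<forall>A\<subseteq>space M. A \<in> sets M \<longleftrightarrow> (\<forall>X\<in>P. A \<inter> X \<in> sets M)) \<and>
     (\<forall>A\<in>sets M. ((\<lambda>X. emeasure M (A \<inter> X)) has_sum emeasure M A) P))"

text \<open>The space \<open>L\<^sub>1(\<mu>)\<close> depends on the term \<open>\<mu>\<close>, so it cannot be a type. Normed spaces are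
  therefore records, and operators are functions on the ambient type of which only the
  values on the carrier matter.\<close>

record ('k, 'e) nspace =
  vecs :: "'e set"
  vadd :: "'e \<Rightarrow> 'e \<Rightarrow> 'e"
  vscale :: "'k \<Rightarrow> 'e \<Rightarrow> 'e"
  vnorm :: "'e \<Rightarrow> real"

definition scalar_space :: "('k::real_normed_field, 'k) nspace" where
  "scalar_space = \<lparr>vecs = UNIV, vadd = (+), vscale = (*), vnorm = norm\<rparr>"

definition unit_ball :: "('k, 'e) nspace \<Rightarrow> 'e set" where
  "unit_ball E = {x \<in> vecs E. vnorm E x \<le> 1}"

definition bounded_op :: "('k, 'e) nspace \<Rightarrow> ('k, 'f) nspace \<Rightarrow> ('e \<Rightarrow> 'f) \<Rightarrow> bool" where
  "bounded_op E F T \<longleftrightarrow> T \<in> vecs E \<rightarrow> vecs F \<and>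
     (\<forall>x\<in>vecs E. \<forall>y\<in>vecs E. T (vadd E x y) = vadd F (T x) (T y)) \<and>
     (\<forall>c. \<forall>x\<in>vecs E. T (vscale E c x) = vscale F c (T x)) \<and>
     (\<exists>K. \<forall>x\<in>vecs E. vnorm F (T x) \<le> K * vnorm E x)"

definition op_norm :: "('k, 'e) nspace \<Rightarrow> ('k, 'f) nspace \<Rightarrow> ('e \<Rightarrow> 'f) \<Rightarrow> real" where
  "op_norm E F T = (SUP x\<in>unit_ball E. vnorm F (T x))"

definition op_add :: "('k, 'f) nspace \<Rightarrow> ('e \<Rightarrow> 'f) \<Rightarrow> ('e \<Rightarrow> 'f) \<Rightarrow> 'e \<Rightarrow> 'f" where
  "op_add F S T = (\<lambda>x. vadd F (S x) (T x))"

definition op_diff :: "('k::real_normed_field, 'f) nspace \<Rightarrow> ('e \<Rightarrow> 'f) \<Rightarrow> ('e \<Rightarrow> 'f) \<Rightarrow> 'e \<Rightarrow> 'f" where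
  "op_diff F S T = (\<lambda>x. vadd F (S x) (vscale F (-1) (T x)))"

definition weak_topology :: "('k::real_normed_field, 'e) nspace \<Rightarrow> 'e topology" where
  "weak_topology E = topology_generated_by
     {{x \<in> vecs E. \<phi> x \<in> U} | \<phi> U. bounded_op E scalar_space \<phi> \<and> open U}"

definition weakly_compact_op ::
    "('k::real_normed_field, 'e) nspace \<Rightarrow> ('k, 'f) nspace \<Rightarrow> ('e \<Rightarrow> 'f) \<Rightarrow> bool" where
  "weakly_compact_op E F W \<longleftrightarrow> bounded_op E F W \<and>
     compactin (weak_topology F) (weak_topology F closure_of (W ` unit_ball E))"

definition weak_ess_norm ::
    "('k::real_normed_field, 'e) nspace \<Rightarrow> ('k, 'f) nspace \<Rightarrow> ('e \<Rightarrow> 'f) \<Rightarrow> real" where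
  "weak_ess_norm E F T = (INF W\<in>{W. weakly_compact_op E F W}. op_norm E F (op_diff F T W))"

definition ae_rel ::
    "'a measure \<Rightarrow> (('a \<Rightarrow> 'k::{real_normed_field,banach,second_countable_topology}) \<times> ('a \<Rightarrow> 'k)) set" where
  "ae_rel M = {(f, g). integrable M f \<and> integrable M g \<and> (AE x in M. f x = g x)}"

abbreviation ae_class ::
    "'a measure \<Rightarrow> ('a \<Rightarrow> 'k::{real_normed_field,banach,second_countable_topology}) \<Rightarrow> ('a \<Rightarrow> 'k) set" where
  "ae_class M f \<equiv> ae_rel M `` {f}"

text \<open>The operations are taken over all representatives; the lemmas below show that they are
  given by any single one.\<close>

definition L1 ::
    "'a measure \<Rightarrow> ('k::{real_normed_field,banach,second_countable_topology}, ('a \<Rightarrow> 'k) set) nspace" where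
  "L1 M = \<lparr>vecs = {f. integrable M f} // ae_rel M,
           vadd = (\<lambda>F G. \<Union>f\<in>F. \<Union>g\<in>G. ae_class M (\<lambda>x. f x + g x)),
           vscale = (\<lambda>c F. \<Union>f\<in>F. ae_class M (\<lambda>x. c * f x)),
           vnorm = (\<lambda>F. the_elem ((\<lambda>f. \<integral>x. norm (f x) \<partial>M) ` F))\<rparr>"

definition chi ::
    "'a measure \<Rightarrow> 'a set \<Rightarrow> ('a \<Rightarrow> 'k::{real_normed_field,banach,second_countable_topology}) set \<Rightarrow> ('a \<Rightarrow> 'k) set" where
  "chi M A F = (\<Union>f\<in>F. ae_class M (\<lambda>x. indicator A x * f x))"

lemma equiv_ae_rel: "equiv {f. integrable M f} (ae_rel M)"
proof (rule equivI)
  show "ae_rel M \<subseteq> {f. integrable M f} \<times> {f. integrable M f}"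
    by (auto simp: ae_rel_def)
  show "refl_on {f. integrable M f} (ae_rel M)"
    by (auto simp: refl_on_def ae_rel_def)
  show "sym (ae_rel M)"
    by (rule symI) (auto simp: ae_rel_def elim: eventually_mono)
  show "trans (ae_rel M)"
    by (rule transI) (auto simp: ae_rel_def elim: eventually_elim2)
qed

lemma ae_class_in_L1: "integrable M f \<Longrightarrow> ae_class M f \<in> vecs (L1 M)"
  by (simp add: L1_def quotientI)

lemma L1_cases:
  assumes "F \<in> vecs (L1 M)"
  obtains f where "integrable M f" "F = ae_class M f"
proof -
  have "F \<in> {f. integrable M f} // ae_rel M" using assms by (simp add: L1_def)
  then show thesis by (rule quotientE) (simp add: that)
qed

lemma ae_class_self: "integrable M f \<Longrightarrow> f \<in> ae_class M f"
  by (simp add: ae_rel_def)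

lemma ae_class_nonempty: "integrable M f \<Longrightarrow> ae_class M f \<noteq> {}"
  using ae_class_self by blast

lemma ae_class_eqI:
  assumes "integrable M f" "integrable M g" "AE x in M. f x = g x"
  shows "ae_class M f = ae_class M g"
  by (rule equiv_class_eq[OF equiv_ae_rel]) (simp add: ae_rel_def assms)

lemma L1_add:
  assumes f: "integrable M f" and g: "integrable M g"
  shows "vadd (L1 M) (ae_class M f) (ae_class M g) = ae_class M (\<lambda>x. f x + g x)"
proof -
  have "ae_class M (\<lambda>x. f' x + g' x) = ae_class M (\<lambda>x. f x + g x)"
    if "f' \<in> ae_class M f" "g' \<in> ae_class M g" for f' g'
  proof (rule ae_class_eqI)
    show "AE x in M. f' x + g' x = f x + g x"
      using that by (auto simp: ae_rel_def elim!: eventually_elim2)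
  qed (use that f g in \<open>auto simp: ae_rel_def\<close>)
  then have "vadd (L1 M) (ae_class M f) (ae_class M g) =
      (\<Union>f'\<in>ae_class M f. \<Union>g'\<in>ae_class M g. ae_class M (\<lambda>x. f x + g x))"
    unfolding L1_def nspace.select_convs by (intro SUP_cong refl)
  then show ?thesis
    by (simp only: UN_constant ae_class_nonempty[OF f] ae_class_nonempty[OF g] if_False)
qed

lemma L1_scale:
  assumes f: "integrable M f"
  shows "vscale (L1 M) c (ae_class M f) = ae_class M (\<lambda>x. c * f x)"
proof -
  have "ae_class M (\<lambda>x. c * f' x) = ae_class M (\<lambda>x. c * f x)" if "f' \<in> ae_class M f" for f'
  proof (rule ae_class_eqI)
    show "AE x in M. c * f' x = c * f x"
      using that by (auto simp: ae_rel_def simp del: mult_cancel_left elim!: eventually_mono)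
  qed (use that f in \<open>auto simp: ae_rel_def\<close>)
  then have "vscale (L1 M) c (ae_class M f) = (\<Union>f'\<in>ae_class M f. ae_class M (\<lambda>x. c * f x))"
    unfolding L1_def nspace.select_convs by (intro SUP_cong refl)
  then show ?thesis
    by (simp only: UN_constant ae_class_nonempty[OF f] if_False)
qed

lemma L1_norm:
  assumes f: "integrable M f"
  shows "vnorm (L1 M) (ae_class M f) = (\<integral>x. norm (f x) \<partial>M)"
proof -
  have "(\<integral>x. norm (f' x) \<partial>M) = (\<integral>x. norm (f x) \<partial>M)" if "f' \<in> ae_class M f" for f'
  proof (rule integral_cong_AE)
    show "AE x in M. norm (f' x) = norm (f x)"
      using that by (auto simp: ae_rel_def elim!: eventually_mono)
  qed (use that f in \<open>auto simp: ae_rel_def\<close>)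
  then have "(\<lambda>f. \<integral>x. norm (f x) \<partial>M) ` ae_class M f = (\<lambda>_. \<integral>x. norm (f x) \<partial>M) ` ae_class M f"
    by (intro image_cong refl)
  also have "\<dots> = {\<integral>x. norm (f x) \<partial>M}"
    by (rule image_constant_conv[THEN trans]) (simp only: ae_class_nonempty[OF f] if_False)
  finally show ?thesis by (simp add: L1_def)
qed

lemma chi_ae_class:
  assumes A: "A \<in> sets M" and f: "integrable M f"
  shows "chi M A (ae_class M f) = ae_class M (\<lambda>x. indicator A x * f x)"
proof -
  have int: "integrable M (\<lambda>x. indicator A x * h x)" if h: "integrable M h" for h :: "'a \<Rightarrow> 'b"
  proof (rule Bochner_Integration.integrable_bound[OF h])
    show "(\<lambda>x. indicator A x * h x) \<in> borel_measurable M"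
      using A h by measurable
  qed (auto simp: indicator_def)
  have "ae_class M (\<lambda>x. indicator A x * f' x) = ae_class M (\<lambda>x. indicator A x * f x)"
    if "f' \<in> ae_class M f" for f'
  proof (rule ae_class_eqI)
    show "AE x in M. indicator A x * f' x = indicator A x * f x"
      using that by (auto simp: ae_rel_def elim!: eventually_mono)
  qed (use that f in \<open>auto simp: ae_rel_def intro: int\<close>)
  then have "chi M A (ae_class M f) = (\<Union>f'\<in>ae_class M f. ae_class M (\<lambda>x. indicator A x * f x))"
    unfolding chi_def by (intro SUP_cong refl)
  then show ?thesis
    by (simp only: UN_constant ae_class_nonempty[OF f] if_False)
qed

definition alpha ::
    "'a measure \<Rightarrow> 'b measure \<Rightarrow> 'b set \<Rightarrow>
     (('a \<Rightarrow> 'k::{real_normed_field,banach,second_countable_topology}) set \<Rightarrow> ('b \<Rightarrow> 'k) set) \<Rightarrow> real" where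
  "alpha M N \<Theta> T = Lim (at_right 0) (\<lambda>\<delta>.
     SUP B\<in>{B \<in> sets N. B \<subseteq> \<Theta> \<and> emeasure N B < ennreal \<delta>}.
       op_norm (L1 M) (L1 N) (op_add (L1 N) (chi N (space N - \<Theta>) \<circ> T) (chi N B \<circ> T)))"

end

theory Submission
  imports Defs
begin

text \<open>
  For a bounded set in an \<open>L\<^sub>1\<close> space, relative weak compactness is equi-integrability:
  uniformly little mass outside a suitable set of finite measure, and on all sets of small measure. Both
  inequalities between the weak essential norm and \<open>a = inf \<alpha>\<^sub>\<Theta>(T)\<close> come from
  this criterion.

  \<^emph>\<open>Lower bound.\<close> If \<open>W\<close> is weakly compact, then for a suitable
  \<open>\<Theta>\<close> the functions \<open>Wf\<close>, with \<open>f\<close> in the unit ball, have mass at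
  most \<open>\<epsilon>\<close> on \<open>(Y - \<Theta>) \<union> B\<close> for every set \<open>B\<close> of
  small measure (\<open>weakly_compact_imp_mass_small\<close>). On such sets \<open>T\<close> therefore has norm
  at most \<open>\<parallel>T - W\<parallel> + \<epsilon>\<close>, so that \<open>a \<le> \<parallel>T -
  W\<parallel>\<close>.

  \<^emph>\<open>A minimizer.\<close> Choose \<open>\<Theta>\<^sub>n\<close> and \<open>\<delta>\<^sub>n\<close>
  that realize \<open>a\<close> up to \<open>1/(n+1)\<close>, and put all the sets
  \<open>\<Theta>\<^sub>n\<close> into one integrable weight \<open>w = \<Sum> c\<^sub>n
  1\<^bsub>\<Theta>\<^sub>n\<^esub>\<close> (\<open>ex_weight\<close>). Then for every \<open>\<epsilon>\<close>
  a set of small \<open>w\<close>-mass carries at most \<open>a + \<epsilon>\<close> of the mass of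
  \<open>Tf\<close>, for all \<open>f\<close> in the unit ball. Suppose first that \<open>T\<close> were
  determined by its values \<open>t\<^sub>A = T(1\<^sub>A/\<mu>(A))\<close> on finitely many disjoint blocks
  \<open>A\<close>. Cut \<open>|t\<^sub>A|\<close> off at the height \<open>m w\<close>, where the number
  \<open>m\<close> is such that the part cut off has mass exactly \<open>a\<close>. What remains is
  equi-integrable with a modulus that does not depend on \<open>A\<close> (\<open>truncation\<close>): either
  \<open>m\<close> is bounded, or the cut acts on a set of small \<open>w\<close>-mass only; a set of small
  \<open>w\<close>-mass together with this one carries at most \<open>a + \<epsilon>\<close> of
  \<open>|t\<^sub>A|\<close>, of which \<open>a\<close> has been removed. The truncated functions define an
  operator with distance at most \<open>a\<close> from \<open>T\<close>.

  A general \<open>T\<close> is approximated in this way after averaging \<open>f\<close> over the blocks. For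
  finitely many \<open>f\<close> at a time there are blocks over which the averages are close to
  \<open>f\<close> (\<open>ex_blocks_average\<close>), so the operators just described are passed to their weak
  limit \<open>W\<close> along an ultrafilter of block systems. The limit exists because an equi-integrable
  family has weak limits by the Radon-Nikodym theorem (\<open>equi_bounded_weak_lim\<close>). The norm is weakly
  lower semicontinuous (\<open>weak_lim_mass_le\<close>), so \<open>\<parallel>T - W\<parallel> \<le> a\<close>,
  and \<open>W\<close> maps the unit ball into a set of functions with one common modulus of equi-integrability,
  which is weakly compact (\<open>compactin_equi_ball\<close>).

  The argument is the same for real and complex scalars; the scalars are a normed field that is a Euclidean
  space over the reals.
\<close>

section \<open>Limits along ultrafilters\<close>

definition ultrafilter :: "'i filter \<Rightarrow> bool" where
  "ultrafilter U \<longleftrightarrow> U \<noteq> bot \<and> (\<forall>P. eventually P U \<or> eventually (\<lambda>i. \<not> P i) U)"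

text \<open>
  By Zorn's lemma there is a minimal proper filter below the given one; the infimum of a chain of proper filters
  is proper because \<open>False\<close> holding eventually would already be seen by one of its members.
\<close>

lemma ex_ultrafilter:
  assumes F: "F \<noteq> (bot :: 'i filter)"
  shows "\<exists>U. U \<le> F \<and> ultrafilter U"
proof -
  let ?A = "{G. G \<le> F \<and> G \<noteq> bot}"
  have "\<exists>m\<in>?A. \<forall>a\<in>?A. a \<le> m \<longrightarrow> a = m"
  proof (rule predicate_Zorn[where P = "\<lambda>a b. b \<le> a"])
    show "partial_order_on ?A (relation_of (\<lambda>a b. b \<le> a) ?A)"
      by (intro partial_order_on_relation_ofI) auto
    fix C assume C: "C \<in> Chains (relation_of (\<lambda>a b. b \<le> a) ?A)"
    then have CA: "C \<subseteq> ?A" and tot: "\<And>a b. a \<in> C \<Longrightarrow> b \<in> C \<Longrightarrow> a \<le> b \<or> b \<le> a"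
      by (auto simp: Chains_def relation_of_def)
    show "\<exists>u\<in>?A. \<forall>a\<in>C. u \<le> a"
    proof (cases "C = {}")
      case True
      then show ?thesis using F by auto
    next
      case False
      have "\<not> eventually (\<lambda>_. False) (Inf C)"
        using CA tot by (subst eventually_Inf_base[OF False])
          (auto simp: eventually_False, metis inf.absorb1 inf.absorb2 order_refl)
      moreover have "Inf C \<le> F"
        using False CA by (metis (no_types, lifting) Inf_lower all_not_in_conv mem_Collect_eq order_trans subset_eq)
      ultimately show ?thesis
        by (intro bexI[of _ "Inf C"]) (auto simp: eventually_False Inf_lower)
    qed
  qed
  then obtain U where U: "U \<le> F" "U \<noteq> bot" and max: "\<And>G. G \<le> U \<Longrightarrow> G \<noteq> bot \<Longrightarrow> G = U"
    by (metis (mono_tags, lifting) mem_Collect_eq order_trans)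
  have "eventually P U \<or> eventually (\<lambda>i. \<not> P i) U" for P
  proof (cases "inf U (principal {i. P i}) = bot")
    case True
    then show ?thesis by (simp add: trivial_limit_def eventually_inf_principal)
  next
    case False
    then have "inf U (principal {i. P i}) = U" by (intro max) auto
    then have "U \<le> principal {i. P i}" by (metis inf.cobounded2)
    then show ?thesis by (simp add: le_principal)
  qed
  with U show ?thesis by (auto simp: ultrafilter_def)
qed

lemma ultrafilter_tendsto:
  fixes f :: "'i \<Rightarrow> 'b::topological_space"
  assumes U: "ultrafilter U" and S: "compact S" and ev: "eventually (\<lambda>i. f i \<in> S) U"
  shows "\<exists>l. (f \<longlongrightarrow> l) U"
proof -
  have "filtermap f U \<noteq> bot" using U by (simp add: ultrafilter_def filtermap_bot_iff)
  then obtain l where l: "inf (nhds l) (filtermap f U) \<noteq> bot"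
    using S[unfolded compact_filter, rule_format, of "filtermap f U"] ev
    by (auto simp: eventually_filtermap)
  have "(f \<longlongrightarrow> l) U"
  proof (rule topological_tendstoI)
    fix V assume "open V" "l \<in> V"
    show "eventually (\<lambda>i. f i \<in> V) U"
    proof (rule ccontr)
      assume "\<not> ?thesis"
      then have "eventually (\<lambda>i. f i \<notin> V) U" using U by (auto simp: ultrafilter_def)
      then have "eventually (\<lambda>x. x \<notin> V) (filtermap f U)" by (simp add: eventually_filtermap)
      moreover have "eventually (\<lambda>x. x \<in> V) (nhds l)"
        using \<open>open V\<close> \<open>l \<in> V\<close> eventually_nhds by blast
      ultimately have "eventually (\<lambda>_. False) (inf (nhds l) (filtermap f U))"
        by (auto simp: eventually_inf)
      then show False using l by (simp add: eventually_False)
    qed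
  qed
  then show ?thesis ..
qed

lemma ultrafilter_tendsto_bounded:
  fixes f :: "'i \<Rightarrow> 'b::{heine_borel,real_normed_vector}"
  assumes "ultrafilter U" and "eventually (\<lambda>i. norm (f i) \<le> r) U"
  shows "\<exists>l. (f \<longlongrightarrow> l) U"
  by (rule ultrafilter_tendsto[OF assms(1) compact_cball[of 0 r]]) (use assms(2) in simp)

section \<open>Rosenthal's matrix lemma\<close>

text \<open>
  Split the indices into infinitely many infinite classes. Either one class has all its off-diagonal row sums at
  most \<open>e\<close>, or each class contains an index whose row has sum above \<open>e\<close> inside the
  class. Choosing one such index from every class, the remaining row sums drop by \<open>e\<close>, because the
  other chosen indices lie outside the class. As the sums are at most \<open>R\<close>, this can happen at most
  \<open>R / e\<close> times.
\<close>

lemma Rosenthal_matrix: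
  fixes x :: "nat \<Rightarrow> nat \<Rightarrow> real"
  assumes nonneg: "\<And>n m. 0 \<le> x n m" and e: "0 < e"
    and bound: "\<And>n F. finite F \<Longrightarrow> n \<notin> F \<Longrightarrow> sum (x n) F \<le> R"
  shows "\<exists>k::nat \<Rightarrow> nat. inj k \<and> (\<forall>p F. finite F \<longrightarrow> p \<notin> F \<longrightarrow> (\<Sum>q\<in>F. x (k p) (k q)) \<le> e)"
proof -
  have main: "\<exists>k::nat \<Rightarrow> nat. inj k \<and> (\<forall>p F. finite F \<longrightarrow> p \<notin> F \<longrightarrow> (\<Sum>q\<in>F. y (k p) (k q)) \<le> e)"
    if "\<And>n m. 0 \<le> y n m" "\<And>n F. finite F \<Longrightarrow> n \<notin> F \<Longrightarrow> sum (y n) F \<le> real j * e"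
    for j and y :: "nat \<Rightarrow> nat \<Rightarrow> real"
    using that
  proof (induction j arbitrary: y)
    case 0
    have "sum (y p) F \<le> e" if "finite F" "p \<notin> F" for p F
      using 0(2)[OF that] e by simp
    then show ?case by (intro exI[of _ id]) auto
  next
    case (Suc j)
    define c where "c p i = prod_encode (p, i)" for p i
    have inj_c: "inj (c p)" for p by (auto simp: c_def inj_def prod_encode_eq)
    show ?case
    proof (cases "\<exists>p. \<forall>i F. finite F \<longrightarrow> i \<notin> F \<longrightarrow> (\<Sum>q\<in>F. y (c p i) (c p q)) \<le> e")
      case True
      then show ?thesis using inj_c by blast
    next
      case False
      then obtain i F where F: "\<And>p. finite (F p)" "\<And>p. i p \<notin> F p"
        and big: "\<And>p. (\<Sum>q\<in>F p. y (c p (i p)) (c p q)) > e"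
        by (metis not_le)
      define k where "k p = c p (i p)" for p
      have inj_k: "inj k" by (auto simp: inj_def k_def c_def prod_encode_eq)
      have "\<exists>k'::nat \<Rightarrow> nat. inj k' \<and>
          (\<forall>p F. finite F \<longrightarrow> p \<notin> F \<longrightarrow> (\<Sum>q\<in>F. y (k (k' p)) (k (k' q))) \<le> e)"
      proof (rule Suc.IH)
        fix p G assume G: "finite (G :: nat set)" "p \<notin> G"
        have disj: "k ` G \<inter> c p ` F p = {}"
          using G(2) by (auto simp: k_def c_def prod_encode_eq)
        have "k p \<notin> k ` G \<union> c p ` F p"
          using G(2) F(2) inj_k inj_c by (auto simp: inj_image_mem_iff k_def c_def prod_encode_eq)
        then have "sum (y (k p)) (k ` G \<union> c p ` F p) \<le> real (Suc j) * e"
          using F(1) G(1) by (intro Suc.prems) auto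
        moreover have "sum (y (k p)) (k ` G \<union> c p ` F p)
            = (\<Sum>q\<in>G. y (k p) (k q)) + (\<Sum>q\<in>F p. y (k p) (c p q))"
          using disj G(1) F(1) inj_on_subset[OF inj_k, of G] inj_on_subset[OF inj_c, of "F p" p]
          by (simp add: sum.union_disjoint sum.reindex)
        ultimately show "(\<Sum>q\<in>G. y (k p) (k q)) \<le> real j * e"
          using big[of p] by (simp add: k_def algebra_simps)
      qed (use Suc.prems in auto)
      then obtain k' :: "nat \<Rightarrow> nat" where k': "inj k'"
        "\<forall>p F. finite F \<longrightarrow> p \<notin> F \<longrightarrow> (\<Sum>q\<in>F. y (k (k' p)) (k (k' q))) \<le> e"
        by blast
      have "inj (\<lambda>p. k (k' p))" using inj_compose[OF inj_k k'(1)] by (simp add: o_def)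
      with k'(2) show ?thesis by blast
    qed
  qed
  obtain j where "R / e \<le> real j" using real_arch_simple by blast
  then have R: "R \<le> real j * e" using e by (simp add: field_simps)
  show ?thesis by (rule main[OF nonneg order_trans[OF bound R]])
qed

section \<open>The mass of an integrable function on a set\<close>

definition mass :: "'b measure \<Rightarrow> ('b \<Rightarrow> 'k::real_normed_vector) \<Rightarrow> 'b set \<Rightarrow> real" where
  "mass N g C = (LINT x|N. indicator C x * norm (g x))"

lemma integrable_bounded_mult:
  fixes g h :: "'b \<Rightarrow> 'k::{real_normed_field,banach,second_countable_topology}"
  assumes "integrable N g" "h \<in> borel_measurable N" "\<And>x. norm (h x) \<le> c"
  shows "integrable N (\<lambda>x. h x * g x)"
proof (rule Bochner_Integration.integrable_bound)
  show "integrable N (\<lambda>x. c * norm (g x))" using assms by auto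
  show "AE x in N. norm (h x * g x) \<le> norm (c * norm (g x))"
    using assms(3) by (auto simp: norm_mult abs_mult intro!: mult_mono order_trans[OF assms(3)])
qed (use assms in measurable)

lemma integrable_mass:
  fixes g :: "'b \<Rightarrow> 'k::{banach,second_countable_topology}"
  assumes "integrable N g" "C \<in> sets N"
  shows "integrable N (\<lambda>x. indicator C x * norm (g x) :: real)"
  using integrable_mult_indicator[OF assms(2) integrable_norm[OF assms(1)]] by simp

lemma norm_integral_mult_le_mass:
  fixes g h :: "'b \<Rightarrow> 'k::{real_normed_field,banach,second_countable_topology}"
  assumes "integrable N g" "C \<in> sets N" "h \<in> borel_measurable N"
    and "\<And>x. norm (h x) \<le> c * indicator C x"
  shows "norm (LINT x|N. h x * g x) \<le> c * mass N g C"
proof -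
  have "norm (LINT x|N. h x * g x) \<le> (LINT x|N. c * (indicator C x * norm (g x)))"
  proof (rule order_trans[OF integral_norm_bound])
    have "norm (h x) \<le> \<bar>c\<bar>" for x using assms(4)[of x] by (cases "x \<in> C") auto
    then have "integrable N (\<lambda>x. norm (h x * g x))"
      using assms by (intro integrable_norm integrable_bounded_mult) auto
    then show "(LINT x|N. norm (h x * g x)) \<le> (LINT x|N. c * (indicator C x * norm (g x)))"
      using assms integrable_mass[OF assms(1,2)]
      by (intro integral_mono) (auto simp: norm_mult mult.assoc intro!: order_trans[OF mult_right_mono[OF assms(4)]])
  qed
  then show ?thesis by (simp add: mass_def)
qed

text \<open>
  The norm on \<open>C\<close> is attained by the conjugate sign of \<open>g\<close>. The quotient below is
  \<open>0\<close> where \<open>g\<close> vanishes.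
\<close>

lemma norming_function:
  fixes g :: "'b \<Rightarrow> 'k::{real_normed_field,banach,second_countable_topology}"
  assumes "integrable N g" "C \<in> sets N"
  obtains h where "h \<in> borel_measurable N" "\<And>x. norm (h x) \<le> indicator C x"
    "(LINT x|N. h x * g x) = of_real (mass N g C)"
proof
  let ?h = "\<lambda>x. indicator C x * (of_real (norm (g x)) / g x)"
  show "?h \<in> borel_measurable N" using assms by measurable
  show "norm (?h x) \<le> indicator C x" for x
    by (auto simp: indicator_def norm_divide norm_mult)
  have "?h x * g x = of_real (indicator C x * norm (g x))" for x
    by (auto simp: indicator_def)
  then have "(LINT x|N. ?h x * g x) = (LINT x|N. of_real (indicator C x * norm (g x)))"
    by (rule arg_cong[of _ _ "integral\<^sup>L N", OF ext])
  also have "\<dots> = of_real (mass N g C)"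
    unfolding mass_def by (rule integral_of_real) (rule integrable_mass[OF assms])
  finally show "(LINT x|N. ?h x * g x) = of_real (mass N g C)" .
qed

text \<open>
  The link to the library: \<open>mass N g\<close> is a finite measure, so monotonicity, additivity and
  continuity need no proof of their own.
\<close>

lemma mass_density:
  fixes g :: "'b \<Rightarrow> 'k::{banach,second_countable_topology}"
  assumes g: "integrable N g"
  shows "finite_measure (density N (\<lambda>x. ennreal (norm (g x))))"
    and "\<And>C. C \<in> sets N \<Longrightarrow> emeasure (density N (\<lambda>x. ennreal (norm (g x)))) C = ennreal (mass N g C)"
    and "\<And>C. C \<in> sets N \<Longrightarrow> measure (density N (\<lambda>x. ennreal (norm (g x)))) C = mass N g C"
proof -
  have *: "emeasure (density N (\<lambda>x. ennreal (norm (g x)))) C = ennreal (mass N g C)"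
    if C: "C \<in> sets N" for C
  proof -
    have "emeasure (density N (\<lambda>x. ennreal (norm (g x)))) C = (\<integral>\<^sup>+x. ennreal (indicator C x * norm (g x)) \<partial>N)"
      using g C by (subst emeasure_density) (auto intro!: nn_integral_cong simp: indicator_def)
    also have "\<dots> = ennreal (mass N g C)"
      unfolding mass_def by (rule nn_integral_eq_integral[OF integrable_mass[OF g C]]) auto
    finally show ?thesis .
  qed
  then show "\<And>C. C \<in> sets N \<Longrightarrow> emeasure (density N (\<lambda>x. ennreal (norm (g x)))) C = ennreal (mass N g C)" .
  show "finite_measure (density N (\<lambda>x. ennreal (norm (g x))))"
    by (rule finite_measureI) (simp add: *)
  have nn: "0 \<le> mass N g C" for C by (auto simp: mass_def)
  show "\<And>C. C \<in> sets N \<Longrightarrow> measure (density N (\<lambda>x. ennreal (norm (g x)))) C = mass N g C"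
    by (simp add: measure_def * nn)
qed

lemma mass_nonneg: "0 \<le> mass N g C"
  by (auto simp: mass_def)

context
  fixes N :: "'b measure" and g :: "'b \<Rightarrow> 'k::{banach,second_countable_topology}"
  assumes g: "integrable N g"
begin

interpretation D: finite_measure "density N (\<lambda>x. ennreal (norm (g x)))"
  by (rule mass_density(1)[OF g])

lemma mass_mono: "A \<in> sets N \<Longrightarrow> B \<in> sets N \<Longrightarrow> A \<subseteq> B \<Longrightarrow> mass N g A \<le> mass N g B"
  using D.finite_measure_mono[of A B] by (simp add: mass_density(3)[OF g])

lemma mass_Un: "A \<in> sets N \<Longrightarrow> B \<in> sets N \<Longrightarrow> mass N g (A \<union> B) \<le> mass N g A + mass N g B"
  using measure_Un_le[of A "density N (\<lambda>x. ennreal (norm (g x)))" B] by (simp add: mass_density(3)[OF g])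

lemma mass_UN_disjoint:
  "finite I \<Longrightarrow> A ` I \<subseteq> sets N \<Longrightarrow> disjoint_family_on A I \<Longrightarrow>
     mass N g (\<Union>i\<in>I. A i) = (\<Sum>i\<in>I. mass N g (A i))"
  using D.finite_measure_finite_Union[of I A] mass_density(3)[OF g]
  by (simp add: image_subset_iff sets.finite_UN)

lemma mass_UN_le:
  assumes A: "\<And>i::nat. A i \<in> sets N" and b: "\<And>n. (\<Sum>i<n. mass N g (A i)) \<le> b"
  shows "mass N g (\<Union>i. A i) \<le> b"
proof -
  have s: "summable (\<lambda>i. mass N g (A i))"
    by (rule bounded_imp_summable[of _ b])
      (use b[of "Suc _"] in \<open>auto simp: mass_nonneg lessThan_Suc_atMost\<close>)
  have "mass N g (\<Union>i. A i) \<le> (\<Sum>i. mass N g (A i))"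
    using D.finite_measure_subadditive_countably[of A] A s
    by (simp add: mass_density(3)[OF g] image_subset_iff sets.countable_UN)
  also have "\<dots> \<le> b" by (rule suminf_le_const[OF s b])
  finally show ?thesis .
qed

lemma mass_decseq:
  assumes "\<And>i::nat. A i \<in> sets N" "decseq A"
  shows "(\<lambda>i. mass N g (A i)) \<longlonglongrightarrow> mass N g (\<Inter>i. A i)"
  using D.finite_Lim_measure_decseq[of A] assms
  by (simp add: mass_density(3)[OF g] image_subset_iff sets.countable_INT)

lemma mass_space: "mass N g (space N) = (LINT x|N. norm (g x))"
  unfolding mass_def by (intro Bochner_Integration.integral_cong) auto

lemma mass_Diff: "A \<in> sets N \<Longrightarrow> B \<in> sets N \<Longrightarrow> mass N g A - mass N g B \<le> mass N g (A - B)"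
  using mass_Un[of "A - B" B] mass_mono[of A "A - B \<union> B"] by (force simp del: Un_Diff_cancel2)

end

lemma mass_cong_AE:
  assumes "integrable N f" "integrable N g" "AE x in N. f x = g x" "C \<in> sets N"
  shows "mass N f C = mass N g C"
  unfolding mass_def using assms by (intro integral_cong_AE) auto

lemma mass_add:
  fixes f g :: "'b \<Rightarrow> 'k::{banach,second_countable_topology}"
  assumes "integrable N f" "integrable N g" "C \<in> sets N"
  shows "mass N (\<lambda>x. f x + g x) C \<le> mass N f C + mass N g C"
proof -
  have "mass N (\<lambda>x. f x + g x) C \<le> (LINT x|N. indicator C x * norm (f x) + indicator C x * norm (g x))"
    unfolding mass_def
  proof (rule integral_mono)
    show "integrable N (\<lambda>x. indicator C x * norm (f x + g x) :: real)"
      using assms by (intro integrable_mass) auto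
    show "integrable N (\<lambda>x. indicator C x * norm (f x) + indicator C x * norm (g x) :: real)"
      using assms by (intro Bochner_Integration.integrable_add integrable_mass)
  qed (auto simp: indicator_def norm_triangle_ineq)
  also have "\<dots> = mass N f C + mass N g C"
    unfolding mass_def using assms integrable_mass by (intro Bochner_Integration.integral_add) auto
  finally show ?thesis .
qed

lemma mass_cmult:
  fixes g :: "'b \<Rightarrow> 'k::real_normed_field"
  shows "mass N (\<lambda>x. c * g x) C = norm c * mass N g C"
  unfolding mass_def by (simp add: norm_mult mult.left_commute)

lemma mass_sum:
  fixes f :: "'i \<Rightarrow> 'b \<Rightarrow> 'k::{banach,second_countable_topology}"
  assumes "finite I" "\<And>i. i \<in> I \<Longrightarrow> integrable N (f i)" "C \<in> sets N"
  shows "mass N (\<lambda>x. \<Sum>i\<in>I. f i x) C \<le> (\<Sum>i\<in>I. mass N (f i) C)"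
  using assms(1,2)
proof (induction I)
  case empty
  then show ?case by (simp add: mass_def)
next
  case (insert i I)
  have "mass N (\<lambda>x. \<Sum>i\<in>insert i I. f i x) C = mass N (\<lambda>x. f i x + (\<Sum>i\<in>I. f i x)) C"
    using insert by simp
  also have "\<dots> \<le> mass N (f i) C + mass N (\<lambda>x. \<Sum>i\<in>I. f i x) C"
    using insert assms(3) by (intro mass_add) auto
  finally show ?case using insert by simp
qed

section \<open>Representatives of classes of integrable functions\<close>

text \<open>
  Every statement about a class is moved to one of its members; equations between members then hold almost
  everywhere.
\<close>

definition rep :: "('b \<Rightarrow> 'k) set \<Rightarrow> 'b \<Rightarrow> 'k" where
  "rep F = (SOME f. f \<in> F)"

context
  fixes N :: "'b measure"
begin

lemma rep_ae_class:
  fixes f :: "'b \<Rightarrow> 'k::{real_normed_field,banach,second_countable_topology}"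
  assumes "integrable N f"
  shows "integrable N (rep (ae_class N f))" "AE x in N. rep (ae_class N f) x = f x"
proof -
  have "rep (ae_class N f) \<in> ae_class N f"
    unfolding rep_def by (rule someI[of "\<lambda>g. g \<in> ae_class N f"]) (rule ae_class_self[OF assms])
  then show "integrable N (rep (ae_class N f))" "AE x in N. rep (ae_class N f) x = f x"
    by (auto simp: ae_rel_def elim!: eventually_mono)
qed

lemma ae_class_eq_iff:
  fixes f g :: "'b \<Rightarrow> 'k::{real_normed_field,banach,second_countable_topology}"
  assumes "integrable N f" "integrable N g"
  shows "ae_class N f = ae_class N g \<longleftrightarrow> (AE x in N. f x = g x)"
  using ae_class_eqI[OF assms] ae_class_self[OF assms(2)] by (auto simp: ae_rel_def)

lemma rep_L1:
  assumes "F \<in> vecs (L1 N)"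
  shows integrable_rep: "integrable N (rep F)" and ae_class_rep: "ae_class N (rep F) = F"
proof -
  obtain f where f: "integrable N f" "F = ae_class N f" using L1_cases[OF assms] .
  show int: "integrable N (rep F)" unfolding f(2) by (rule rep_ae_class(1)[OF f(1)])
  have "AE x in N. rep F x = f x" unfolding f(2) by (rule rep_ae_class(2)[OF f(1)])
  then show "ae_class N (rep F) = F"
    using f ae_class_eq_iff[OF int f(1)] by simp
qed

lemma vadd_L1:
  assumes "F \<in> vecs (L1 N)" "G \<in> vecs (L1 N)"
  shows "vadd (L1 N) F G = ae_class N (\<lambda>x. rep F x + rep G x)"
  using L1_add[OF assms[THEN integrable_rep]] by (simp only: assms[THEN ae_class_rep])

lemma vscale_L1:
  assumes "F \<in> vecs (L1 N)"
  shows "vscale (L1 N) c F = ae_class N (\<lambda>x. c * rep F x)"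
  using L1_scale[OF assms[THEN integrable_rep]] by (simp only: assms[THEN ae_class_rep])

lemma vnorm_L1:
  assumes "F \<in> vecs (L1 N)"
  shows "vnorm (L1 N) F = mass N (rep F) (space N)"
  using L1_norm[OF assms[THEN integrable_rep]]
  by (simp only: assms[THEN ae_class_rep] mass_space[OF assms[THEN integrable_rep]])

lemma vadd_in: "F \<in> vecs (L1 N) \<Longrightarrow> G \<in> vecs (L1 N) \<Longrightarrow> vadd (L1 N) F G \<in> vecs (L1 N)"
  by (simp add: vadd_L1 ae_class_in_L1 integrable_rep)

lemma vscale_in: "F \<in> vecs (L1 N) \<Longrightarrow> vscale (L1 N) c F \<in> vecs (L1 N)"
  by (simp add: vscale_L1 ae_class_in_L1 integrable_rep)

lemma rep_vadd: "F \<in> vecs (L1 N) \<Longrightarrow> G \<in> vecs (L1 N) \<Longrightarrow> AE x in N. rep (vadd (L1 N) F G) x = rep F x + rep G x"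
  by (simp only: vadd_L1) (intro rep_ae_class Bochner_Integration.integrable_add integrable_rep)

lemma rep_vscale: "F \<in> vecs (L1 N) \<Longrightarrow> AE x in N. rep (vscale (L1 N) c F) x = c * rep F x"
  by (simp only: vscale_L1) (intro rep_ae_class integrable_mult_right integrable_rep)

lemma rep_chi:
  assumes "F \<in> vecs (L1 N)" "A \<in> sets N"
  shows "chi N A F \<in> vecs (L1 N)" "AE x in N. rep (chi N A F) x = indicator A x * rep F x"
proof -
  have *: "chi N A F = ae_class N (\<lambda>x. indicator A x * rep F x)"
    using chi_ae_class[OF assms(2) integrable_rep[OF assms(1)]] by (simp only: ae_class_rep[OF assms(1)])
  have i: "integrable N (\<lambda>x. indicator A x * rep F x)"
    by (rule integrable_bounded_mult[OF integrable_rep[OF assms(1)], of _ 1]) (use assms in \<open>auto simp: indicator_def\<close>)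
  show "chi N A F \<in> vecs (L1 N)" "AE x in N. rep (chi N A F) x = indicator A x * rep F x"
    unfolding * using i by (auto intro!: ae_class_in_L1 rep_ae_class)
qed

end

section \<open>Weakly compact sets carry uniformly little mass far out and on small sets\<close>

lemma mass_bounded_le:
  assumes "integrable N g" "C \<in> sets N" "emeasure N C < \<infinity>" "\<And>x. x \<in> C \<Longrightarrow> norm (g x :: 'k::{banach,second_countable_topology}) \<le> c"
  shows "mass N g C \<le> c * measure N C"
proof -
  have "mass N g C \<le> (LINT x|N. c * indicator C x)"
    unfolding mass_def using assms
    by (intro integral_mono integrable_mass integrable_mult_right integrable_real_indicator)
       (auto simp: indicator_def)
  also have "\<dots> = c * measure N C" using assms(2,3) by simp
  finally show ?thesis .
qed

text \<open>
  A single integrable function lives, up to an error, on a set \<open>1/k \<le> |g| \<le> k\<close>, which has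
  finite measure and on which \<open>g\<close> is bounded.
\<close>

lemma mass_small_outside:
  fixes g :: "'b \<Rightarrow> 'k::{banach,second_countable_topology}"
  assumes g: "integrable N g" and e: "0 < e"
  shows "\<exists>\<Theta>\<in>sets N. emeasure N \<Theta> < \<infinity> \<and> (\<exists>\<delta>>0. \<forall>B\<in>sets N. emeasure N B < ennreal \<delta> \<longrightarrow>
           mass N g ((space N - \<Theta>) \<union> B) \<le> e)"
proof -
  define E where "E k = {x \<in> space N. 1 / real (Suc k) \<le> norm (g x) \<and> norm (g x) \<le> real (Suc k)}" for k
  have E[measurable]: "E k \<in> sets N" for k unfolding E_def using g by measurable
  have E_fin: "emeasure N (E k) < \<infinity>" for k
  proof -
    have "emeasure N (E k) \<le> emeasure N {x \<in> space N. 1 / real (Suc k) \<le> norm (g x)}"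
      using g by (intro emeasure_mono) (auto simp: E_def)
    also have "\<dots> \<le> ennreal (1 / (1 / real (Suc k)) * (LINT x|N. norm (g x)))"
      using g by (intro integral_Markov_inequality) auto
    finally show ?thesis by (auto intro: order.strict_trans1)
  qed
  have "decseq (\<lambda>k. space N - E k)"
  proof (rule decseq_SucI)
    show "space N - E (Suc k) \<subseteq> space N - E k" for k
      by (auto simp: E_def elim: order_trans[rotated] intro!: divide_left_mono)
  qed
  then have "(\<lambda>k. mass N g (space N - E k)) \<longlonglongrightarrow> mass N g (\<Inter>k. space N - E k)"
    by (intro mass_decseq[OF g]) auto
  moreover have "mass N g (\<Inter>k. space N - E k) = 0"
  proof -
    have "g x = 0" if x: "\<And>k. x \<in> space N - E k" for x
    proof (rule ccontr)
      assume "g x \<noteq> 0"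
      then have n: "0 < norm (g x)" by simp
      obtain k where k: "norm (g x) + 1 / norm (g x) \<le> real k" using real_arch_simple by blast
      then have "norm (g x) \<le> real (Suc k)" using n by (smt (verit) divide_nonneg_nonneg of_nat_Suc)
      moreover have "1 / norm (g x) \<le> real (Suc k)"
        using k n by (smt (verit) of_nat_Suc)
      then have "1 / real (Suc k) \<le> norm (g x)" using n by (simp add: field_simps)
      ultimately show False using x[of k] by (auto simp: E_def)
    qed
    then have "indicator (\<Inter>k. space N - E k) x * norm (g x) = (0::real)" for x
      by (auto simp: indicator_def)
    then show ?thesis unfolding mass_def by (intro integral_eq_zero_AE AE_I2)
  qed
  ultimately have "eventually (\<lambda>k. mass N g (space N - E k) < e / 2) sequentially"
    using e by (intro order_tendstoD(2)) auto
  then obtain k where k: "mass N g (space N - E k) < e / 2"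
    by (auto simp: eventually_sequentially)
  have "mass N g ((space N - E k) \<union> B) \<le> e"
    if B: "B \<in> sets N" "emeasure N B < ennreal (e / (2 * real (Suc k)))" for B
  proof -
    have fin: "emeasure N B < \<infinity>" using B(2) by (auto intro: order.strict_trans)
    have "measure N (B \<inter> E k) \<le> measure N B"
      using B fin by (intro measure_mono_fmeasurable) (auto simp: fmeasurable_def)
    moreover have "measure N B < e / (2 * real (Suc k))"
      using B(2) fin e by (simp add: emeasure_eq_ennreal_measure less_top ennreal_less_iff)
    moreover have "mass N g (B \<inter> E k) \<le> real (Suc k) * measure N (B \<inter> E k)"
    proof (rule mass_bounded_le[OF g])
      show "emeasure N (B \<inter> E k) < \<infinity>"
        by (rule le_less_trans[OF emeasure_mono fin]) (use B in auto)
      show "B \<inter> E k \<in> sets N" using B by simp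
    qed (auto simp: E_def)
    ultimately have "mass N g (B \<inter> E k) \<le> real (Suc k) * (e / (2 * real (Suc k)))"
      by (smt (verit) mult_left_mono of_nat_0_le_iff)
    also have "\<dots> = e / 2" by (simp del: of_nat_Suc)
    finally have "mass N g (B \<inter> E k) \<le> e / 2" .
    moreover have "(space N - E k) \<union> B = (space N - E k) \<union> (B \<inter> E k)"
      using sets.sets_into_space[OF B(1)] by auto
    moreover have "mass N g ((space N - E k) \<union> (B \<inter> E k)) \<le> mass N g (space N - E k) + mass N g (B \<inter> E k)"
      using B by (intro mass_Un[OF g]) auto
    ultimately show ?thesis using k by simp
  qed
  moreover have "0 < e / (2 * real (Suc k))" using e by simp
  ultimately show ?thesis using E E_fin by blast
qed

text \<open>
  The functionals given by bounded densities; they separate points and determine the norm.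
\<close>

definition pairing :: "'b measure \<Rightarrow> ('b \<Rightarrow> 'k) \<Rightarrow> ('b \<Rightarrow> 'k::{real_normed_field,banach,second_countable_topology}) set \<Rightarrow> 'k" where
  "pairing N h F = (LINT x|N. h x * rep F x)"

lemma bounded_op_pairing:
  fixes h :: "'b \<Rightarrow> 'k::{real_normed_field,banach,second_countable_topology}"
  assumes h: "h \<in> borel_measurable N" "\<And>x. norm (h x) \<le> c"
  shows "bounded_op (L1 N) scalar_space (pairing N h)"
  unfolding bounded_op_def scalar_space_def nspace.select_convs
proof (intro conjI ballI allI exI[of _ c])
  note int = integrable_bounded_mult[OF integrable_rep h]
  fix F G :: "('b \<Rightarrow> 'k) set" and a :: 'k assume F: "F \<in> vecs (L1 N)"
  have "pairing N h (vscale (L1 N) a F) = (LINT x|N. a * (h x * rep F x))"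
    unfolding pairing_def using rep_vscale[OF F, of a] h int[OF F] int[OF vscale_in[OF F, of a]]
    by (intro integral_cong_AE) auto
  then show "pairing N h (vscale (L1 N) a F) = a * pairing N h F"
    by (simp add: pairing_def)
  show "norm (pairing N h F) \<le> c * vnorm (L1 N) F"
  proof -
    have "norm (pairing N h F) \<le> (LINT x|N. c * norm (rep F x))"
      unfolding pairing_def using int[OF F] integrable_rep[OF F] h
      by (intro order_trans[OF integral_norm_bound] integral_mono integrable_norm)
         (auto simp: norm_mult intro!: mult_right_mono)
    then show ?thesis by (simp add: vnorm_L1[OF F] mass_space[OF integrable_rep[OF F]])
  qed
  assume G: "G \<in> vecs (L1 N)"
  have "pairing N h (vadd (L1 N) F G) = (LINT x|N. h x * rep F x + h x * rep G x)"
    unfolding pairing_def using rep_vadd[OF F G] h int[OF F] int[OF G] int[OF vadd_in[OF F G]]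
    by (intro integral_cong_AE) (auto simp: distrib_left)
  then show "pairing N h (vadd (L1 N) F G) = pairing N h F + pairing N h G"
    using int[OF F] int[OF G] by (simp add: pairing_def)
qed auto

lemma topspace_weak_topology: "topspace (weak_topology E) \<subseteq> vecs E"
  by (auto simp: weak_topology_def topology_generated_by_topspace)

lemma openin_weak_topology:
  "bounded_op E scalar_space \<phi> \<Longrightarrow> open V \<Longrightarrow> openin (weak_topology E) {x \<in> vecs E. \<phi> x \<in> V}"
  unfolding weak_topology_def by (rule topology_generated_by_Basis) blast

text \<open>
  This is the hard half of the Dunford-Pettis theorem. If the conclusion fails, one finds
  \<open>F\<^sub>n\<close> in \<open>S\<close> and sets \<open>C\<^sub>n\<close> such that
  \<open>F\<^sub>n\<close> has mass above \<open>e\<close> on \<open>C\<^sub>n\<close>, whereas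
  \<open>F\<^sub>0, \<dots>, F\<^sub>n\<^sub>-\<^sub>1\<close> have almost none there: a single integrable
  function is small on the sets that witness the failure. Removing from each \<open>C\<^sub>n\<close> the later
  ones gives disjoint sets \<open>D\<^sub>n\<close>, still with mass at least \<open>e/2\<close> of
  \<open>F\<^sub>n\<close>. The mass of \<open>F\<^sub>n\<close> on the earlier sets is not controlled;
  Rosenthal's lemma passes to a subsequence for which all off-diagonal masses together are at most
  \<open>e/8\<close>.

  Let \<open>h\<^sub>p\<close> be the sign function of \<open>F\<^bsub>k q\<^esub>\<close> on each
  \<open>D\<^bsub>k q\<^esub>\<close> with \<open>q \<ge> p\<close>, and \<open>0\<close> elsewhere. For fixed
  \<open>G\<close> the pairing with \<open>h\<^sub>p\<close> tends to \<open>0\<close>, so that \<open>K\<close>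
  is covered by the weakly open sets on which it is below \<open>e/4\<close>. But for \<open>q \<ge> p\<close>
  the pairing of \<open>h\<^sub>p\<close> with \<open>F\<^bsub>k q\<^esub>\<close> has absolute value at least
  \<open>e/4\<close>, so no finitely many of these sets cover \<open>K\<close>.
\<close>

lemma weakly_compact_imp_mass_small:
  fixes S K :: "('b \<Rightarrow> 'k::{real_normed_field,banach,second_countable_topology}) set set"
  assumes K: "compactin (weak_topology (L1 N)) K" and SK: "S \<subseteq> K"
    and R: "\<And>F. F \<in> S \<Longrightarrow> vnorm (L1 N) F \<le> R" and e: "0 < e"
  shows "\<exists>\<Theta>\<in>sets N. emeasure N \<Theta> < \<infinity> \<and> (\<exists>\<delta>>0. \<forall>F\<in>S. \<forall>B\<in>sets N. emeasure N B < ennreal \<delta> \<longrightarrow>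
           mass N (rep F) ((space N - \<Theta>) \<union> B) \<le> e)"
proof (rule ccontr)
  assume neg: "\<not> ?thesis"
  have K_vecs: "K \<subseteq> vecs (L1 N)"
    using K topspace_weak_topology by (force simp: compactin_def)
  note int = integrable_rep[OF subsetD[OF K_vecs]] integrable_rep[OF subsetD[OF order_trans[OF SK K_vecs]]]
  have escape: "\<exists>F\<in>S. \<exists>C\<in>sets N. e < mass N (rep F) C \<and> mass N g C \<le> d"
    if g: "integrable N g" and d: "0 < d" for g :: "'b \<Rightarrow> real" and d
  proof -
    obtain \<Theta> \<delta> where \<Theta>: "\<Theta> \<in> sets N" "emeasure N \<Theta> < \<infinity>" "0 < \<delta>"
      and small: "\<And>B. B \<in> sets N \<Longrightarrow> emeasure N B < ennreal \<delta> \<Longrightarrow> mass N g ((space N - \<Theta>) \<union> B) \<le> d"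
      using mass_small_outside[OF g d] by blast
    obtain F B where "F \<in> S" "B \<in> sets N" "emeasure N B < ennreal \<delta>"
      "e < mass N (rep F) ((space N - \<Theta>) \<union> B)"
      using neg \<Theta> by (meson not_le)
    with small[of B] \<Theta>(1) show ?thesis
      by (intro bexI[of _ F] bexI[of _ "(space N - \<Theta>) \<union> B"]) auto
  qed
  \<comment> \<open>The third component dominates the norms of all functions chosen so far.\<close>
  define P where "P n p \<longleftrightarrow> (case p of (F, C, g) \<Rightarrow> F \<in> S \<and> C \<in> sets N \<and> e < mass N (rep F) C \<and>
      integrable N g \<and> (\<forall>x. norm (rep F x) \<le> g x))" for n :: nat and p :: "('b \<Rightarrow> 'k) set \<times> 'b set \<times> ('b \<Rightarrow> real)"
  define Q where "Q n p p' \<longleftrightarrow> (case p of (F, C, g) \<Rightarrow> case p' of (F', C', g') \<Rightarrow>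
      mass N g C' \<le> e / 2 * (1/2) ^ (n + 2) \<and> (\<forall>x. g x \<le> g' x))"
    for n :: nat and p p' :: "('b \<Rightarrow> 'k) set \<times> 'b set \<times> ('b \<Rightarrow> real)"
  have "\<exists>f. \<forall>n. P n (f n) \<and> Q n (f n) (f (Suc n))"
  proof (rule dependent_nat_choice)
    obtain F C where "F \<in> S" "C \<in> sets N" "e < mass N (rep F) C"
      using escape[of "\<lambda>_. 0" 1] by auto
    then show "\<exists>p. P 0 p"
      using int(2)[of F] by (intro exI[of _ "(F, C, \<lambda>x. norm (rep F x))"]) (auto simp: P_def)
  next
    fix p n assume p: "P n p"
    obtain F C g where [simp]: "p = (F, C, g)" by (cases p) auto
    have g: "integrable N g" and Fg: "\<And>x. norm (rep F x) \<le> g x" using p by (auto simp: P_def)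
    have "0 < e / 2 * (1/2) ^ (n + 2)" using e by simp
    then obtain F' C' where F': "F' \<in> S" "C' \<in> sets N" "e < mass N (rep F') C'"
      "mass N g C' \<le> e / 2 * (1/2) ^ (n + 2)"
      using escape[OF g] by metis
    have "0 \<le> g x" for x using Fg[of x] norm_ge_zero[of "rep F x"] by linarith
    then show "\<exists>p'. P (Suc n) p' \<and> Q n p p'"
      using F' int(2)[of F'] g
      by (intro exI[of _ "(F', C', \<lambda>x. g x + norm (rep F' x))"]) (auto simp: P_def Q_def)
  qed
  then obtain f where f: "\<And>n. P n (f n)" "\<And>n. Q n (f n) (f (Suc n))" by blast
  define F where "F n = fst (f n)" for n
  define C where "C n = fst (snd (f n))" for n
  define g where "g n = snd (snd (f n))" for n
  have f_eq: "f n = (F n, C n, g n)" for n by (simp add: F_def C_def g_def)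
  have FS: "F n \<in> S" and C[measurable]: "C n \<in> sets N" and big: "e < mass N (rep (F n)) (C n)"
    and g: "integrable N (g n)" and Fg: "norm (rep (F n) x) \<le> g n x" for n x
    using f(1)[of n] by (auto simp: P_def f_eq)
  have gC: "mass N (g n) (C (Suc n)) \<le> e / 2 * (1/2) ^ (n + 2)" and g_Suc: "g n x \<le> g (Suc n) x" for n x
    using f(2)[of n] by (auto simp: Q_def f_eq)
  have Fint: "integrable N (rep (F n))" for n by (rule int(2)[OF FS])
  have FC: "mass N (rep (F n)) (C m) \<le> e / 2 * (1/2) ^ (m + 1)" if "n < m" for n m
  proof -
    obtain m' where m: "m = Suc m'" "n \<le> m'" using \<open>n < m\<close> by (cases m) auto
    have "norm (rep (F n) x) \<le> \<bar>g m' x\<bar>" for x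
      using Fg[where n = n and x = x] lift_Suc_mono_le[of "\<lambda>i. g i x", OF g_Suc m(2)] by linarith
    then have "mass N (rep (F n)) (C m) \<le> mass N (g m') (C m)"
      unfolding mass_def using integrable_mass[OF Fint C] integrable_mass[OF g C]
      by (intro integral_mono) (auto intro!: mult_left_mono)
    then show ?thesis using gC[of m'] by (simp add: m)
  qed
  define D where "D n = C n - (\<Union>i. C (n + 1 + i))" for n
  have D[measurable]: "D n \<in> sets N" for n unfolding D_def by measurable
  have D_disj: "D n \<inter> D m = {}" if "n \<noteq> m" for n m
  proof -
    have "D n \<inter> D m = {}" if "n < m" for n m
    proof -
      have "m = n + 1 + (m - n - 1)" using that by simp
      then have "C m \<subseteq> (\<Union>i. C (n + 1 + i))" by (metis UN_upper UNIV_I)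
      then show ?thesis by (auto simp: D_def)
    qed
    then show ?thesis using \<open>n \<noteq> m\<close> by (metis Int_commute linorder_neqE_nat)
  qed
  have D_big: "e / 2 \<le> mass N (rep (F n)) (D n)" for n
  proof -
    have "mass N (rep (F n)) (\<Union>i. C (n + 1 + i)) \<le> e / 2"
    proof (rule mass_UN_le[OF Fint])
      fix k
      have "(\<Sum>i<k. mass N (rep (F n)) (C (n + 1 + i))) \<le> (\<Sum>i<k. e / 2 * (1/2) ^ (i + 1))"
      proof (rule sum_mono)
        fix i
        have "mass N (rep (F n)) (C (n + 1 + i)) \<le> e / 2 * (1/2) ^ (n + 1 + i + 1)"
          by (rule FC) simp
        also have "\<dots> \<le> e / 2 * (1/2) ^ (i + 1)"
          using e by (intro mult_left_mono power_decreasing) auto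
        finally show "mass N (rep (F n)) (C (n + 1 + i)) \<le> e / 2 * (1/2) ^ (i + 1)" .
      qed
      also have "\<dots> = e / 2 * (1 - (1/2) ^ k)"
        by (induction k) (simp_all add: field_simps)
      also have "\<dots> \<le> e / 2" using e by simp
      finally show "(\<Sum>i<k. mass N (rep (F n)) (C (n + 1 + i))) \<le> e / 2" .
    qed simp
    moreover have "mass N (rep (F n)) (C n) - mass N (rep (F n)) (\<Union>i. C (n + 1 + i)) \<le> mass N (rep (F n)) (D n)"
      unfolding D_def by (rule mass_Diff[OF Fint]) measurable
    ultimately show ?thesis using big[of n] by linarith
  qed
  have bound: "(\<Sum>m\<in>G. mass N (rep (F n)) (D m)) \<le> R" if "finite G" for n G
  proof -
    have "(\<Sum>m\<in>G. mass N (rep (F n)) (D m)) = mass N (rep (F n)) (\<Union>m\<in>G. D m)"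
      using that D_disj by (intro mass_UN_disjoint[OF Fint, symmetric]) (auto simp: disjoint_family_on_def)
    also have "\<dots> \<le> mass N (rep (F n)) (space N)"
      using that sets.sets_into_space[OF D] by (intro mass_mono[OF Fint]) auto
    also have "\<dots> \<le> R" using R[OF FS, of n] vnorm_L1[of "F n" N] FS[of n] SK K_vecs by auto
    finally show ?thesis .
  qed
  obtain k :: "nat \<Rightarrow> nat" where k: "inj k" and offdiag:
    "\<And>p G. finite G \<Longrightarrow> p \<notin> G \<Longrightarrow> (\<Sum>q\<in>G. mass N (rep (F (k p))) (D (k q))) \<le> e / 8"
  proof -
    have "\<exists>k::nat \<Rightarrow> nat. inj k \<and>
        (\<forall>p G. finite G \<longrightarrow> p \<notin> G \<longrightarrow> (\<Sum>q\<in>G. mass N (rep (F (k p))) (D (k q))) \<le> e / 8)"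
      by (rule Rosenthal_matrix[of _ "e / 8" R]) (use e bound mass_nonneg in auto)
    then show thesis by (elim exE conjE) (rule that, assumption, simp)
  qed
  define j where "j x = (LEAST q. x \<in> D (k q))" for x
  define V where "V p = (\<Union>i. D (k (p + i)))" for p
  have V[measurable]: "V p \<in> sets N" for p unfolding V_def by measurable
  have j_eq: "j x = q" if "x \<in> D (k q)" for x q
    unfolding j_def
  proof (rule Least_equality)
    fix r assume "x \<in> D (k r)"
    then have "k r = k q" using D_disj[of "k r" "k q"] that by auto
    then show "q \<le> r" using k by (simp add: inj_eq)
  qed fact
  define h where "h p x = indicator (V p) x * (of_real (norm (rep (F (k (j x))) x)) / rep (F (k (j x))) x)" for p x
  have h_meas: "h p \<in> borel_measurable N" for p
  proof -
    have [measurable]: "j \<in> measurable N (count_space UNIV)" unfolding j_def by measurable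
    have [measurable]: "rep (F n) \<in> borel_measurable N" for n using Fint by auto
    have "(\<lambda>x. (\<lambda>q x. of_real (norm (rep (F (k q)) x)) / rep (F (k q)) x) (j x) x) \<in> borel_measurable N"
      by (rule measurable_compose_countable) measurable
    then show ?thesis unfolding h_def by measurable
  qed
  have h_le: "norm (h p x) \<le> 1" for p x
    by (auto simp: h_def norm_mult norm_divide indicator_def)
  have small: "\<exists>p. norm (pairing N (h p) G) < e / 4" if G: "G \<in> K" for G
  proof -
    have "decseq V" unfolding decseq_def V_def
    proof (intro allI impI subsetI)
      fix m n x assume "m \<le> n" "x \<in> (\<Union>i. D (k (n + i)))"
      then obtain i where "x \<in> D (k (m + (n - m + i)))" by auto
      then show "x \<in> (\<Union>i. D (k (m + i)))" by blast
    qed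
    moreover have "(\<Inter>p. V p) = {}"
    proof -
      have False if x: "\<And>p. x \<in> V p" for x
      proof -
        obtain i i' where "x \<in> D (k (0 + i))" "x \<in> D (k (Suc i + i'))" using x[of 0] x[of "Suc i" for i]
          unfolding V_def by blast
        then show False using j_eq[of x i] j_eq[of x "Suc i + i'"] by auto
      qed
      then show ?thesis by blast
    qed
    ultimately have "(\<lambda>p. mass N (rep G) (V p)) \<longlonglongrightarrow> 0"
      using mass_decseq[OF int(1)[OF G], of V] by (simp add: mass_def)
    then have "eventually (\<lambda>p. mass N (rep G) (V p) < e / 4) sequentially"
      using e by (intro order_tendstoD(2)) auto
    then obtain p where "mass N (rep G) (V p) < e / 4" by (auto simp: eventually_sequentially)
    moreover have "norm (pairing N (h p) G) \<le> 1 * mass N (rep G) (V p)"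
      unfolding pairing_def by (rule norm_integral_mult_le_mass[OF int(1)[OF G] V h_meas])
        (auto simp: h_def norm_mult norm_divide indicator_def)
    ultimately show ?thesis by (intro exI[of _ p]) simp
  qed
  have large: "e / 4 \<le> norm (pairing N (h p) (F (k q)))" if "p \<le> q" for p q
  proof -
    let ?u = "rep (F (k q))"
    define h1 where "h1 x = indicator (D (k q)) x * (of_real (norm (?u x)) / ?u x)" for x
    define h2 where "h2 x = (1 - indicator (D (k q)) x) * h p x" for x
    have u[measurable]: "?u \<in> borel_measurable N" using Fint by auto
    note h_meas[measurable]
    have h1: "h1 \<in> borel_measurable N" unfolding h1_def by measurable
    have h2: "h2 \<in> borel_measurable N" unfolding h2_def by measurable
    have le1: "norm (h1 x) \<le> 1" "norm (h2 x) \<le> 1" for x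
      by (auto simp: h1_def h2_def h_def indicator_def norm_mult norm_divide)
    have DV: "D (k q) \<subseteq> V p" unfolding V_def using \<open>p \<le> q\<close> by (auto intro!: exI[of _ "q - p"])
    have "h p x = h1 x + h2 x" for x
      using DV j_eq[of x q] by (auto simp: h1_def h2_def h_def indicator_def)
    then have "pairing N (h p) (F (k q)) = (LINT x|N. h1 x * ?u x + h2 x * ?u x)"
      unfolding pairing_def by (simp add: distrib_right)
    also have "\<dots> = (LINT x|N. h1 x * ?u x) + (LINT x|N. h2 x * ?u x)"
      by (intro Bochner_Integration.integral_add integrable_bounded_mult[OF Fint, where c = 1] h1 h2 le1)
    also have "(LINT x|N. h1 x * ?u x) = of_real (mass N ?u (D (k q)))"
    proof -
      have "h1 x * ?u x = of_real (indicator (D (k q)) x * norm (?u x))" for x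
        by (auto simp: h1_def indicator_def)
      then have "(LINT x|N. h1 x * ?u x) = (LINT x|N. of_real (indicator (D (k q)) x * norm (?u x)))"
        by (rule arg_cong[of _ _ "integral\<^sup>L N", OF ext])
      also have "\<dots> = of_real (mass N ?u (D (k q)))"
        unfolding mass_def by (rule integral_of_real) (rule integrable_mass[OF Fint D])
      finally show ?thesis .
    qed
    finally have eq: "pairing N (h p) (F (k q)) = of_real (mass N ?u (D (k q))) + (LINT x|N. h2 x * ?u x)" .
    define A where "A i = (if i = q then {} else D (k i))" for i
    have A[measurable]: "A i \<in> sets N" for i by (auto simp: A_def)
    have "norm (LINT x|N. h2 x * ?u x) \<le> 1 * mass N ?u (\<Union>i. A i)"
    proof (rule norm_integral_mult_le_mass[OF Fint _ h2])
      fix x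
      have "x \<in> (\<Union>i. A i)" if "x \<in> V p" "x \<notin> D (k q)"
        using that by (auto simp: V_def A_def split: if_splits)
      then show "norm (h2 x) \<le> 1 * indicator (\<Union>i. A i) x"
        using h_le[of p x] by (auto simp: h2_def h_def indicator_def)
    qed measurable
    also have "mass N ?u (\<Union>i. A i) \<le> e / 8"
    proof (rule mass_UN_le[OF Fint A])
      fix n
      have "(\<Sum>i<n. mass N ?u (A i)) = (\<Sum>i\<in>{..<n} - {q}. mass N ?u (D (k i)))"
        by (intro sum.mono_neutral_cong_right) (auto simp: A_def mass_def)
      then show "(\<Sum>i<n. mass N ?u (A i)) \<le> e / 8" using offdiag[of "{..<n} - {q}" q] by simp
    qed
    finally have "norm (LINT x|N. h2 x * ?u x) \<le> e / 8" by simp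
    moreover have "norm (of_real (mass N ?u (D (k q))) :: 'k) \<ge> e / 2"
      using D_big[of "k q"] e by simp
    ultimately show ?thesis unfolding eq
      using norm_diff_ineq[of "of_real (mass N ?u (D (k q)))" "LINT x|N. h2 x * ?u x"] e by linarith
  qed
  define Op where "Op p = {G \<in> vecs (L1 N). pairing N (h p) G \<in> ball 0 (e / 4)}" for p
  have "openin (weak_topology (L1 N)) (Op p)" for p
    unfolding Op_def using bounded_op_pairing[OF h_meas h_le] by (intro openin_weak_topology) auto
  moreover have "K \<subseteq> \<Union>(range Op)" using small K_vecs by (auto simp: Op_def)
  ultimately obtain \<F> where "finite \<F>" "\<F> \<subseteq> range Op" "K \<subseteq> \<Union>\<F>"
    using K unfolding compactin_def by (metis (no_types, lifting) imageE)
  then obtain I where I: "finite I" "K \<subseteq> (\<Union>p\<in>I. Op p)"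
    by (metis finite_subset_image)
  define q where "q = Max (insert 0 I)"
  have "F (k q) \<in> K" using FS SK by auto
  then obtain p where "p \<in> I" "F (k q) \<in> Op p" using I by auto
  then show False using large[of p q] I(1) by (auto simp: q_def Op_def)
qed

section \<open>Weak limits of equi-integrable families\<close>

lemma integrable_max0:
  fixes f :: "'b \<Rightarrow> real"
  assumes "integrable N f" shows "integrable N (\<lambda>x. max 0 (f x))"
  using assms by (intro integrable_max) auto

text \<open>
  A form of the Radon-Nikodym theorem for set functions that arise as limits: finite additivity together with
  absolute continuity with respect to the finite measure \<open>mass N w\<close> gives countable additivity. The
  density is taken with respect to \<open>N\<close> itself, although \<open>N\<close> may be far from
  \<open>\<sigma>\<close>-finite: it is the density with respect to \<open>mass N w\<close>, multiplied by
  \<open>w\<close>.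
\<close>

lemma mass_density_additive:
  fixes w :: "'b \<Rightarrow> real" and p :: "'b set \<Rightarrow> real"
  assumes w: "integrable N w"
    and p_nonneg: "\<And>A. A \<in> sets N \<Longrightarrow> 0 \<le> p A"
    and p_add: "\<And>A B. A \<in> sets N \<Longrightarrow> B \<in> sets N \<Longrightarrow> A \<inter> B = {} \<Longrightarrow> p (A \<union> B) = p A + p B"
    and p_cont: "\<And>e. 0 < e \<Longrightarrow> \<exists>\<rho>>0. \<forall>A\<in>sets N. mass N w A < \<rho> \<longrightarrow> p A \<le> e"
  obtains u :: "'b \<Rightarrow> real" where "integrable N u" "\<And>x. 0 \<le> u x" "\<And>x. w x = 0 \<Longrightarrow> u x = 0"
    "\<And>A. A \<in> sets N \<Longrightarrow> (LINT x|N. indicator A x * u x) = p A"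
proof -
  let ?M = "density N (\<lambda>x. ennreal (norm (w x)))"
  interpret M: finite_measure ?M by (rule mass_density(1)[OF w])
  define Q where "Q = measure_of (space N) (sets N) (\<lambda>A. ennreal (p A))"
  have p_empty: "p {} = 0" using p_add[of "{}" "{}"] by simp
  have Q: "emeasure Q A = ennreal (p A)" if A: "A \<in> sets N" for A
    unfolding Q_def
  proof (rule emeasure_measure_of_sigma)
    show pos: "positive (sets N) (\<lambda>A. ennreal (p A))" by (simp add: positive_def p_empty)
    show "countably_additive (sets N) (\<lambda>A. ennreal (p A))"
    proof (rule sets.empty_continuous_imp_countably_additive[OF pos])
      show "additive (sets N) (\<lambda>A. ennreal (p A))"
        by (auto simp: additive_def p_add p_nonneg)
      fix A :: "nat \<Rightarrow> 'b set" assume A: "range A \<subseteq> sets N" "decseq A" "(\<Inter>i. A i) = {}"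
      then have lim: "(\<lambda>i. mass N w (A i)) \<longlonglongrightarrow> 0"
        using mass_decseq[OF w, of A] by (auto simp: mass_def)
      have "(\<lambda>i. p (A i)) \<longlonglongrightarrow> 0"
      proof (rule order_tendstoI)
        fix e :: real assume "0 < e"
        then obtain \<rho> where \<rho>: "0 < \<rho>" "\<And>A. A \<in> sets N \<Longrightarrow> mass N w A < \<rho> \<Longrightarrow> p A \<le> e / 2"
          using p_cont[of "e / 2"] by auto
        have "eventually (\<lambda>i. mass N w (A i) < \<rho>) sequentially" using order_tendstoD(2)[OF lim \<rho>(1)] .
        then show "eventually (\<lambda>i. p (A i) < e) sequentially"
        proof eventually_elim
          case (elim i)
          then show ?case using \<rho>(2)[of "A i"] A(1) \<open>0 < e\<close> by force
        qed
      next
        fix e :: real assume "e < 0"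
        have "e < p (A i)" for i using p_nonneg[of "A i"] A(1) \<open>e < 0\<close> by (simp add: image_subset_iff)
        then show "eventually (\<lambda>i. e < p (A i)) sequentially" by simp
      qed
      from tendsto_ennrealI[OF this] show "(\<lambda>i. ennreal (p (A i))) \<longlonglongrightarrow> 0" by simp
    qed simp
  qed (use A sets.sigma_algebra_axioms in auto)
  have sets_Q[simp]: "sets Q = sets N" and space_Q[simp]: "space Q = space N"
    by (simp_all add: Q_def sets.space_closed)
  have "\<exists>f\<in>borel_measurable ?M. density ?M f = Q"
  proof (rule M.Radon_Nikodym_finite_measure)
    show "finite_measure Q" by (rule finite_measureI) (simp add: Q)
    show "absolutely_continuous ?M Q"
      unfolding absolutely_continuous_def
    proof
      fix A assume "A \<in> null_sets ?M"
      then have A: "A \<in> sets N" and "mass N w A = 0"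
        using mass_density(2)[OF w, of A] mass_nonneg[of N w A] by (auto simp: null_sets_def)
      then have "p A \<le> e" if "0 < e" for e using p_cont[OF that] by force
      then have "p A \<le> 0" by (meson field_le_epsilon add_0 dense_ge)
      then show "A \<in> null_sets Q" using A p_nonneg[OF A] by (simp add: null_sets_def Q)
    qed
  qed simp
  then obtain f where f[measurable]: "f \<in> borel_measurable N" and fQ: "density ?M f = Q" by auto
  define v where "v x = ennreal (norm (w x)) * f x" for x
  have [measurable]: "w \<in> borel_measurable N" using w by auto
  have v[measurable]: "v \<in> borel_measurable N" unfolding v_def by measurable
  have "density N v = Q"
    using fQ by (subst (asm) density_density_eq) (auto simp: v_def[abs_def])
  then have vQ: "(\<integral>\<^sup>+x. v x * indicator A x \<partial>N) = ennreal (p A)" if "A \<in> sets N" for A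
    using emeasure_density[OF v that] Q[OF that] by simp
  have "(\<integral>\<^sup>+x. v x \<partial>N) = ennreal (p (space N))"
    using vQ[of "space N"] by (simp cong: nn_integral_cong)
  then have "AE x in N. v x \<noteq> \<infinity>" by (intro nn_integral_PInf_AE) auto
  then have v_fin: "AE x in N. ennreal (enn2real (v x)) = v x"
    by (auto elim!: eventually_mono simp: less_top)
  define u where "u x = enn2real (v x)" for x
  have [measurable]: "u \<in> borel_measurable N" unfolding u_def by measurable
  have u_nn: "(\<integral>\<^sup>+x. ennreal (indicator A x * u x) \<partial>N) = ennreal (p A)" if "A \<in> sets N" for A
  proof -
    have "(\<integral>\<^sup>+x. ennreal (indicator A x * u x) \<partial>N) = (\<integral>\<^sup>+x. v x * indicator A x \<partial>N)"
      using v_fin by (intro nn_integral_cong_AE) (auto elim!: eventually_mono simp: u_def indicator_def)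
    then show ?thesis using vQ[OF that] by simp
  qed
  show thesis
  proof
    show "0 \<le> u x" for x by (simp add: u_def)
    show "u x = 0" if "w x = 0" for x using that by (simp add: u_def v_def)
    have "(\<integral>\<^sup>+x. ennreal (u x) \<partial>N) = ennreal (p (space N))"
      using u_nn[of "space N"] by (simp cong: nn_integral_cong)
    then show "integrable N u"
      by (intro integrableI_nn_integral_finite[where x = "p (space N)"]) (auto simp: u_def)
    show "(LINT x|N. indicator A x * u x) = p A" if A: "A \<in> sets N" for A
      using u_nn[OF A] A p_nonneg[OF A] by (subst integral_eq_nn_integral) (auto simp: u_def)
  qed
qed

text \<open>
  Each coordinate is rounded down to a multiple of \<open>e / d\<close>, where \<open>d\<close> is the
  dimension.
\<close>

lemma simple_approx_bounded:
  fixes h :: "'b \<Rightarrow> 'k::euclidean_space"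
  assumes h[measurable]: "h \<in> borel_measurable N" and c: "\<And>x. norm (h x) \<le> c" and e: "0 < e"
  obtains s where "s \<in> borel_measurable N" "finite (range s)" "\<And>x. norm (h x - s x) \<le> e"
proof
  define d where "d = e / DIM('k)"
  have d: "0 < d" using e by (simp add: d_def)
  define s where "s x = (\<Sum>b\<in>Basis. (d * of_int \<lfloor>(h x \<bullet> b) / d\<rfloor>) *\<^sub>R b)" for x
  show "s \<in> borel_measurable N" unfolding s_def by measurable
  show "finite (range s)"
  proof (rule finite_subset)
    define m where "m = \<lceil>c / d\<rceil> + 1"
    have rng: "\<lfloor>(h x \<bullet> b) / d\<rfloor> \<in> {- m..m}" if b: "b \<in> Basis" for x b
    proof -
      have "\<bar>h x \<bullet> b\<bar> \<le> c" using c[of x] Basis_le_norm[OF b, of "h x"] by linarith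
      then have "\<bar>(h x \<bullet> b) / d\<bar> \<le> c / d" using d by (simp add: abs_divide divide_right_mono)
      moreover have "c / d \<le> of_int m - 1" by (simp add: m_def)
      moreover define y where "y = (h x \<bullet> b) / d"
      ultimately have "- of_int m \<le> y" "y < of_int m + 1" by linarith+
      then show ?thesis unfolding y_def[symmetric] by (simp add: le_floor_iff floor_le_iff)
    qed
    show "range s \<subseteq> (\<lambda>f. \<Sum>b\<in>Basis. (d * of_int (f b)) *\<^sub>R b) ` (PiE Basis (\<lambda>_. {- m..m}))"
    proof (intro image_subsetI)
      fix x
      show "s x \<in> (\<lambda>f. \<Sum>b\<in>Basis. (d * of_int (f b)) *\<^sub>R b) ` (PiE Basis (\<lambda>_. {- m..m}))"
        by (rule image_eqI[of _ _ "restrict (\<lambda>b. \<lfloor>(h x \<bullet> b) / d\<rfloor>) Basis"])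
           (use rng in \<open>auto simp: s_def\<close>)
    qed
    show "finite ((\<lambda>f. \<Sum>b\<in>Basis. (d * of_int (f b)) *\<^sub>R b :: 'k) ` (PiE Basis (\<lambda>_. {- m..m})))"
      by (intro finite_imageI finite_PiE) auto
  qed
  show "norm (h x - s x) \<le> e" for x
  proof -
    have "norm (h x - s x) \<le> (\<Sum>b\<in>Basis. \<bar>(h x - s x) \<bullet> b\<bar>)" by (rule norm_le_l1)
    also have "\<dots> \<le> (\<Sum>b\<in>(Basis::'k set). d)"
    proof (rule sum_mono)
      fix b :: 'k assume b: "b \<in> Basis"
      have "s x \<bullet> b = d * of_int \<lfloor>(h x \<bullet> b) / d\<rfloor>"
        using b by (simp add: s_def inner_sum_left inner_Basis if_distrib cong: if_cong)
      moreover have "d * of_int \<lfloor>(h x \<bullet> b) / d\<rfloor> \<le> d * ((h x \<bullet> b) / d)"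
          "d * ((h x \<bullet> b) / d) \<le> d * (of_int \<lfloor>(h x \<bullet> b) / d\<rfloor> + 1)"
        using d by (intro mult_left_mono; linarith)+
      then have "d * of_int \<lfloor>(h x \<bullet> b) / d\<rfloor> \<le> h x \<bullet> b" "h x \<bullet> b \<le> d * of_int \<lfloor>(h x \<bullet> b) / d\<rfloor> + d"
        using d by (simp_all add: distrib_left)
      ultimately show "\<bar>(h x - s x) \<bullet> b\<bar> \<le> d" by (simp add: inner_diff_left)
    qed
    also have "\<dots> = e" by (simp add: d_def)
    finally show ?thesis .
  qed
qed

text \<open>
  The modulus \<open>\<omega>\<close> is explicit, so that one modulus can be shared by a whole family of
  functions. Small sets are measured by the mass of the weight \<open>w\<close> rather than by \<open>N\<close>.
  This covers both halves of equi-integrability, since the complement of \<open>{x. \<epsilon> \<le> w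
  x}\<close> has little \<open>w\<close>-mass for small \<open>\<epsilon>\<close>.
\<close>

definition equi_bounded :: "'b measure \<Rightarrow> ('b \<Rightarrow> real) \<Rightarrow> (real \<Rightarrow> real) \<Rightarrow> real \<Rightarrow> ('b \<Rightarrow> 'k::real_normed_vector) \<Rightarrow> bool" where
  "equi_bounded N w \<omega> R g \<longleftrightarrow> mass N g (space N) \<le> R \<and>
     (\<forall>e>0. \<forall>A\<in>sets N. mass N w A < \<omega> e \<longrightarrow> mass N g A \<le> e)"

text \<open>
  Convergence against bounded densities only. For equi-bounded families this is convergence in the weak
  topology, by \<open>functional_density\<close> below.
\<close>

definition weak_lim :: "'i filter \<Rightarrow> 'b measure \<Rightarrow> ('i \<Rightarrow> 'b \<Rightarrow> 'k::{real_normed_field,banach,second_countable_topology}) \<Rightarrow> ('b \<Rightarrow> 'k) \<Rightarrow> bool" where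
  "weak_lim U N g u \<longleftrightarrow> integrable N u \<and> (\<forall>h\<in>borel_measurable N. \<forall>c. (\<forall>x. norm (h x) \<le> c) \<longrightarrow>
     ((\<lambda>i. LINT x|N. h x * g i x) \<longlongrightarrow> (LINT x|N. h x * u x)) U)"

text \<open>
  Weak lower semicontinuity of the norm of the restriction to \<open>A\<close>, by a norming function for the
  limit.
\<close>

lemma weak_lim_mass_le:
  fixes g :: "'i \<Rightarrow> 'b \<Rightarrow> 'k::{real_normed_field,banach,second_countable_topology}"
  assumes lim: "weak_lim U N g u" and U: "U \<noteq> bot" and A: "A \<in> sets N"
    and ev: "eventually (\<lambda>i. integrable N (g i) \<and> mass N (g i) A \<le> b) U"
  shows "mass N u A \<le> b"
proof -
  have u: "integrable N u" using lim by (simp add: weak_lim_def)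
  obtain h where h: "h \<in> borel_measurable N" "\<And>x. norm (h x) \<le> indicator A x"
    "(LINT x|N. h x * u x) = of_real (mass N u A)"
    using norming_function[OF u A] by blast
  have "norm (h x) \<le> 1" for x using h(2)[of x] by (cases "x \<in> A") auto
  then have "((\<lambda>i. LINT x|N. h x * g i x) \<longlongrightarrow> of_real (mass N u A)) U"
    using lim h(1) unfolding weak_lim_def h(3)[symmetric] by blast
  then have "((\<lambda>i. norm (LINT x|N. h x * g i x)) \<longlongrightarrow> norm (of_real (mass N u A) :: 'k)) U"
    by (rule tendsto_norm)
  moreover have "eventually (\<lambda>i. norm (LINT x|N. h x * g i x) \<le> b) U"
    using ev
  proof eventually_elim
    case (elim i)
    then show ?case using norm_integral_mult_le_mass[OF _ A h(1), of "g i" 1] h(2) by force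
  qed
  ultimately have "norm (of_real (mass N u A) :: 'k) \<le> b"
    by (rule tendsto_upperbound[OF _ _ U])
  then show ?thesis by simp
qed

text \<open>
  Along the ultrafilter, the integrals over each set of the positive and of the negative part of every real
  coordinate of \<open>g i\<close> converge. The limits are additive in the set and inherit the modulus, so that
  they have densities. Treating the two parts separately keeps the set functions nonnegative and avoids a Jordan
  decomposition. The limits for indicator functions extend to bounded densities by uniform approximation.
\<close>

lemma equi_bounded_weak_lim:
  fixes g :: "'i \<Rightarrow> 'b \<Rightarrow> 'k::{real_normed_field,euclidean_space}"
  assumes U: "ultrafilter U" and w: "integrable N w" and \<omega>: "\<And>e. 0 < e \<Longrightarrow> 0 < \<omega> e"
    and g: "eventually (\<lambda>i. integrable N (g i) \<and> equi_bounded N w \<omega> R (g i)) U"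
  shows "\<exists>u. weak_lim U N g u"
proof -
  have Ubot: "U \<noteq> bot" using U by (simp add: ultrafilter_def)
  define q where "q s b z = max 0 (s * (z \<bullet> b))" for s :: real and b z :: 'k
  let ?I = "\<lambda>s b A f. LINT x|N. indicator A x * q s b (f x)"
  have q_nonneg: "0 \<le> q s b z" for s b z by (simp add: q_def)
  have q_le: "q s b z \<le> norm z" if "b \<in> Basis" "s \<in> {1, -1}" for s b z
    using Basis_le_norm[OF that(1), of z] that(2) by (auto simp: q_def)
  have q_int: "integrable N (\<lambda>x. q s b (f x))" if "integrable N f" for s b f
    unfolding q_def using that by (intro integrable_max0) auto
  have q_int': "integrable N (\<lambda>x. indicator A x * q s b (f x))" if "integrable N f" "A \<in> sets N" for s b f A
    using integrable_mult_indicator[OF that(2) q_int[OF that(1)]] by simp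
  have I_le: "(?I s b A f) \<le> mass N f A"
    if "integrable N f" "A \<in> sets N" "b \<in> Basis" "s \<in> {1, -1}" for f A s b
    unfolding mass_def using that q_le
    by (intro integral_mono q_int' integrable_mass) (auto intro!: mult_left_mono)
  have I_nonneg: "0 \<le> (?I s b A f)" for A s b f
    by (intro integral_nonneg_AE) (auto simp: q_nonneg)
  define P where "P b s u \<longleftrightarrow> integrable N u \<and> (\<forall>A\<in>sets N.
      ((\<lambda>i. ?I s b A (g i)) \<longlongrightarrow> (LINT x|N. indicator A x * u x)) U)"
    for b s and u :: "'b \<Rightarrow> real"
  have ex: "\<exists>u. P b s u" if b: "b \<in> Basis" and s: "s \<in> {1, -1}" for b s
  proof -
    have "\<exists>l. ((\<lambda>i. ?I s b A (g i)) \<longlongrightarrow> l) U" if A: "A \<in> sets N" for A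
    proof (rule ultrafilter_tendsto_bounded[OF U])
      show "eventually (\<lambda>i. norm (?I s b A (g i)) \<le> R) U"
        using g
      proof eventually_elim
        case (elim i)
        have "mass N (g i) A \<le> mass N (g i) (space N)"
          using elim A sets.sets_into_space[OF A] by (intro mass_mono) auto
        then show ?case
          using elim I_le[OF _ A b s, of "g i"] I_nonneg[of A s b "g i"] by (auto simp: equi_bounded_def)
      qed
    qed
    then obtain p where p: "\<And>A. A \<in> sets N \<Longrightarrow>
        ((\<lambda>i. ?I s b A (g i)) \<longlongrightarrow> p A) U" by metis
    obtain u where "integrable N u" "\<And>A. A \<in> sets N \<Longrightarrow> (LINT x|N. indicator A x * u x) = p A"
    proof (rule mass_density_additive[OF w, of p])
      fix A assume A: "A \<in> sets N"
      show "0 \<le> p A"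
        by (rule tendsto_lowerbound[OF p[OF A] _ Ubot]) (simp add: I_nonneg)
      fix B assume B: "B \<in> sets N" and disj: "A \<inter> B = {}"
      have "((\<lambda>i. ?I s b (A \<union> B) (g i)) \<longlongrightarrow> p A + p B) U"
      proof (rule Lim_transform_eventually[OF tendsto_add[OF p[OF A] p[OF B]]])
        show "eventually (\<lambda>i. (?I s b A (g i)) + (?I s b B (g i))
            = (?I s b (A \<union> B) (g i))) U"
          using g
        proof eventually_elim
          case (elim i)
          then have "(?I s b A (g i)) + (?I s b B (g i))
              = (LINT x|N. indicator A x * q s b (g i x) + indicator B x * q s b (g i x))"
            using A B by (intro Bochner_Integration.integral_add[symmetric] q_int') auto
          also have "\<dots> = (?I s b (A \<union> B) (g i))"
            using disj by (intro Bochner_Integration.integral_cong) (auto simp: indicator_def)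
          finally show ?case .
        qed
      qed
      then show "p (A \<union> B) = p A + p B"
        using p[of "A \<union> B"] A B tendsto_unique[OF Ubot] by blast
    next
      fix e :: real assume e: "0 < e"
      have "p A \<le> e" if A: "A \<in> sets N" "mass N w A < \<omega> e" for A
      proof (rule tendsto_upperbound[OF p[OF A(1)] _ Ubot])
        show "eventually (\<lambda>i. (?I s b A (g i)) \<le> e) U"
          using g
        proof eventually_elim
          case (elim i)
          then show ?case using I_le[OF _ A(1) b s, of "g i"] A e by (force simp: equi_bounded_def)
        qed
      qed
      then show "\<exists>\<rho>>0. \<forall>A\<in>sets N. mass N w A < \<rho> \<longrightarrow> p A \<le> e" using \<omega>[OF e] by blast
    qed blast
    then show ?thesis using p unfolding P_def by (intro exI[of _ u]) auto
  qed
  define u where "u s b = (SOME u. P b s u)" for s b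
  have P: "P b s (u s b)" if "b \<in> Basis" "s \<in> {1, -1}" for b s
    unfolding u_def by (rule someI_ex[OF ex[OF that]])
  have u: "\<And>b s. b \<in> Basis \<Longrightarrow> s \<in> {1, -1} \<Longrightarrow> integrable N (u s b)"
    and u_lim: "\<And>b s A. b \<in> Basis \<Longrightarrow> s \<in> {1, -1} \<Longrightarrow> A \<in> sets N \<Longrightarrow>
      ((\<lambda>i. ?I s b A (g i)) \<longlongrightarrow> (LINT x|N. indicator A x * u s b x)) U"
    using P unfolding P_def by blast+
  define v where "v x = (\<Sum>b\<in>Basis. (u 1 b x - u (-1) b x) *\<^sub>R b)" for x
  have v: "integrable N v" unfolding v_def using u by (intro Bochner_Integration.integrable_sum) auto
  have lim_ind: "((\<lambda>i. LINT x|N. indicator A x *\<^sub>R g i x) \<longlongrightarrow> (LINT x|N. indicator A x *\<^sub>R v x)) U"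
    if A: "A \<in> sets N" for A
  proof -
    have comp: "(LINT x|N. indicator A x *\<^sub>R (\<Sum>b\<in>Basis. (f 1 b x - f (-1) b x) *\<^sub>R b))
        = (\<Sum>b\<in>Basis. ((LINT x|N. indicator A x * f 1 b x) - (LINT x|N. indicator A x * f (-1) b x)) *\<^sub>R b)"
      if f: "\<And>b s. b \<in> Basis \<Longrightarrow> s \<in> {1, -1} \<Longrightarrow> integrable N (f s b)" for f :: "real \<Rightarrow> 'k \<Rightarrow> 'b \<Rightarrow> real"
    proof -
      have fi: "integrable N (\<lambda>x. indicator A x * f s b x)" if "b \<in> Basis" "s \<in> {1, -1}" for b s
        using integrable_mult_indicator[OF A f[OF that]] by simp
      have "(LINT x|N. indicator A x *\<^sub>R (\<Sum>b\<in>Basis. (f 1 b x - f (-1) b x) *\<^sub>R b))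
        = (LINT x|N. (\<Sum>b\<in>Basis. (indicator A x * f 1 b x - indicator A x * f (-1) b x) *\<^sub>R b))"
        by (simp add: scaleR_sum_right right_diff_distrib)
      also have "\<dots> = (\<Sum>b\<in>Basis. (LINT x|N. (indicator A x * f 1 b x - indicator A x * f (-1) b x) *\<^sub>R b))"
        using fi by (intro Bochner_Integration.integral_sum integrable_scaleR_left Bochner_Integration.integrable_diff) auto
      also have "\<dots> = (\<Sum>b\<in>Basis. ((LINT x|N. indicator A x * f 1 b x) - (LINT x|N. indicator A x * f (-1) b x)) *\<^sub>R b)"
        using fi by (intro sum.cong refl) simp
      finally show ?thesis .
    qed
    have "((\<lambda>i. \<Sum>b\<in>Basis. ((?I 1 b A (g i)) - (?I (-1) b A (g i))) *\<^sub>R b)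
        \<longlongrightarrow> (\<Sum>b\<in>Basis. ((LINT x|N. indicator A x * u 1 b x) - (LINT x|N. indicator A x * u (-1) b x)) *\<^sub>R b)) U"
      using A by (intro tendsto_sum tendsto_scaleR tendsto_diff u_lim tendsto_const) auto
    moreover have "(\<Sum>b\<in>Basis. ((LINT x|N. indicator A x * u 1 b x) - (LINT x|N. indicator A x * u (-1) b x)) *\<^sub>R b)
        = (LINT x|N. indicator A x *\<^sub>R v x)"
      unfolding v_def using u by (subst comp) auto
    moreover have "eventually (\<lambda>i. (\<Sum>b\<in>Basis. ((?I 1 b A (g i)) - (?I (-1) b A (g i))) *\<^sub>R b)
        = (LINT x|N. indicator A x *\<^sub>R g i x)) U"
      using g
    proof eventually_elim
      case (elim i)
      have "q 1 b z - q (-1) b z = z \<bullet> b" for b z by (auto simp: q_def)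
      then have "g i x = (\<Sum>b\<in>Basis. (q 1 b (g i x) - q (-1) b (g i x)) *\<^sub>R b)" for x
        by (simp add: euclidean_representation)
      then have "(LINT x|N. indicator A x *\<^sub>R g i x)
          = (LINT x|N. indicator A x *\<^sub>R (\<Sum>b\<in>Basis. (q 1 b (g i x) - q (-1) b (g i x)) *\<^sub>R b))" by simp
      also have "\<dots> = (\<Sum>b\<in>Basis. ((?I 1 b A (g i)) - (?I (-1) b A (g i))) *\<^sub>R b)"
        using elim q_int by (intro comp) auto
      finally show ?case by simp
    qed
    ultimately show ?thesis by (simp only: Lim_transform_eventually)
  qed
  have lim_simple: "((\<lambda>i. LINT x|N. s x * g i x) \<longlongrightarrow> (LINT x|N. s x * v x)) U"
    if s[measurable]: "s \<in> borel_measurable N" and fin: "finite (range s)" for s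
  proof -
    let ?A = "\<lambda>c. s -` {c} \<inter> space N"
    have A: "?A c \<in> sets N" for c by measurable
    have eq: "(LINT x|N. s x * f x) = (\<Sum>c\<in>range s. c * (LINT x|N. indicator (?A c) x *\<^sub>R f x))"
      if f: "integrable N f" for f :: "'b \<Rightarrow> 'k"
    proof -
      have "(LINT x|N. s x * f x) = (LINT x|N. (\<Sum>c\<in>range s. c * (indicator (?A c) x *\<^sub>R f x)))"
      proof (rule Bochner_Integration.integral_cong[OF refl])
        fix x assume x: "x \<in> space N"
        have "(\<Sum>c\<in>range s. c * (indicator (?A c) x *\<^sub>R f x)) = (\<Sum>c\<in>{s x}. c * (indicator (?A c) x *\<^sub>R f x))"
          using fin by (intro sum.mono_neutral_right) (auto simp: indicator_def)
        then show "s x * f x = (\<Sum>c\<in>range s. c * (indicator (?A c) x *\<^sub>R f x))" using x by simp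
      qed
      also have "\<dots> = (\<Sum>c\<in>range s. LINT x|N. c * (indicator (?A c) x *\<^sub>R f x))"
        using f A by (intro Bochner_Integration.integral_sum integrable_mult_right integrable_mult_indicator)
      also have "\<dots> = (\<Sum>c\<in>range s. c * (LINT x|N. indicator (?A c) x *\<^sub>R f x))"
        by (intro sum.cong refl integral_mult_right_zero)
      finally show ?thesis .
    qed
    have "((\<lambda>i. \<Sum>c\<in>range s. c * (LINT x|N. indicator (?A c) x *\<^sub>R g i x))
        \<longlongrightarrow> (\<Sum>c\<in>range s. c * (LINT x|N. indicator (?A c) x *\<^sub>R v x))) U"
      by (intro tendsto_sum tendsto_mult tendsto_const lim_ind A)
    moreover have "eventually (\<lambda>i. (\<Sum>c\<in>range s. c * (LINT x|N. indicator (?A c) x *\<^sub>R g i x)) = (LINT x|N. s x * g i x)) U"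
      using g by eventually_elim (simp add: eq)
    ultimately show ?thesis unfolding eq[OF v] by (rule Lim_transform_eventually)
  qed
  have "((\<lambda>i. LINT x|N. h x * g i x) \<longlongrightarrow> (LINT x|N. h x * v x)) U"
    if h[measurable]: "h \<in> borel_measurable N" and c: "\<And>x. norm (h x) \<le> c" for h c
  proof (rule tendstoI)
    fix e :: real assume e: "0 < e"
    define r where "r = \<bar>R\<bar> + mass N v (space N) + 1"
    have r: "0 < r" "R \<le> r" "mass N v (space N) \<le> r" using mass_nonneg[of N v "space N"] by (auto simp: r_def)
    obtain s where s[measurable]: "s \<in> borel_measurable N" and fin: "finite (range s)"
      and hs: "\<And>x. norm (h x - s x) \<le> e / (3 * r)"
      using simple_approx_bounded[OF h c, of "e / (3 * r)"] e r(1) by auto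
    have close: "norm ((LINT x|N. h x * f x) - (LINT x|N. s x * f x)) \<le> e / 3"
      if f: "integrable N f" "mass N f (space N) \<le> r" for f :: "'b \<Rightarrow> 'k"
    proof -
      have hsi: "integrable N (\<lambda>x. (h x - s x) * f x)"
        by (rule integrable_bounded_mult[OF f(1) _ hs]) measurable
      have hi: "integrable N (\<lambda>x. h x * f x)" by (rule integrable_bounded_mult[OF f(1) h c])
      have "(\<lambda>x. s x * f x) = (\<lambda>x. h x * f x - (h x - s x) * f x)" by (auto simp: algebra_simps)
      then have si: "integrable N (\<lambda>x. s x * f x)" using hi hsi by simp
      have "norm ((LINT x|N. h x * f x) - (LINT x|N. s x * f x)) = norm (LINT x|N. (h x - s x) * f x)"
        using hi si by (simp add: left_diff_distrib)
      also have "\<dots> \<le> (LINT x|N. e / (3 * r) * norm (f x))"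
      proof (intro order_trans[OF integral_norm_bound] integral_mono)
        show "norm ((h x - s x) * f x) \<le> e / (3 * r) * norm (f x)" for x
          unfolding norm_mult by (rule mult_right_mono[OF hs norm_ge_zero])
      qed (use f(1) hsi in auto)
      also have "\<dots> = e / (3 * r) * mass N f (space N)" by (simp add: mass_space[OF f(1)])
      also have "\<dots> \<le> e / (3 * r) * r" using f(2) e r(1) by (intro mult_left_mono) auto
      also have "\<dots> = e / 3" using r(1) by simp
      finally show ?thesis .
    qed
    have "eventually (\<lambda>i. dist (LINT x|N. s x * g i x) (LINT x|N. s x * v x) < e / 3) U"
      by (rule tendstoD[OF lim_simple[OF s fin]]) (use e in simp)
    with g show "eventually (\<lambda>i. dist (LINT x|N. h x * g i x) (LINT x|N. h x * v x) < e) U"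
    proof eventually_elim
      case (elim i)
      have 1: "norm ((LINT x|N. h x * g i x) - (LINT x|N. s x * g i x)) \<le> e / 3"
        using elim r by (intro close) (auto simp: equi_bounded_def)
      have 2: "norm ((LINT x|N. h x * v x) - (LINT x|N. s x * v x)) \<le> e / 3"
        using v r by (intro close)
      show ?case
        using 1 2 elim(2) dist_triangle[of "LINT x|N. h x * g i x" "LINT x|N. h x * v x" "LINT x|N. s x * g i x"]
          dist_triangle[of "LINT x|N. s x * g i x" "LINT x|N. h x * v x" "LINT x|N. s x * v x"]
        by (simp add: dist_norm norm_minus_commute)
    qed
  qed
  then show ?thesis using v by (auto simp: weak_lim_def)
qed

lemma weak_lim_add:
  fixes f g :: "'i \<Rightarrow> 'b \<Rightarrow> 'k::{real_normed_field,banach,second_countable_topology}"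
  assumes 1: "weak_lim U N f u" and 2: "weak_lim U N g v"
    and ev: "eventually (\<lambda>i. integrable N (f i) \<and> integrable N (g i)) U"
  shows "weak_lim U N (\<lambda>i x. f i x + g i x) (\<lambda>x. u x + v x)"
  unfolding weak_lim_def
proof (intro conjI ballI allI impI)
  have u: "integrable N u" "integrable N v" using 1 2 by (simp_all add: weak_lim_def)
  then show "integrable N (\<lambda>x. u x + v x)" by simp
  fix h :: "'b \<Rightarrow> 'k" and c assume h: "h \<in> borel_measurable N" "\<forall>x. norm (h x) \<le> c"
  have eq: "(LINT x|N. h x * (p x + q x)) = (LINT x|N. h x * p x) + (LINT x|N. h x * q x)"
    if "integrable N p" "integrable N q" for p q :: "'b \<Rightarrow> 'k"
    using integrable_bounded_mult[OF that(1) h(1), of c] integrable_bounded_mult[OF that(2) h(1), of c] h(2)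
    by (simp add: distrib_left)
  have "((\<lambda>i. (LINT x|N. h x * f i x) + (LINT x|N. h x * g i x)) \<longlongrightarrow>
      (LINT x|N. h x * u x) + (LINT x|N. h x * v x)) U"
    using 1 2 h by (intro tendsto_add) (auto simp: weak_lim_def)
  moreover have "eventually (\<lambda>i. (LINT x|N. h x * f i x) + (LINT x|N. h x * g i x) = (LINT x|N. h x * (f i x + g i x))) U"
    using ev by eventually_elim (simp add: eq)
  ultimately show "((\<lambda>i. LINT x|N. h x * (f i x + g i x)) \<longlongrightarrow> (LINT x|N. h x * (u x + v x))) U"
    unfolding eq[OF u] by (rule Lim_transform_eventually)
qed

lemma weak_lim_cmult:
  fixes f :: "'i \<Rightarrow> 'b \<Rightarrow> 'k::{real_normed_field,banach,second_countable_topology}"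
  assumes "weak_lim U N f u"
  shows "weak_lim U N (\<lambda>i x. c * f i x) (\<lambda>x. c * u x)"
proof -
  have eq: "(LINT x|N. h x * (c * p x)) = c * (LINT x|N. h x * p x)" for h p :: "'b \<Rightarrow> 'k"
    by (subst integral_mult_right_zero[symmetric]) (simp add: mult_ac)
  show ?thesis using assms unfolding weak_lim_def eq
    by (intro conjI ballI allI impI tendsto_mult_left) (simp_all, blast)
qed

lemma weak_lim_const: "integrable N f \<Longrightarrow> weak_lim U N (\<lambda>_. f) f"
  by (simp add: weak_lim_def)

lemma weak_lim_cong_AE:
  fixes f :: "'i \<Rightarrow> 'b \<Rightarrow> 'k::{real_normed_field,banach,second_countable_topology}"
  assumes lim: "weak_lim U N f u" and v: "integrable N v" "AE x in N. u x = v x"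
  shows "weak_lim U N f v"
  unfolding weak_lim_def
proof (intro conjI v(1) ballI allI impI)
  fix h :: "'b \<Rightarrow> 'k" and c assume h: "h \<in> borel_measurable N" "\<forall>x. norm (h x) \<le> c"
  have "(LINT x|N. h x * u x) = (LINT x|N. h x * v x)"
    using lim v h(1) by (intro integral_cong_AE) (auto simp: weak_lim_def elim!: eventually_mono)
  moreover have "((\<lambda>i. LINT x|N. h x * f i x) \<longlongrightarrow> (LINT x|N. h x * u x)) U"
    using lim h unfolding weak_lim_def by blast
  ultimately show "((\<lambda>i. LINT x|N. h x * f i x) \<longlongrightarrow> (LINT x|N. h x * v x)) U" by simp
qed

lemma AE_eq_of_mass_diff:
  fixes f g :: "'b \<Rightarrow> 'k::{banach,second_countable_topology}"
  assumes "integrable N f" "integrable N g" "mass N (\<lambda>x. f x - g x) (space N) \<le> 0"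
  shows "AE x in N. f x = g x"
proof -
  have i: "integrable N (\<lambda>x. f x - g x)" using assms by simp
  have "(LINT x|N. norm (f x - g x)) = 0"
    unfolding mass_space[OF i, symmetric] by (rule antisym[OF assms(3) mass_nonneg])
  then show ?thesis using i by (subst (asm) integral_nonneg_eq_0_iff_AE) auto
qed

text \<open>
  The difference is a weak limit of zero, so lower semicontinuity of the norm applies.
\<close>

lemma weak_lim_unique:
  assumes U: "U \<noteq> bot" and 1: "weak_lim U N f u" and 2: "weak_lim U N g v"
    and ev: "eventually (\<lambda>i. integrable N (f i) \<and> f i = g i) U"
  shows "AE x in N. u x = v x"
proof (rule AE_eq_of_mass_diff)
  have "weak_lim U N (\<lambda>i x. f i x + (-1) * g i x) (\<lambda>x. u x + (-1) * v x)"
    using ev by (intro weak_lim_add weak_lim_cmult 1 2) (auto elim!: eventually_mono)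
  then have "weak_lim U N (\<lambda>i x. f i x - g i x) (\<lambda>x. u x - v x)" by simp
  then show "mass N (\<lambda>x. u x - v x) (space N) \<le> 0"
    by (rule weak_lim_mass_le[OF _ U]) (use ev in \<open>auto elim!: eventually_mono simp: mass_def\<close>)
qed (use 1 2 in \<open>auto simp: weak_lim_def\<close>)

section \<open>Weak compactness of equi-integrable balls\<close>

lemma AE_nonpos_of_integrals:
  fixes f :: "'b \<Rightarrow> real"
  assumes f: "integrable N f" and le: "\<And>A. A \<in> sets N \<Longrightarrow> (LINT x|N. indicator A x * f x) \<le> 0"
  shows "AE x in N. f x \<le> 0"
proof -
  let ?A = "{x \<in> space N. 0 < f x}"
  have A[measurable]: "?A \<in> sets N" using f by measurable
  have int: "integrable N (\<lambda>x. indicator ?A x * f x)"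
    using integrable_mult_indicator[OF A f] by simp
  moreover have nn: "AE x in N. 0 \<le> indicator ?A x * f x" by (auto simp: indicator_def)
  moreover have "(LINT x|N. indicator ?A x * f x) = 0"
    using le[OF A] integral_nonneg_AE[OF nn] by linarith
  ultimately have "AE x in N. indicator ?A x * f x = 0" by (simp add: integral_nonneg_eq_0_iff_AE)
  then show ?thesis using AE_space by eventually_elim (auto simp: indicator_def split: if_splits)
qed

context
  fixes N :: "'b measure" and \<phi> :: "('b \<Rightarrow> 'k::{real_normed_field,euclidean_space}) set \<Rightarrow> 'k"
  assumes \<phi>: "bounded_op (L1 N) scalar_space \<phi>"
begin

lemma functional_add:
  "integrable N f \<Longrightarrow> integrable N g \<Longrightarrow>
    \<phi> (ae_class N (\<lambda>x. f x + g x)) = \<phi> (ae_class N f) + \<phi> (ae_class N g)"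
  using \<phi> by (simp add: bounded_op_def scalar_space_def L1_add[symmetric] ae_class_in_L1)

lemma functional_scale:
  "integrable N f \<Longrightarrow> \<phi> (ae_class N (\<lambda>x. c * f x)) = c * \<phi> (ae_class N f)"
  using \<phi> by (simp add: bounded_op_def scalar_space_def L1_scale[symmetric] ae_class_in_L1)

lemma functional_bound:
  obtains c where "0 \<le> c" "\<And>f. integrable N f \<Longrightarrow> norm (\<phi> (ae_class N f)) \<le> c * mass N f (space N)"
proof -
  obtain c where c: "\<And>F. F \<in> vecs (L1 N) \<Longrightarrow> norm (\<phi> F) \<le> c * vnorm (L1 N) F"
    using \<phi> unfolding bounded_op_def scalar_space_def nspace.select_convs by blast
  have "norm (\<phi> (ae_class N f)) \<le> max 0 c * mass N f (space N)" if f: "integrable N f" for f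
  proof -
    have "norm (\<phi> (ae_class N f)) \<le> c * mass N f (space N)"
      using c[OF ae_class_in_L1[OF f]] by (simp only: L1_norm[OF f] mass_space[OF f])
    also have "\<dots> \<le> max 0 c * mass N f (space N)"
      by (intro mult_right_mono mass_nonneg) simp
    finally show ?thesis .
  qed
  then show thesis by (intro that[of "max 0 c"]) auto
qed

text \<open>
  The dual of \<open>L\<^sub>1\<close> on the support of the weight is \<open>L\<^sub>\<infinity>\<close>. The
  coordinates of \<open>A \<mapsto> \<phi>(1\<^sub>A w)\<close> are bounded by \<open>c\<close> times the mass
  of \<open>w\<close>; adding this bound makes them nonnegative, and the Radon-Nikodym theorem gives densities
  between \<open>0\<close> and \<open>2 c w\<close>. Dividing by \<open>w\<close> and undoing the shift leads to
  \<open>h\<close>. The representation then extends from the functions \<open>1\<^sub>A w\<close> to all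
  products \<open>w f\<close> by induction over functions integrable for the measure with density
  \<open>w\<close>.
\<close>

lemma functional_density:
  fixes w :: "'b \<Rightarrow> real"
  assumes w: "integrable N w" and w_nonneg: "\<And>x. 0 \<le> w x"
  shows "\<exists>h\<in>borel_measurable N. \<exists>c. (\<forall>x. norm (h x) \<le> c) \<and>
    (\<forall>f. integrable N f \<longrightarrow> (AE x in N. w x = 0 \<longrightarrow> f x = 0) \<longrightarrow>
       \<phi> (ae_class N f) = (LINT x|N. h x * f x))"
proof -
  have [measurable]: "w \<in> borel_measurable N" using w by auto
  obtain c where c: "0 \<le> c" and \<phi>_le: "\<And>f. integrable N f \<Longrightarrow> norm (\<phi> (ae_class N f)) \<le> c * mass N f (space N)"
    using functional_bound by blast
  define wA where "wA A x = (of_real (indicator A x * w x) :: 'k)" for A x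
  have iw: "integrable N (\<lambda>x. indicator A x * w x)" if "A \<in> sets N" for A
    using integrable_mult_indicator[OF that w] by simp
  have wA: "integrable N (wA A)" if "A \<in> sets N" for A
    unfolding wA_def using iw[OF that] by (rule integrable_of_real)
  have mass_wA: "mass N (wA A) (space N) = mass N w A" if "A \<in> sets N" for A
    unfolding mass_def wA_def using w_nonneg
    by (intro Bochner_Integration.integral_cong) (auto simp: indicator_def)
  have mass_w: "mass N w A = (LINT x|N. indicator A x * w x)" for A
    by (simp add: mass_def w_nonneg)
  define p where "p b A = c * mass N w A + \<phi> (ae_class N (wA A)) \<bullet> b" for b A
  have p_bounds: "0 \<le> p b A" "p b A \<le> 2 * c * mass N w A" if A: "A \<in> sets N" and b: "b \<in> Basis" for b A
  proof -
    have "\<bar>\<phi> (ae_class N (wA A)) \<bullet> b\<bar> \<le> c * mass N w A"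
      using \<phi>_le[OF wA[OF A], unfolded mass_wA[OF A]] Basis_le_norm[OF b, of "\<phi> (ae_class N (wA A))"]
      by linarith
    then show "0 \<le> p b A" "p b A \<le> 2 * c * mass N w A" by (auto simp: p_def)
  qed
  have p_add: "p b (A \<union> B) = p b A + p b B" if "A \<in> sets N" "B \<in> sets N" "A \<inter> B = {}" for b A B
  proof -
    have "wA (A \<union> B) = (\<lambda>x. wA A x + wA B x)" using that(3) by (auto simp: wA_def indicator_def fun_eq_iff)
    then have "\<phi> (ae_class N (wA (A \<union> B))) = \<phi> (ae_class N (wA A)) + \<phi> (ae_class N (wA B))"
      using functional_add[OF wA[OF that(1)] wA[OF that(2)]] by simp
    moreover have "mass N w (A \<union> B) = mass N w A + mass N w B"
      using mass_UN_disjoint[OF w, of "{True, False}" "\<lambda>t. if t then A else B"] that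
      by (auto simp: disjoint_family_on_def Int_commute Un_commute split: if_splits)
    ultimately show ?thesis by (simp add: p_def inner_add_left distrib_left)
  qed
  have "\<exists>u. integrable N u \<and> (\<forall>x. 0 \<le> u x) \<and> (\<forall>x. w x = 0 \<longrightarrow> u x = 0) \<and>
      (\<forall>A\<in>sets N. (LINT x|N. indicator A x * u x) = p b A)" if b: "b \<in> Basis" for b
  proof (rule mass_density_additive[OF w, of "p b"])
    fix e :: real assume e: "0 < e"
    have "p b A \<le> e" if A: "A \<in> sets N" "mass N w A < e / (2 * c + 1)" for A
    proof -
      have "p b A \<le> (2 * c + 1) * mass N w A"
        using p_bounds(2)[OF A(1) b] mass_nonneg[of N w A] by (simp add: distrib_right)
      also have "\<dots> \<le> e" using A(2) c by (simp add: field_simps)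
      finally show ?thesis .
    qed
    then show "\<exists>\<rho>>0. \<forall>A\<in>sets N. mass N w A < \<rho> \<longrightarrow> p b A \<le> e"
      using e c by (intro exI[of _ "e / (2 * c + 1)"]) auto
  qed (use p_bounds(1) p_add b in blast)+
  then obtain u where u: "\<And>b. b \<in> Basis \<Longrightarrow> integrable N (u b)" and u_nonneg: "\<And>b x. b \<in> Basis \<Longrightarrow> 0 \<le> u b x"
    and u0: "\<And>b x. b \<in> Basis \<Longrightarrow> w x = 0 \<Longrightarrow> u b x = 0"
    and up: "\<And>b A. b \<in> Basis \<Longrightarrow> A \<in> sets N \<Longrightarrow> (LINT x|N. indicator A x * u b x) = p b A"
    by metis
  \<comment> \<open>Clipping changes the quotient on a null set only, and makes it bounded everywhere.\<close>
  define r where "r b x = max (- c) (min c (u b x / w x - c))" for b x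
  have r_le: "\<bar>r b x\<bar> \<le> c" for b x using c by (auto simp: r_def)
  have r_meas: "r b \<in> borel_measurable N" if "b \<in> Basis" for b
    using u[OF that] unfolding r_def by measurable
  have rw: "AE x in N. r b x * w x = u b x - c * w x" if b: "b \<in> Basis" for b
  proof -
    have "AE x in N. u b x - 2 * c * w x \<le> 0"
    proof (rule AE_nonpos_of_integrals)
      fix A assume A: "A \<in> sets N"
      have "(LINT x|N. indicator A x * (u b x - 2 * c * w x))
          = (LINT x|N. indicator A x * u b x - 2 * c * (indicator A x * w x))"
        by (simp add: algebra_simps)
      also have "\<dots> = (LINT x|N. indicator A x * u b x) - 2 * c * (LINT x|N. indicator A x * w x)"
        using iw[OF A] integrable_mult_indicator[OF A u[OF b]] by (subst Bochner_Integration.integral_diff) auto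
      also have "\<dots> \<le> 0" using p_bounds(2)[OF A b] up[OF b A] by (simp add: mass_w)
      finally show "(LINT x|N. indicator A x * (u b x - 2 * c * w x)) \<le> 0" .
    qed (use u[OF b] w in auto)
    then show ?thesis
    proof eventually_elim
      case (elim x)
      show ?case
      proof (cases "w x = 0")
        case True
        then show ?thesis using u0[OF b] by simp
      next
        case False
        then have wx: "0 < w x" using w_nonneg[of x] by simp
        then have "0 \<le> u b x / w x" "u b x / w x \<le> 2 * c"
          using elim u_nonneg[OF b, of x] by (auto simp: field_simps)
        then have "r b x = u b x / w x - c" by (simp add: r_def)
        then show ?thesis using wx by (simp add: left_diff_distrib)
      qed
    qed
  qed
  define h where "h x = (\<Sum>b\<in>Basis. r b x *\<^sub>R b)" for x
  have h[measurable]: "h \<in> borel_measurable N"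
    unfolding h_def using r_meas by (intro borel_measurable_sum borel_measurable_scaleR) auto
  have h_le: "norm (h x) \<le> c * DIM('k)" for x
  proof -
    have "norm (h x) \<le> (\<Sum>b\<in>(Basis::'k set). c)"
      unfolding h_def by (rule sum_norm_le) (simp add: r_le)
    then show ?thesis by (simp add: mult.commute)
  qed
  have base: "\<phi> (ae_class N (wA A)) = (LINT x|N. h x * wA A x)" if A: "A \<in> sets N" for A
  proof -
    have ri: "integrable N (\<lambda>x. r b x * (indicator A x * w x))" if b: "b \<in> Basis" for b
      by (rule integrable_bounded_mult[OF iw[OF A] r_meas[OF b], of c]) (use r_le in auto)
    have "(LINT x|N. h x * wA A x) = (LINT x|N. (\<Sum>b\<in>Basis. (r b x * (indicator A x * w x)) *\<^sub>R b))"
      unfolding h_def wA_def sum_distrib_right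
      by (intro Bochner_Integration.integral_cong sum.cong refl) (simp add: scaleR_conv_of_real mult_ac)
    also have "\<dots> = (\<Sum>b\<in>Basis. (LINT x|N. (r b x * (indicator A x * w x)) *\<^sub>R b))"
      using ri by (intro Bochner_Integration.integral_sum integrable_scaleR_left)
    also have "\<dots> = (\<Sum>b\<in>Basis. (\<phi> (ae_class N (wA A)) \<bullet> b) *\<^sub>R b)"
    proof (rule sum.cong[OF refl])
      fix b :: 'k assume b: "b \<in> Basis"
      have "(LINT x|N. r b x * (indicator A x * w x)) = (LINT x|N. indicator A x * u b x - c * (indicator A x * w x))"
        using rw[OF b] u[OF b] w r_meas[OF b] A
        by (intro integral_cong_AE) (auto elim!: eventually_mono simp: indicator_def)
      also have "\<dots> = (LINT x|N. indicator A x * u b x) - c * (LINT x|N. indicator A x * w x)"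
        using iw[OF A] integrable_mult_indicator[OF A u[OF b]] by (subst Bochner_Integration.integral_diff) auto
      also have "\<dots> = \<phi> (ae_class N (wA A)) \<bullet> b"
        by (simp add: up[OF b A] p_def mass_w)
      finally show "(LINT x|N. (r b x * (indicator A x * w x)) *\<^sub>R b) = (\<phi> (ae_class N (wA A)) \<bullet> b) *\<^sub>R b"
        using ri[OF b] by simp
    qed
    also have "\<dots> = \<phi> (ae_class N (wA A))" by (rule euclidean_representation)
    finally show ?thesis by simp
  qed
  let ?M = "density N (\<lambda>x. ennreal (w x))"
  have iM: "integrable N (\<lambda>x. w x *\<^sub>R f x)" if "integrable ?M f" for f :: "'b \<Rightarrow> 'k"
    using that borel_measurable_integrable[OF that] by (simp add: integrable_density w_nonneg)
  have dens: "\<phi> (ae_class N (\<lambda>x. w x *\<^sub>R f x)) = (LINT x|N. h x * (w x *\<^sub>R f x))"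
    if "integrable ?M f" for f
    using that
  proof (induction f rule: integrable_induct)
    case (base A a)
    then have A: "A \<in> sets N" by simp
    have eq: "w x *\<^sub>R (indicator A x *\<^sub>R a) = a * wA A x" for x
      by (simp add: wA_def scaleR_conv_of_real mult_ac)
    have "(LINT x|N. h x * (a * wA A x)) = a * (LINT x|N. h x * wA A x)"
      by (subst integral_mult_right_zero[symmetric]) (simp add: mult_ac)
    then show ?case
      unfolding eq using functional_scale[OF wA[OF A]] \<open>\<And>A. A \<in> sets N \<Longrightarrow> \<phi> (ae_class N (wA A)) = (LINT x|N. h x * wA A x)\<close>[OF A]
      by simp
  next
    case (add f g)
    note i = iM[OF add.hyps(1)] iM[OF add.hyps(2)]
    show ?case
      using add functional_add[OF i] integrable_bounded_mult[OF i(1) h h_le] integrable_bounded_mult[OF i(2) h h_le]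
      by (simp add: scaleR_add_right distrib_left)
  next
    case (lim f s)
    have meas[measurable]: "f \<in> borel_measurable N" "\<And>i. s i \<in> borel_measurable N"
      using lim.hyps by (auto dest!: borel_measurable_integrable)
    have fi: "integrable N (\<lambda>x. w x *\<^sub>R f x)" and si: "\<And>i. integrable N (\<lambda>x. w x *\<^sub>R s i x)"
      using iM lim.hyps by (auto simp: integrable_density w_nonneg)
    have lims: "(\<lambda>i. w x *\<^sub>R s i x) \<longlonglongrightarrow> w x *\<^sub>R f x" if "x \<in> space N" for x
      using that lim.hyps(2)[of x] by (intro tendsto_intros) auto
    have dom: "norm (w x *\<^sub>R s i x) \<le> 2 * norm (w x *\<^sub>R f x)" if "x \<in> space N" for x i
      using that lim.hyps(3)[of x i] mult_left_mono[of "norm (s i x)" "2 * norm (f x)" "\<bar>w x\<bar>"] by auto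
    have "(\<lambda>i. LINT x|N. h x * (w x *\<^sub>R s i x)) \<longlonglongrightarrow> (LINT x|N. h x * (w x *\<^sub>R f x))"
    proof (rule integral_dominated_convergence[where w = "\<lambda>x. c * DIM('k) * (2 * norm (w x *\<^sub>R f x))"])
      show "integrable N (\<lambda>x. c * DIM('k) * (2 * norm (w x *\<^sub>R f x)))"
        by (intro integrable_mult_right integrable_norm fi)
      show "AE x in N. (\<lambda>i. h x * (w x *\<^sub>R s i x)) \<longlonglongrightarrow> h x * (w x *\<^sub>R f x)"
        using lims by (intro AE_I2 tendsto_mult_left)
      show "AE x in N. norm (h x * (w x *\<^sub>R s i x)) \<le> c * DIM('k) * (2 * norm (w x *\<^sub>R f x))" for i
        unfolding norm_mult using dom[of _ i] h_le c by (intro AE_I2 mult_mono) simp_all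
    qed measurable
    moreover have "(\<lambda>i. \<phi> (ae_class N (\<lambda>x. w x *\<^sub>R s i x))) \<longlonglongrightarrow> \<phi> (ae_class N (\<lambda>x. w x *\<^sub>R f x))"
    proof (rule Lim_null[THEN iffD2], rule Lim_null_comparison)
      let ?d = "\<lambda>i x. w x *\<^sub>R s i x + (- 1) * (w x *\<^sub>R f x)"
      have d: "integrable N (?d i)" for i using si fi by simp
      show "eventually (\<lambda>i. norm (\<phi> (ae_class N (\<lambda>x. w x *\<^sub>R s i x)) - \<phi> (ae_class N (\<lambda>x. w x *\<^sub>R f x)))
          \<le> c * (LINT x|N. norm (?d i x))) sequentially"
      proof (intro always_eventually allI)
        fix i
        have "\<phi> (ae_class N (?d i)) = \<phi> (ae_class N (\<lambda>x. w x *\<^sub>R s i x)) - \<phi> (ae_class N (\<lambda>x. w x *\<^sub>R f x))"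
          using functional_add[OF si[of i] integrable_mult_right[OF fi, of "-1"]] functional_scale[OF fi, of "-1"] by simp
        then show "norm (\<phi> (ae_class N (\<lambda>x. w x *\<^sub>R s i x)) - \<phi> (ae_class N (\<lambda>x. w x *\<^sub>R f x)))
          \<le> c * (LINT x|N. norm (?d i x))"
          using \<phi>_le[OF d[of i]] mass_space[OF d[of i]] by simp
      qed
      have "(\<lambda>i. LINT x|N. norm (?d i x)) \<longlonglongrightarrow> (LINT x|N. 0)"
      proof (rule integral_dominated_convergence[where w = "\<lambda>x. 3 * norm (w x *\<^sub>R f x)"])
        show "integrable N (\<lambda>x. 3 * norm (w x *\<^sub>R f x))"
          by (intro integrable_mult_right integrable_norm fi)
        show "AE x in N. (\<lambda>i. norm (?d i x)) \<longlonglongrightarrow> 0"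
        proof (rule AE_I2)
          fix x assume "x \<in> space N"
          then have "(\<lambda>i. ?d i x) \<longlonglongrightarrow> w x *\<^sub>R f x + (- 1) * (w x *\<^sub>R f x)"
            by (intro tendsto_add lims tendsto_const)
          then show "(\<lambda>i. norm (?d i x)) \<longlonglongrightarrow> 0" by (intro tendsto_norm_zero) simp
        qed
        show "AE x in N. norm (norm (?d i x)) \<le> 3 * norm (w x *\<^sub>R f x)" for i
        proof (rule AE_I2)
          fix x assume "x \<in> space N"
          then show "norm (norm (?d i x)) \<le> 3 * norm (w x *\<^sub>R f x)"
            using dom[of x i] norm_triangle_ineq4[of "w x *\<^sub>R s i x" "w x *\<^sub>R f x"] by simp
        qed
      qed measurable
      then show "(\<lambda>i. c * (LINT x|N. norm (?d i x))) \<longlonglongrightarrow> 0"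
        using tendsto_mult_left[of _ 0 _ c] by simp
    qed
    ultimately show ?case using lim.IH by (simp only: LIMSEQ_unique)
  qed
  have "\<phi> (ae_class N f) = (LINT x|N. h x * f x)"
    if f: "integrable N f" and f0: "AE x in N. w x = 0 \<longrightarrow> f x = 0" for f
  proof -
    define g where "g x = inverse (w x) *\<^sub>R f x" for x
    have [measurable]: "f \<in> borel_measurable N" using f by auto
    have gf: "AE x in N. w x *\<^sub>R g x = f x" using f0 by (auto elim!: eventually_mono simp: g_def)
    have [measurable]: "g \<in> borel_measurable N" unfolding g_def by measurable
    have "integrable N (\<lambda>x. w x *\<^sub>R g x)"
      using f gf by (subst integrable_cong_AE[of _ _ f]) auto
    moreover from this have "integrable ?M g" by (subst integrable_density) (auto simp: w_nonneg)
    ultimately have "\<phi> (ae_class N (\<lambda>x. w x *\<^sub>R g x)) = (LINT x|N. h x * (w x *\<^sub>R g x))"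
      and "ae_class N (\<lambda>x. w x *\<^sub>R g x) = ae_class N f"
      using dens ae_class_eqI f gf by blast+
    moreover have "(LINT x|N. h x * (w x *\<^sub>R g x)) = (LINT x|N. h x * f x)"
      by (rule integral_cong_AE) (measurable, use gf in eventually_elim, simp only:)
    ultimately show ?thesis by simp
  qed
  then show ?thesis using h h_le by blast
qed

end

definition equi_ball :: "'b measure \<Rightarrow> ('b \<Rightarrow> real) \<Rightarrow> (real \<Rightarrow> real) \<Rightarrow> real \<Rightarrow> ('b \<Rightarrow> 'k::{real_normed_field,banach,second_countable_topology}) set set" where
  "equi_ball N w \<omega> R = {F \<in> vecs (L1 N). equi_bounded N w \<omega> R (rep F)}"

lemma equi_bounded_cong_AE:
  assumes "integrable N f" "integrable N g" "AE x in N. f x = g x"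
  shows "equi_bounded N w \<omega> R f \<longleftrightarrow> equi_bounded N w \<omega> R g"
  unfolding equi_bounded_def using mass_cong_AE[OF assms] by auto

lemma topspace_weak_topology_L1:
  "topspace (weak_topology (L1 N :: ('k::{real_normed_field,banach,second_countable_topology}, ('b \<Rightarrow> 'k) set) nspace)) = vecs (L1 N)"
proof
  have "bounded_op (L1 N) scalar_space (pairing N (\<lambda>_. 0 :: 'k))" by (rule bounded_op_pairing[of _ _ 0]) auto
  from openin_subset[OF openin_weak_topology[OF this open_UNIV]]
  show "vecs (L1 N) \<subseteq> topspace (weak_topology (L1 N :: ('k, ('b \<Rightarrow> 'k) set) nspace))" by simp
qed (rule topspace_weak_topology)

text \<open>
  A bound on the mass over \<open>A\<close> is weakly closed: where it fails, a norming functional exhibits this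
  on a weakly open set.
\<close>

lemma closedin_equi_ball:
  fixes w :: "'b \<Rightarrow> real"
  shows "closedin (weak_topology (L1 N :: ('k::{real_normed_field,euclidean_space}, ('b \<Rightarrow> 'k) set) nspace)) (equi_ball N w \<omega> R)"
proof -
  let ?X = "weak_topology (L1 N :: ('k, ('b \<Rightarrow> 'k) set) nspace)"
  note top = topspace_weak_topology_L1[of N, where ?'k = 'k]
  have closed_mass: "closedin ?X {F \<in> vecs (L1 N). mass N (rep F) A \<le> b}" if A: "A \<in> sets N" for A b
    unfolding closedin_def
  proof (intro conjI)
    have nhd: "\<exists>V. openin ?X V \<and> F \<in> V \<and> V \<subseteq> vecs (L1 N) - {F \<in> vecs (L1 N). mass N (rep F) A \<le> b}"
      if F: "F \<in> vecs (L1 N)" "b < mass N (rep F) A" for F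
    proof -
      obtain h where h: "h \<in> borel_measurable N" "\<And>x. norm (h x) \<le> indicator A x"
        "(LINT x|N. h x * rep F x) = of_real (mass N (rep F) A)"
        using norming_function[OF integrable_rep[OF F(1)] A] by blast
      have h1: "norm (h x) \<le> 1" for x using h(2)[of x] by (cases "x \<in> A") auto
      have "open {z :: 'k. b < norm z}" by (intro open_Collect_less continuous_intros)
      then have "openin ?X {G \<in> vecs (L1 N). pairing N h G \<in> {z. b < norm z}}"
        by (intro openin_weak_topology bounded_op_pairing[OF h(1) h1])
      moreover have "pairing N h F \<in> {z. b < norm z}"
        using F(2) mass_nonneg[of N "rep F" A] by (simp add: pairing_def h(3))
      moreover have "norm (pairing N h G) \<le> mass N (rep G) A" if "G \<in> vecs (L1 N)" for G
        using norm_integral_mult_le_mass[OF integrable_rep[OF that] A h(1), of 1] h(2) by (simp add: pairing_def)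
      ultimately show ?thesis using F(1)
        by (intro exI[of _ "{G \<in> vecs (L1 N). pairing N h G \<in> {z. b < norm z}}"]) force
    qed
    show "openin ?X (topspace ?X - {F \<in> vecs (L1 N). mass N (rep F) A \<le> b})"
      unfolding top
    proof (subst openin_subopen, intro ballI)
      fix F :: "('b \<Rightarrow> 'k) set" assume "F \<in> vecs (L1 N) - {F \<in> vecs (L1 N). mass N (rep F) A \<le> b}"
      then have "F \<in> vecs (L1 N)" "b < mass N (rep F) A" by auto
      from nhd[OF this] show "\<exists>T. openin ?X T \<and> F \<in> T \<and> T \<subseteq> vecs (L1 N) - {F \<in> vecs (L1 N). mass N (rep F) A \<le> b}" .
    qed
  qed (auto simp: top)
  have "equi_ball N w \<omega> R = \<Inter>(insert {F \<in> vecs (L1 N). mass N (rep F) (space N) \<le> R}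
      {{F \<in> vecs (L1 N). mass N (rep F) A \<le> e} | e A. 0 < e \<and> A \<in> sets N \<and> mass N w A < \<omega> e} :: ('b \<Rightarrow> 'k) set set set)"
    by (auto simp: equi_ball_def equi_bounded_def)
  also have "closedin ?X \<dots>" using closed_mass by (intro closedin_Inter) auto
  finally show ?thesis .
qed

text \<open>
  Otherwise the sets \<open>S - V\<close>, with \<open>V\<close> in a cover without finite subcover, generate a
  proper filter, and an ultrafilter below it cannot converge to a point of \<open>S\<close>.
\<close>

lemma compactin_ultrafilter:
  assumes S: "S \<subseteq> topspace X"
    and lim: "\<And>U. ultrafilter U \<Longrightarrow> eventually (\<lambda>x. x \<in> S) U \<Longrightarrow>
      \<exists>l\<in>S. \<forall>V. openin X V \<longrightarrow> l \<in> V \<longrightarrow> eventually (\<lambda>x. x \<in> V) U"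
  shows "compactin X S"
  unfolding compactin_def
proof (intro conjI S allI impI)
  fix \<U> assume \<U>: "Ball \<U> (openin X) \<and> S \<subseteq> \<Union>\<U>"
  show "\<exists>\<F>. finite \<F> \<and> \<F> \<subseteq> \<U> \<and> S \<subseteq> \<Union>\<F>"
  proof (rule ccontr)
    assume no: "\<not> ?thesis"
    let ?F = "INF V\<in>\<U>. principal (S - V)"
    have "?F \<noteq> bot"
    proof (rule INF_filter_not_bot)
      fix \<F> assume \<F>: "\<F> \<subseteq> \<U>" "finite \<F>"
      with no have "\<not> S \<subseteq> \<Union>\<F>" by simp
      then have "(\<Inter>V\<in>\<F>. S - V) \<noteq> {}" by auto
      then show "(INF V\<in>\<F>. principal (S - V)) \<noteq> bot"
        using \<F>(2) by (simp add: INF_principal_finite principal_eq_bot_iff)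
    qed
    then obtain U where U: "U \<le> ?F" "ultrafilter U" using ex_ultrafilter by blast
    have ev: "eventually (\<lambda>x. x \<in> S - V) U" if "V \<in> \<U>" for V
      using order_trans[OF U(1) INF_lower[OF that]] by (simp add: le_principal)
    have "S \<noteq> {}" using no by (auto dest: spec[of _ "{}"])
    then obtain V0 where "V0 \<in> \<U>" using \<U> by auto
    from ev[OF this] have "eventually (\<lambda>x. x \<in> S) U" by eventually_elim simp
    from lim[OF U(2) this] obtain l where l: "l \<in> S"
      "\<And>V. openin X V \<Longrightarrow> l \<in> V \<Longrightarrow> eventually (\<lambda>x. x \<in> V) U" by blast
    then obtain V where V: "V \<in> \<U>" "l \<in> V" using \<U> by blast
    have "eventually (\<lambda>x. x \<in> V) U" using l(2) V \<U> by blast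
    with ev[OF V(1)] have "eventually (\<lambda>_. False) U" by eventually_elim simp
    then show False using U(2) by (simp add: ultrafilter_def eventually_False)
  qed
qed

text \<open>
  The other half of the Dunford-Pettis theorem, with one explicit ball in place of an arbitrary equi-integrable
  set. Members of the ball vanish almost everywhere on the zero set of \<open>w\<close>, so that every
  functional acts on them through a bounded density.
\<close>

lemma compactin_equi_ball:
  fixes w :: "'b \<Rightarrow> real"
  assumes w: "integrable N w" and w_nonneg: "\<And>x. 0 \<le> w x" and \<omega>: "\<And>e. 0 < e \<Longrightarrow> 0 < \<omega> e"
  shows "compactin (weak_topology (L1 N :: ('k::{real_normed_field,euclidean_space}, ('b \<Rightarrow> 'k) set) nspace)) (equi_ball N w \<omega> R)"
proof (rule compactin_ultrafilter)
  let ?E = "L1 N :: ('k, ('b \<Rightarrow> 'k) set) nspace"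
  show "equi_ball N w \<omega> R \<subseteq> topspace (weak_topology ?E)"
    using closedin_equi_ball by (rule closedin_subset)
  fix U :: "('b \<Rightarrow> 'k) set filter"
  assume U: "ultrafilter U" and ev: "eventually (\<lambda>F. F \<in> equi_ball N w \<omega> R) U"
  have Ubot: "U \<noteq> bot" using U by (simp add: ultrafilter_def)
  have ev': "eventually (\<lambda>F. integrable N (rep F) \<and> equi_bounded N w \<omega> R (rep F)) U"
    using ev by eventually_elim (auto simp: equi_ball_def integrable_rep)
  obtain u where lim: "weak_lim U N rep u"
    using equi_bounded_weak_lim[OF U w \<omega> ev'] by blast
  then have u: "integrable N u" by (simp add: weak_lim_def)
  have u_eq: "equi_bounded N w \<omega> R u"
    unfolding equi_bounded_def
  proof (intro conjI allI impI ballI)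
    show "mass N u (space N) \<le> R"
      by (rule weak_lim_mass_le[OF lim Ubot]) (use ev' in \<open>auto elim!: eventually_mono simp: equi_bounded_def\<close>)
    show "mass N u A \<le> e" if "0 < e" "A \<in> sets N" "mass N w A < \<omega> e" for e A
      by (rule weak_lim_mass_le[OF lim Ubot that(2)])
         (use ev' that in \<open>auto elim!: eventually_mono simp: equi_bounded_def\<close>)
  qed
  have in_ball: "ae_class N u \<in> equi_ball N w \<omega> R"
    using u_eq equi_bounded_cong_AE[OF rep_ae_class(1)[OF u] u rep_ae_class(2)[OF u]]
    by (simp add: equi_ball_def ae_class_in_L1[OF u])
  have vanish: "AE x in N. w x = 0 \<longrightarrow> f x = 0"
    if f: "integrable N f" "equi_bounded N w \<omega> R f" for f :: "'b \<Rightarrow> 'k"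
  proof -
    let ?A = "{x \<in> space N. w x = 0}"
    have A: "?A \<in> sets N" using w by measurable
    have "mass N w ?A = 0"
      unfolding mass_def by (intro integral_eq_zero_AE AE_I2) (auto simp: indicator_def)
    then have "mass N f ?A \<le> e" if "0 < e" for e
      using f(2) A that \<omega>[OF that] by (auto simp: equi_bounded_def)
    then have "mass N f ?A \<le> 0" by (rule dense_ge)
    then have "mass N f ?A = 0" using mass_nonneg[of N f ?A] by linarith
    then have "AE x in N. indicator ?A x * norm (f x) = 0"
      unfolding mass_def using integrable_mass[OF f(1) A] by (subst (asm) integral_nonneg_eq_0_iff_AE) auto
    then show ?thesis using AE_space by eventually_elim (auto simp: indicator_def split: if_splits)
  qed
  have nhd: "eventually (\<lambda>F. F \<in> V) U" if "openin (weak_topology ?E) V" "ae_class N u \<in> V" for V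
    using that unfolding weak_topology_def openin_topology_generated_by_iff
  proof (induction V rule: generate_topology_on.induct)
    case Empty
    then show ?case by simp
  next
    case (Int A B)
    then show ?case by (auto intro: eventually_conj)
  next
    case (UN K)
    then obtain A where "A \<in> K" "ae_class N u \<in> A" by auto
    with UN.IH[of A] show ?case by (auto elim: eventually_mono)
  next
    case (Basis S)
    then obtain \<phi> V where S: "S = {F \<in> vecs ?E. \<phi> F \<in> V}" and \<phi>: "bounded_op ?E scalar_space \<phi>" and V: "open V"
      by auto
    obtain h c where h: "h \<in> borel_measurable N" "\<And>x. norm (h x) \<le> c"
      and rep: "\<And>f. integrable N f \<Longrightarrow> AE x in N. w x = 0 \<longrightarrow> f x = 0 \<Longrightarrow> \<phi> (ae_class N f) = (LINT x|N. h x * f x)"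
      using functional_density[OF \<phi> w w_nonneg] by blast
    have "((\<lambda>F. LINT x|N. h x * rep F x) \<longlongrightarrow> \<phi> (ae_class N u)) U"
      using lim h rep[OF u vanish[OF u u_eq]] by (auto simp: weak_lim_def)
    then have "eventually (\<lambda>F. (LINT x|N. h x * rep F x) \<in> V) U"
      by (rule topological_tendstoD) (use V Basis S in auto)
    with ev show ?case
    proof eventually_elim
      case (elim F)
      then have F: "F \<in> vecs ?E" "equi_bounded N w \<omega> R (rep F)" by (auto simp: equi_ball_def)
      have "\<phi> F = (LINT x|N. h x * rep F x)"
        using rep[OF integrable_rep[OF F(1)] vanish[OF integrable_rep[OF F(1)] F(2)]] ae_class_rep[OF F(1)] by simp
      then show ?case using elim F by (simp add: S)
    qed
  qed
  show "\<exists>l\<in>equi_ball N w \<omega> R. \<forall>V. openin (weak_topology ?E) V \<longrightarrow> l \<in> V \<longrightarrow> eventually (\<lambda>F. F \<in> V) U"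
    using in_ball nhd by blast
qed

section \<open>Truncation\<close>

text \<open>
  The modulus of the truncated functions in \<open>truncation\<close>. A cut at the height \<open>m w\<close>
  counts as high if \<open>m \<ge> 2 (R + 1) / \<rho> e\<close>; the first term serves high cuts and the second
  serves low ones.
\<close>

definition trunc_modulus :: "real \<Rightarrow> (real \<Rightarrow> real) \<Rightarrow> real \<Rightarrow> real" where
  "trunc_modulus R \<rho> e = min (\<rho> e / 2) (e * \<rho> e / (2 * (R + 1)))"

lemma trunc_modulus_pos: "0 \<le> R \<Longrightarrow> 0 < e \<Longrightarrow> 0 < \<rho> e \<Longrightarrow> 0 < trunc_modulus R \<rho> e"
  by (simp add: trunc_modulus_def)

text \<open>
  The function \<open>v m\<close> is the mass of the part of \<open>t\<close> above \<open>m w\<close>. If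
  \<open>v\<close> takes the value \<open>a\<close>, the cut is made there. If \<open>v\<close> stays above
  \<open>a\<close>, its limit is the mass of \<open>t\<close> on the zero set of \<open>w\<close>, which is at
  most \<open>a\<close> by hypothesis; hence this mass equals \<open>a\<close> and it is what has to be removed.
  In both cases the mass removed is exactly \<open>a\<close> and is located on a set \<open>Z\<close> such that
  the rest has at most the mass \<open>mass N t (A \<union> Z) - a\<close> on \<open>A\<close>. If
  \<open>t\<close> itself has mass at most \<open>a\<close>, all of it is removed.
\<close>

lemma truncation:
  fixes t :: "'b \<Rightarrow> 'k::{real_normed_field,banach,second_countable_topology}" and w :: "'b \<Rightarrow> real"
  assumes w: "integrable N w" and w_nonneg: "\<And>x. 0 \<le> w x"
    and t: "integrable N t" and R: "mass N t (space N) \<le> R"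
    and \<rho>: "\<And>e. 0 < e \<Longrightarrow> 0 < \<rho> e"
    and small: "\<And>e A. 0 < e \<Longrightarrow> A \<in> sets N \<Longrightarrow> mass N w A < \<rho> e \<Longrightarrow> mass N t A \<le> a + e"
    and a: "0 \<le> a"
  shows "\<exists>g. integrable N g \<and> mass N (\<lambda>x. t x - g x) (space N) \<le> a \<and> equi_bounded N w (trunc_modulus R \<rho>) R g"
proof -
  have R0: "0 \<le> R" using mass_nonneg[of N t "space N"] R by linarith
  have [measurable]: "t \<in> borel_measurable N" "w \<in> borel_measurable N" using t w by auto
  define v where "v m = (LINT x|N. max 0 (norm (t x) - m * w x))" for m
  have vi: "integrable N (\<lambda>x. max 0 (norm (t x) - m * w x))" for m
    using t w by (intro integrable_max0) auto
  have nn: "mass N g A = 0" if "\<And>x. x \<in> A \<Longrightarrow> g x = 0" for g :: "'b \<Rightarrow> 'c::real_normed_vector" and A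
    unfolding mass_def using that by (intro integral_eq_zero_AE AE_I2) (auto simp: indicator_def)
  consider (small) "mass N t (space N) \<le> a"
    | (cut) m where "0 \<le> m" "v m = a"
    | (limit) "\<And>m. 0 \<le> m \<Longrightarrow> a < v m"
  proof (cases "a < v 0 \<and> (\<exists>m\<ge>0. v m \<le> a)")
    case True
    then obtain m where m: "0 \<le> m" "v m \<le> a" "a \<le> v 0" by auto
    have lip: "\<bar>v x - v y\<bar> \<le> (LINT x|N. w x) * \<bar>x - y\<bar>" for x y
    proof -
      have "\<bar>v x - v y\<bar> = \<bar>LINT z|N. max 0 (norm (t z) - x * w z) - max 0 (norm (t z) - y * w z)\<bar>"
        unfolding v_def using vi by simp
      also have "\<dots> \<le> (LINT z|N. \<bar>x - y\<bar> * w z)"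
      proof (rule integral_abs_bound[THEN order_trans], rule integral_mono)
        fix z
        have "\<bar>max 0 (norm (t z) - x * w z) - max 0 (norm (t z) - y * w z)\<bar> \<le> \<bar>(x - y) * w z\<bar>"
          by (auto simp: max_def algebra_simps abs_if)
        then show "\<bar>max 0 (norm (t z) - x * w z) - max 0 (norm (t z) - y * w z)\<bar> \<le> \<bar>x - y\<bar> * w z"
          using w_nonneg[of z] by (simp add: abs_mult)
      qed (use vi w in auto)
      finally show ?thesis by (simp add: mult.commute)
    qed
    have "continuous_on {0..m} v"
    proof (rule lipschitz_on_continuous_on)
      show "(LINT x|N. w x)-lipschitz_on {0..m} v"
        using lip w_nonneg by (intro lipschitz_onI) (auto simp: dist_real_def)
    qed
    then show thesis using IVT2'[of v m a 0] m that(2) by auto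
  next
    case False
    then consider "v 0 \<le> a" | "\<And>m. 0 \<le> m \<Longrightarrow> a < v m" by force
    then show thesis
    proof cases
      case 1
      then have "mass N t (space N) \<le> a" by (simp add: v_def mass_space[OF t])
      then show thesis by (rule that(1))
    qed (rule that(3))
  qed
  then show ?thesis
  proof cases
    case small
    then show ?thesis
      using R0 by (intro exI[of _ "\<lambda>_. 0"]) (auto simp: equi_bounded_def nn)
  next
    case (cut m)
    define g where "g x = (min (norm (t x)) (m * w x) / norm (t x)) *\<^sub>R t x" for x
    have g_norm: "norm (g x) = min (norm (t x)) (m * w x)" for x
      using cut(1) w_nonneg[of x] by (auto simp: g_def)
    have tg_norm: "norm (t x - g x) = max 0 (norm (t x) - m * w x)" for x
    proof (cases "t x = 0")
      case True
      then show ?thesis using cut(1) w_nonneg[of x] by (simp add: g_def)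
    next
      case False
      have "t x - g x = (1 - min (norm (t x)) (m * w x) / norm (t x)) *\<^sub>R t x"
        by (simp add: g_def scaleR_left_diff_distrib)
      also have "norm \<dots> = \<bar>1 - min (norm (t x)) (m * w x) / norm (t x)\<bar> * norm (t x)" by simp
      also have "\<dots> = \<bar>(1 - min (norm (t x)) (m * w x) / norm (t x)) * norm (t x)\<bar>"
        by (simp add: abs_mult)
      also have "\<dots> = \<bar>norm (t x) - min (norm (t x)) (m * w x)\<bar>"
        using False by (simp add: left_diff_distrib)
      finally show ?thesis by (simp add: min_def max_def)
    qed
    have [measurable]: "g \<in> borel_measurable N" unfolding g_def by measurable
    have g: "integrable N g"
      by (rule Bochner_Integration.integrable_bound[OF integrable_norm[OF t]]) (auto simp: g_norm)
    have tg: "mass N (\<lambda>x. t x - g x) (space N) = a"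
      using cut(2) g t by (subst mass_space) (auto simp: tg_norm v_def)
    define Z where "Z = {x \<in> space N. m * w x < norm (t x)}"
    have Z[measurable]: "Z \<in> sets N" unfolding Z_def by measurable
    have g_le: "mass N g A \<le> mass N t (A \<union> Z) - a" if A: "A \<in> sets N" for A
    proof -
      have "mass N g A \<le> mass N g (A \<union> Z)" using A by (intro mass_mono[OF g]) auto
      also have "\<dots> = (LINT x|N. indicator (A \<union> Z) x * norm (t x) - max 0 (norm (t x) - m * w x))"
        unfolding mass_def
        by (intro Bochner_Integration.integral_cong refl) (auto simp: g_norm indicator_def Z_def min_def max_def)
      also have "\<dots> = mass N t (A \<union> Z) - a"
        using vi integrable_mass[OF t, of "A \<union> Z"] A cut(2)
        by (subst Bochner_Integration.integral_diff) (auto simp: mass_def v_def)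
      finally show ?thesis .
    qed
    have g_le_w: "mass N g A \<le> m * mass N w A" if A: "A \<in> sets N" for A
    proof -
      have "mass N g A \<le> (LINT x|N. m * (indicator A x * norm (w x)))"
        unfolding mass_def using integrable_mass[OF g A] integrable_mass[OF w A]
        by (intro integral_mono) (auto simp: g_norm indicator_def w_nonneg)
      then show ?thesis by (simp add: mass_def)
    qed
    have mwZ: "m * mass N w Z \<le> R"
    proof -
      have "m * mass N w Z = (LINT x|N. m * (indicator Z x * norm (w x)))" by (simp add: mass_def)
      also have "\<dots> \<le> (LINT x|N. norm (t x))"
        using integrable_mass[OF w Z] t
        by (intro integral_mono) (auto simp: Z_def indicator_def w_nonneg)
      also have "\<dots> \<le> R" using R by (simp add: mass_space[OF t])
      finally show ?thesis .
    qed
    have "equi_bounded N w (trunc_modulus R \<rho>) R g"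
      unfolding equi_bounded_def
    proof (intro conjI allI impI ballI)
      have "mass N g (space N) \<le> mass N t (space N)"
        unfolding mass_def using integrable_mass[OF g sets.top] integrable_mass[OF t sets.top]
        by (intro integral_mono) (auto simp: g_norm intro!: mult_left_mono)
      then show "mass N g (space N) \<le> R" using R by linarith
      fix e A assume e: "(0::real) < e" and A: "A \<in> sets N" and le: "mass N w A < trunc_modulus R \<rho> e"
      note \<rho>e = \<rho>[OF e]
      show "mass N g A \<le> e"
      proof (cases "2 * (R + 1) / \<rho> e \<le> m")
        case True
        \<comment> \<open>A high cut: the set \<open>Z\<close> above it has so little \<open>w\<close>-mass that \<open>A \<union> Z\<close> is still small.\<close>
        have "2 * (R + 1) / \<rho> e * mass N w Z \<le> R"
          using mult_right_mono[OF True mass_nonneg[of N w Z]] mwZ by linarith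
        then have "2 * (R + 1) * mass N w Z \<le> R * \<rho> e" using \<rho>e by (simp add: field_simps)
        also have "\<dots> \<le> (R + 1) * \<rho> e" using \<rho>e by (simp add: distrib_right)
        finally have "(R + 1) * (2 * mass N w Z) \<le> (R + 1) * \<rho> e" by (simp only: mult_ac)
        then have "2 * mass N w Z \<le> \<rho> e" using R0 by (simp only: mult_le_cancel_left_pos)
        then have "mass N w Z \<le> \<rho> e / 2" by simp
        moreover have "mass N w A < \<rho> e / 2" using le by (simp add: trunc_modulus_def)
        ultimately have "mass N w (A \<union> Z) < \<rho> e" using mass_Un[OF w A Z] by linarith
        then have "mass N t (A \<union> Z) \<le> a + e" using A by (intro small e) auto
        then show ?thesis using g_le[OF A] by linarith
      next
        case False
        have "mass N g A \<le> m * mass N w A" by (rule g_le_w[OF A])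
        also have "\<dots> \<le> 2 * (R + 1) / \<rho> e * mass N w A"
          using False by (intro mult_right_mono mass_nonneg) simp
        also have "\<dots> \<le> 2 * (R + 1) / \<rho> e * (e * \<rho> e / (2 * (R + 1)))"
          using le R0 \<rho>e by (intro mult_left_mono) (auto simp: trunc_modulus_def)
        also have "\<dots> = e"
        proof -
          have "X / r * (e * r / X) = e" if "X \<noteq> 0" "r \<noteq> 0" for X r :: real using that by simp
          then show ?thesis using R0 \<rho>e by (metis add_nonneg_pos less_numeral_extra(1,3) less_irrefl mult_pos_pos zero_less_numeral)
        qed
        finally show ?thesis .
      qed
    qed
    then show ?thesis using g tg by (intro exI[of _ g]) auto
  next
    case limit
    define Z where "Z = {x \<in> space N. w x = 0}"
    have Z[measurable]: "Z \<in> sets N" unfolding Z_def by measurable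
    have wZ: "mass N w Z = 0" by (rule nn) (simp add: Z_def)
    define g where "g x = indicator (space N - Z) x *\<^sub>R t x" for x
    have g: "integrable N g" unfolding g_def using t by (intro integrable_mult_indicator) auto
    have g_mass: "mass N g A = mass N t (A - Z)" if "A \<in> sets N" for A
      unfolding mass_def using sets.sets_into_space[OF that]
      by (intro Bochner_Integration.integral_cong refl) (auto simp: g_def indicator_def)
    have tg: "mass N (\<lambda>x. t x - g x) (space N) = mass N t Z"
      unfolding mass_def
      by (intro Bochner_Integration.integral_cong refl) (auto simp: g_def indicator_def Z_def)
    have "mass N t Z \<le> a"
    proof (rule field_le_epsilon)
      show "mass N t Z \<le> a + e" if "0 < e" for e using \<rho>[OF that] by (intro small that) (auto simp: wZ)
    qed
    moreover have "a \<le> mass N t Z"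
    proof -
      have "(\<lambda>n. v (real n)) \<longlonglongrightarrow> mass N t Z"
        unfolding v_def mass_def
      proof (rule integral_dominated_convergence[where w = "\<lambda>x. norm (t x)"])
        show "AE x in N. (\<lambda>n. max 0 (norm (t x) - real n * w x)) \<longlonglongrightarrow> indicator Z x * norm (t x)"
        proof (rule AE_I2)
          fix x assume x: "x \<in> space N"
          show "(\<lambda>n. max 0 (norm (t x) - real n * w x)) \<longlonglongrightarrow> indicator Z x * norm (t x)"
          proof (cases "w x = 0")
            case False
            then have "0 < w x" using w_nonneg[of x] by simp
            then obtain k where k: "norm (t x) < real k * w x" using reals_Archimedean3 by blast
            have "max 0 (norm (t x) - real n * w x) = 0" if "k \<le> n" for n
              using k that mult_right_mono[of "real k" "real n" "w x"] w_nonneg[of x] by simp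
            then have "eventually (\<lambda>n. max 0 (norm (t x) - real n * w x) = 0) sequentially"
              using eventually_sequentially by blast
            then have "(\<lambda>n. max 0 (norm (t x) - real n * w x)) \<longlonglongrightarrow> 0" by (rule tendsto_eventually)
            then show ?thesis using False by (simp add: Z_def)
          qed (use x in \<open>simp add: Z_def\<close>)
        qed
        show "AE x in N. norm (max 0 (norm (t x) - real n * w x)) \<le> norm (t x)" for n
          using w_nonneg by (auto simp: max_def)
      qed (use t in auto)
      moreover have "a \<le> v (real n)" for n using limit[of "real n"] by simp
      ultimately show ?thesis by (intro tendsto_lowerbound[of _ _ sequentially]) auto
    qed
    ultimately have tZ: "mass N t Z = a" by simp
    have "equi_bounded N w (trunc_modulus R \<rho>) R g"
      unfolding equi_bounded_def
    proof (intro conjI allI impI ballI)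
      have "mass N g (space N) \<le> mass N t (space N)"
        using sets.sets_into_space by (subst g_mass) (auto intro!: mass_mono[OF t])
      then show "mass N g (space N) \<le> R" using R by linarith
      fix e A assume e: "(0::real) < e" and A: "A \<in> sets N" and le: "mass N w A < trunc_modulus R \<rho> e"
      have "mass N w (A \<union> Z) < \<rho> e"
        using mass_Un[OF w A Z] wZ le \<rho>[OF e] by (auto simp: trunc_modulus_def)
      then have "mass N t (A \<union> Z) \<le> a + e" using A by (intro small e) auto
      moreover have "mass N t (A \<union> Z) = mass N t (A - Z) + mass N t Z"
      proof -
        have "(\<Union>i\<in>UNIV. if i then A - Z else Z) = A \<union> Z" by auto
        then show ?thesis
          using mass_UN_disjoint[OF t, of UNIV "\<lambda>i. if i then A - Z else Z"] A
          by (auto simp: disjoint_family_on_def UNIV_bool add.commute)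
      qed
      ultimately show "mass N g A \<le> e" using g_mass[OF A] tZ by linarith
    qed
    then show ?thesis using g tg tZ by (intro exI[of _ g]) auto
  qed
qed

section \<open>Averaging over finitely many blocks\<close>

definition blocks :: "'a measure \<Rightarrow> 'a set set \<Rightarrow> bool" where
  "blocks M \<pi> \<longleftrightarrow> finite \<pi> \<and> disjoint \<pi> \<and> (\<forall>A\<in>\<pi>. A \<in> sets M \<and> 0 < emeasure M A \<and> emeasure M A < \<infinity>)"

definition normalized :: "'a measure \<Rightarrow> 'a set \<Rightarrow> 'a \<Rightarrow> 'k::real_normed_field" where
  "normalized M A x = indicator A x / of_real (measure M A)"

definition block_integral :: "'a measure \<Rightarrow> ('a \<Rightarrow> 'k::{real_normed_field,banach,second_countable_topology}) \<Rightarrow> 'a set \<Rightarrow> 'k" where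
  "block_integral M f A = (LINT x|M. indicator A x * f x)"

lemma sum_block_integral_le:
  assumes f: "integrable M f" and \<pi>: "blocks M \<pi>"
  shows "(\<Sum>A\<in>\<pi>. norm (block_integral M f A)) \<le> mass M f (space M)"
proof -
  have "(\<Sum>A\<in>\<pi>. norm (block_integral M f A)) \<le> (\<Sum>A\<in>\<pi>. mass M f A)"
  proof (rule sum_mono)
    fix A assume "A \<in> \<pi>"
    then have A: "A \<in> sets M" using \<pi> by (auto simp: blocks_def)
    have "norm (LINT x|M. indicator A x * f x) \<le> 1 * mass M f A"
      by (rule norm_integral_mult_le_mass[OF f A]) (use A in \<open>auto simp: indicator_def\<close>)
    then show "norm (block_integral M f A) \<le> mass M f A" by (simp add: block_integral_def)
  qed
  also have "\<dots> = mass M f (\<Union>A\<in>\<pi>. A)"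
    using \<pi> by (intro mass_UN_disjoint[OF f, symmetric])
      (auto simp: blocks_def disjoint_def disjoint_family_on_def)
  also have "\<dots> \<le> mass M f (space M)"
    using \<pi> sets.sets_into_space by (intro mass_mono[OF f]) (auto simp: blocks_def sets.finite_Union)
  finally show ?thesis .
qed

text \<open>
  Blocks are disjoint, so the coefficients sum up to at most the norm of \<open>f\<close>; this is why a bound
  that holds for each \<open>g A\<close> separately passes to the sum.
\<close>

lemma mass_block_sum_le:
  assumes f: "integrable M f" and \<pi>: "blocks M \<pi>" and C: "C \<in> sets N"
    and g: "\<And>A. A \<in> \<pi> \<Longrightarrow> integrable N (g A)" "\<And>A. A \<in> \<pi> \<Longrightarrow> mass N (g A) C \<le> b" and b: "0 \<le> b"
  shows "mass N (\<lambda>y. \<Sum>A\<in>\<pi>. block_integral M f A * g A y) C \<le> mass M f (space M) * b"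
proof -
  have "mass N (\<lambda>y. \<Sum>A\<in>\<pi>. block_integral M f A * g A y) C \<le> (\<Sum>A\<in>\<pi>. mass N (\<lambda>y. block_integral M f A * g A y) C)"
    using \<pi> g(1) C by (intro mass_sum) (auto simp: blocks_def)
  also have "\<dots> \<le> (\<Sum>A\<in>\<pi>. norm (block_integral M f A) * b)"
    using g(2) by (intro sum_mono) (auto simp: mass_cmult intro!: mult_left_mono)
  also have "\<dots> \<le> mass M f (space M) * b"
    using sum_block_integral_le[OF f \<pi>] b by (simp add: sum_distrib_right[symmetric] mult_right_mono)
  finally show ?thesis .
qed

lemma normalized_integrable:
  assumes "A \<in> sets M" "emeasure M A < \<infinity>"
  shows "integrable M (normalized M A :: 'a \<Rightarrow> 'k::{real_normed_field,banach,second_countable_topology})"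
proof -
  have "integrable M (\<lambda>x. indicator A x *\<^sub>R (1 / of_real (measure M A) :: 'k))"
    by (rule integrable_indicator[OF assms])
  moreover have "(\<lambda>x. indicator A x *\<^sub>R (1 / of_real (measure M A) :: 'k)) = normalized M A"
    by (auto simp: normalized_def fun_eq_iff indicator_def)
  ultimately show ?thesis by simp
qed

lemma mass_normalized:
  assumes "A \<in> sets M" "0 < emeasure M A" "emeasure M A < \<infinity>" "C \<in> sets M"
  shows "mass M (normalized M A :: 'a \<Rightarrow> 'k::real_normed_field) C \<le> 1"
proof -
  have m: "0 < measure M A" using assms(2,3) by (simp add: measure_def enn2real_positive_iff)
  have "mass M (normalized M A :: 'a \<Rightarrow> 'k) C = (LINT x|M. indicator (C \<inter> A) x * (1 / measure M A))"
    unfolding mass_def using m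
    by (intro Bochner_Integration.integral_cong refl) (auto simp: normalized_def indicator_def norm_divide)
  also have "\<dots> = measure M (C \<inter> A) * (1 / measure M A)"
    using assms sets.sets_into_space[OF assms(1)] by (simp add: Int_absorb2 inf.coboundedI2)
  also have "\<dots> \<le> measure M A * (1 / measure M A)"
    using assms m by (intro mult_right_mono measure_mono_fmeasurable) (auto simp: fmeasurable_def)
  also have "\<dots> = 1" using m by simp
  finally show ?thesis .
qed

definition average :: "'a measure \<Rightarrow> 'a set set \<Rightarrow> ('a \<Rightarrow> 'k::{real_normed_field,banach,second_countable_topology}) \<Rightarrow> 'a \<Rightarrow> 'k" where
  "average M \<pi> f x = (\<Sum>A\<in>\<pi>. block_integral M f A * normalized M A x)"

lemma average_integrable: "blocks M \<pi> \<Longrightarrow> integrable M (average M \<pi> f)"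
  unfolding average_def by (auto simp: blocks_def intro!: Bochner_Integration.integrable_sum integrable_mult_right normalized_integrable)

lemma mass_average_le:
  assumes "integrable M f" "blocks M \<pi>"
  shows "mass M (average M \<pi> f) (space M) \<le> mass M f (space M)"
proof -
  have "mass M (\<lambda>x. \<Sum>A\<in>\<pi>. block_integral M f A * normalized M A x) (space M) \<le> mass M f (space M) * 1"
    using assms by (intro mass_block_sum_le) (auto simp: blocks_def intro!: normalized_integrable mass_normalized)
  then show ?thesis by (simp add: average_def[abs_def])
qed

lemma block_integral_diff:
  assumes "integrable M f" "integrable M g" "A \<in> sets M"
  shows "block_integral M (\<lambda>x. f x - g x) A = block_integral M f A - block_integral M g A"
proof -
  have "integrable M (\<lambda>x. indicator A x * h x)" if "integrable M h" for h :: "'a \<Rightarrow> 'b"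
    by (rule integrable_bounded_mult[OF that, of _ 1]) (use assms(3) in \<open>auto simp: indicator_def\<close>)
  then show ?thesis using assms by (simp add: block_integral_def right_diff_distrib)
qed

lemma integrable_simple_approx:
  fixes f :: "'a \<Rightarrow> 'k::{banach,second_countable_topology}"
  assumes f: "integrable M f" and e: "0 < e"
  shows "\<exists>s. simple_function M s \<and> integrable M s \<and> mass M (\<lambda>x. f x - s x) (space M) \<le> e"
proof -
  have fm: "f \<in> borel_measurable M" using f by auto
  obtain s where s: "\<And>i. simple_function M (s i)" "\<And>x. x \<in> space M \<Longrightarrow> (\<lambda>i. s i x) \<longlonglongrightarrow> f x"
    "\<And>i x. x \<in> space M \<Longrightarrow> dist (s i x) 0 \<le> 2 * dist (f x) 0"
    using borel_measurable_implies_sequence_metric[OF fm, of 0] by metis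
  have sm[measurable]: "s i \<in> borel_measurable M" for i by (rule borel_measurable_simple_function[OF s(1)])
  have si: "integrable M (s i)" for i
    by (rule Bochner_Integration.integrable_bound[of M "\<lambda>x. 2 * norm (f x)"])
       (use f s(3) in \<open>auto simp: dist_norm\<close>)
  have "(\<lambda>i. LINT x|M. norm (f x - s i x)) \<longlonglongrightarrow> (LINT x|M. 0)"
  proof (rule integral_dominated_convergence[where w = "\<lambda>x. 3 * norm (f x)"])
    show "AE x in M. (\<lambda>i. norm (f x - s i x)) \<longlonglongrightarrow> 0"
    proof (rule AE_I2)
      fix x assume "x \<in> space M"
      then have "(\<lambda>i. f x - s i x) \<longlonglongrightarrow> f x - f x" by (intro tendsto_diff tendsto_const s(2))
      then show "(\<lambda>i. norm (f x - s i x)) \<longlonglongrightarrow> 0" by (intro tendsto_norm_zero) simp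
    qed
    show "AE x in M. norm (norm (f x - s i x)) \<le> 3 * norm (f x)" for i
    proof (rule AE_I2)
      fix x assume "x \<in> space M"
      then show "norm (norm (f x - s i x)) \<le> 3 * norm (f x)"
        using s(3)[of x i] norm_triangle_ineq4[of "f x" "s i x"] by simp
    qed
  qed (use f in auto)
  then have "eventually (\<lambda>i. (LINT x|M. norm (f x - s i x)) < e) sequentially"
    using e by (intro order_tendstoD(2)) auto
  then obtain i where "(LINT x|M. norm (f x - s i x)) < e" by (auto simp: eventually_sequentially)
  then show ?thesis using s(1) si f by (intro exI[of _ "s i"]) (simp add: mass_space)
qed

text \<open>
  Approximate each function by an integrable simple one and take as blocks the joint level sets of positive
  finite measure. Averaging reproduces the simple functions: level sets of measure zero do not matter, and on
  level sets of infinite measure the simple functions vanish. Since averaging is a contraction, it moves the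
  given functions only little.
\<close>

lemma ex_blocks_average:
  fixes Fs :: "('a \<Rightarrow> 'k::{real_normed_field,banach,second_countable_topology}) set"
  assumes fin: "finite Fs" and int: "\<And>f. f \<in> Fs \<Longrightarrow> integrable M f" and e: "0 < e"
  shows "\<exists>\<pi>. blocks M \<pi> \<and> (\<forall>f\<in>Fs. mass M (\<lambda>x. average M \<pi> f x - f x) (space M) \<le> e)"
proof -
  have "\<exists>s. simple_function M s \<and> integrable M s \<and> mass M (\<lambda>x. f x - s x) (space M) \<le> e / 2" if "f \<in> Fs" for f
    using integrable_simple_approx[OF int[OF that], of "e / 2"] e by simp
  then obtain s where s: "\<And>f. f \<in> Fs \<Longrightarrow> simple_function M (s f)" "\<And>f. f \<in> Fs \<Longrightarrow> integrable M (s f)"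
    "\<And>f. f \<in> Fs \<Longrightarrow> mass M (\<lambda>x. f x - s f x) (space M) \<le> e / 2" by metis
  define L where "L x = {y \<in> space M. \<forall>f\<in>Fs. s f y = s f x}" for x
  have L_eq: "L x = L y" if "y \<in> L x" for x y using that by (auto simp: L_def)
  have L_sets: "L x \<in> sets M" for x
  proof -
    have "{y \<in> space M. s f y = s f x} \<in> sets M" if "f \<in> Fs" for f
      using simple_functionD(2)[OF s(1)[OF that], of "{s f x}"] by (simp add: vimage_def Int_def conj_commute)
    then show ?thesis unfolding L_def by (rule sets.sets_Collect_finite_All[OF _ fin])
  qed
  have L_fin: "finite (L ` space M)"
  proof (rule finite_subset)
    show "L ` space M \<subseteq> (\<lambda>p. {y \<in> space M. \<forall>f\<in>Fs. s f y = p f}) ` (PiE Fs (\<lambda>f. s f ` space M))"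
    proof (rule image_subsetI)
      fix x assume "x \<in> space M"
      then show "L x \<in> (\<lambda>p. {y \<in> space M. \<forall>f\<in>Fs. s f y = p f}) ` (PiE Fs (\<lambda>f. s f ` space M))"
        by (intro image_eqI[of _ _ "restrict (\<lambda>f. s f x) Fs"]) (auto simp: L_def)
    qed
    show "finite ((\<lambda>p. {y \<in> space M. \<forall>f\<in>Fs. s f y = p f}) ` (PiE Fs (\<lambda>f. s f ` space M)))"
      by (rule finite_imageI[OF finite_PiE[OF fin simple_functionD(1)[OF s(1)]]])
  qed
  define \<pi> where "\<pi> = {A \<in> L ` space M. 0 < emeasure M A \<and> emeasure M A < \<infinity>}"
  have \<pi>: "blocks M \<pi>"
    unfolding blocks_def disjoint_def
  proof (intro conjI ballI impI)
    show "finite \<pi>" unfolding \<pi>_def using L_fin by simp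
    fix A B assume "A \<in> \<pi>" "B \<in> \<pi>" "A \<noteq> B"
    then show "A \<inter> B = {}" using L_eq unfolding \<pi>_def by blast
  qed (auto simp: \<pi>_def L_sets)
  have null: "AE x in M. \<forall>A\<in>L ` space M. emeasure M A = 0 \<longrightarrow> x \<notin> A"
  proof (subst AE_finite_all[OF L_fin], intro ballI)
    fix A assume "A \<in> L ` space M"
    then have "A \<in> sets M" using L_sets by auto
    then show "AE x in M. emeasure M A = 0 \<longrightarrow> x \<notin> A"
      by (cases "emeasure M A = 0") (auto intro!: AE_not_in simp: null_sets_def)
  qed
  have "mass M (\<lambda>x. average M \<pi> f x - f x) (space M) \<le> e" if f: "f \<in> Fs" for f
  proof -
    let ?s = "s f"
    note fi = int[OF f] and si = s(2)[OF f]
    have fin_pos: "emeasure M (L x) < \<infinity>" if x: "x \<in> space M" "?s x \<noteq> 0" for x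
    proof -
      have "emeasure M (L x) \<le> emeasure M {y \<in> space M. norm (?s x) \<le> norm (?s y)}"
        using f si by (intro emeasure_mono) (auto simp: L_def)
      also have "\<dots> \<le> ennreal (1 / norm (?s x) * (LINT y|M. norm (?s y)))"
        using si x by (intro integral_Markov_inequality) auto
      finally show ?thesis by (auto intro: order.strict_trans1)
    qed
    have avg_s: "AE x in M. average M \<pi> ?s x = ?s x"
      using null AE_space
    proof eventually_elim
      case (elim x)
      then have Lx: "L x \<in> L ` space M" "x \<in> L x" "emeasure M (L x) \<noteq> 0" by (auto simp: L_def)
      have only: "A = L x" if "A \<in> \<pi>" "x \<in> A" for A
        using that L_eq unfolding \<pi>_def by blast
      show ?case
      proof (cases "emeasure M (L x) < \<infinity>")
        case True
        then have L\<pi>: "L x \<in> \<pi>" using Lx by (auto simp: \<pi>_def zero_less_iff_neq_zero)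
        have "average M \<pi> ?s x = (\<Sum>A\<in>{L x}. block_integral M ?s A * normalized M A x)"
          unfolding average_def using L\<pi> \<pi> only
          by (intro sum.mono_neutral_right) (auto simp: blocks_def normalized_def indicator_def)
        also have "\<dots> = block_integral M ?s (L x) / of_real (measure M (L x))"
          using Lx(2) by (simp add: normalized_def)
        also have "block_integral M ?s (L x) = of_real (measure M (L x)) * ?s x"
        proof -
          have "block_integral M ?s (L x) = (LINT y|M. indicator (L x) y *\<^sub>R ?s x)"
            unfolding block_integral_def using f
            by (intro Bochner_Integration.integral_cong refl) (auto simp: L_def indicator_def)
          also have "\<dots> = measure M (L x) *\<^sub>R ?s x"
            using True L_sets[of x] sets.sets_into_space[OF L_sets[of x]] by (simp add: Int_absorb2)
          finally show ?thesis by (simp add: scaleR_conv_of_real)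
        qed
        also have "of_real (measure M (L x)) * ?s x / of_real (measure M (L x)) = ?s x"
          using Lx(3) True by (simp add: measure_def enn2real_eq_0_iff)
        finally show ?thesis .
      next
        case False
        then have "?s x = 0" using fin_pos elim by blast
        moreover have "average M \<pi> ?s x = 0"
        proof -
          have "x \<notin> A" if "A \<in> \<pi>" for A
          proof
            assume "x \<in> A"
            then have "A = L x" using only that by blast
            then show False using that False by (simp add: \<pi>_def)
          qed
          then show ?thesis unfolding average_def by (intro sum.neutral) (simp add: normalized_def)
        qed
        ultimately show ?thesis by simp
      qed
    qed
    have avg_diff: "average M \<pi> (\<lambda>x. f x - ?s x) x = average M \<pi> f x - average M \<pi> ?s x" for x
      unfolding average_def sum_subtractf[symmetric] using \<pi> block_integral_diff[OF fi si]
      by (intro sum.cong refl) (auto simp: blocks_def left_diff_distrib)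
    have di: "integrable M (\<lambda>x. f x - ?s x)" "integrable M (\<lambda>x. (-1) * (f x - ?s x))" using fi si by auto
    note ai = average_integrable[OF \<pi>]
    have "mass M (\<lambda>x. average M \<pi> f x - f x) (space M)
        = mass M (\<lambda>x. average M \<pi> (\<lambda>x. f x - ?s x) x + (-1) * (f x - ?s x)) (space M)"
    proof (rule mass_cong_AE)
      show "AE x in M. average M \<pi> f x - f x = average M \<pi> (\<lambda>x. f x - ?s x) x + (-1) * (f x - ?s x)"
        using avg_s by eventually_elim (simp add: avg_diff)
      show "integrable M (\<lambda>x. average M \<pi> (\<lambda>x. f x - ?s x) x + (-1) * (f x - ?s x))"
        by (intro Bochner_Integration.integrable_add ai di)
      show "integrable M (\<lambda>x. average M \<pi> f x - f x)"
        by (intro Bochner_Integration.integrable_diff ai fi)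
    qed auto
    also have "\<dots> \<le> mass M (average M \<pi> (\<lambda>x. f x - ?s x)) (space M) + mass M (\<lambda>x. (-1) * (f x - ?s x)) (space M)"
      by (intro mass_add ai di) auto
    also have "\<dots> \<le> mass M (\<lambda>x. f x - ?s x) (space M) + mass M (\<lambda>x. f x - ?s x) (space M)"
      using mass_average_le[OF di(1) \<pi>] by (simp only: mass_cmult) simp
    also have "\<dots> \<le> e" using s(3)[OF f] by simp
    finally show ?thesis .
  qed
  with \<pi> show ?thesis by blast
qed

section \<open>The approximating operator\<close>

context
  fixes M :: "'a measure" and N :: "'b measure"
    and T :: "('a \<Rightarrow> 'k::{real_normed_field,banach,second_countable_topology}) set \<Rightarrow> ('b \<Rightarrow> 'k) set"
  assumes T: "bounded_op (L1 M) (L1 N) T"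
begin

lemma op_in: "F \<in> vecs (L1 M) \<Longrightarrow> T F \<in> vecs (L1 N)"
  using T unfolding bounded_op_def by blast

lemma op_rep_add:
  assumes "integrable M f" "integrable M g"
  shows "AE y in N. rep (T (ae_class M (\<lambda>x. f x + g x))) y = rep (T (ae_class M f)) y + rep (T (ae_class M g)) y"
proof -
  have "T (ae_class M (\<lambda>x. f x + g x)) = vadd (L1 N) (T (ae_class M f)) (T (ae_class M g))"
    using T assms[THEN ae_class_in_L1] unfolding bounded_op_def L1_add[OF assms, symmetric] by blast
  then show ?thesis using rep_vadd[OF op_in op_in] assms[THEN ae_class_in_L1] by metis
qed

lemma op_rep_scale:
  assumes "integrable M f"
  shows "AE y in N. rep (T (ae_class M (\<lambda>x. c * f x))) y = c * rep (T (ae_class M f)) y"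
proof -
  have "T (ae_class M (\<lambda>x. c * f x)) = vscale (L1 N) c (T (ae_class M f))"
    using T assms[THEN ae_class_in_L1] unfolding bounded_op_def L1_scale[OF assms, symmetric] by blast
  then show ?thesis using rep_vscale[OF op_in[OF ae_class_in_L1[OF assms]]] by simp
qed

lemma op_rep_sum:
  assumes "finite I" "\<And>i. i \<in> I \<Longrightarrow> integrable M (f i)"
  shows "AE y in N. rep (T (ae_class M (\<lambda>x. \<Sum>i\<in>I. c i * f i x))) y = (\<Sum>i\<in>I. c i * rep (T (ae_class M (f i))) y)"
  using assms
proof (induction I)
  case empty
  have "AE y in N. rep (T (ae_class M (\<lambda>x. 0 * 0))) y = 0 * rep (T (ae_class M (\<lambda>x. 0))) y"
    by (rule op_rep_scale) simp
  then show ?case by simp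
next
  case (insert i I)
  have "AE y in N. rep (T (ae_class M (\<lambda>x. c i * f i x + (\<Sum>i\<in>I. c i * f i x)))) y
      = rep (T (ae_class M (\<lambda>x. c i * f i x))) y + rep (T (ae_class M (\<lambda>x. \<Sum>i\<in>I. c i * f i x))) y"
    using insert.prems by (intro op_rep_add) auto
  moreover have "AE y in N. rep (T (ae_class M (\<lambda>x. c i * f i x))) y = c i * rep (T (ae_class M (f i))) y"
    using insert.prems by (intro op_rep_scale) auto
  ultimately show ?case
    using insert.IH insert.prems
    by (auto simp: insert.hyps elim: eventually_elim2)
qed

lemma op_bound:
  obtains K where "0 \<le> K" "\<And>F. F \<in> vecs (L1 M) \<Longrightarrow> vnorm (L1 N) (T F) \<le> K * vnorm (L1 M) F"
proof -
  obtain K where K: "\<And>F. F \<in> vecs (L1 M) \<Longrightarrow> vnorm (L1 N) (T F) \<le> K * vnorm (L1 M) F"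
    using T unfolding bounded_op_def by blast
  have "vnorm (L1 N) (T F) \<le> max 0 K * vnorm (L1 M) F" if F: "F \<in> vecs (L1 M)" for F
  proof -
    have "0 \<le> vnorm (L1 M) F" by (simp add: vnorm_L1[OF F] mass_nonneg)
    then have "K * vnorm (L1 M) F \<le> max 0 K * vnorm (L1 M) F" by (intro mult_right_mono) auto
    then show ?thesis using K[OF F] by linarith
  qed
  then show thesis by (intro that[of "max 0 K"]) auto
qed

end

lemma block_integral_add:
  assumes "integrable M f" "integrable M g" "A \<in> sets M"
  shows "block_integral M (\<lambda>x. f x + g x) A = block_integral M f A + block_integral M g A"
  using block_integral_diff[of M "\<lambda>x. f x + g x" g A] assms by simp

lemma block_integral_cong_AE:
  assumes "integrable M f" "integrable M g" "A \<in> sets M" "AE x in M. f x = g x"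
  shows "block_integral M f A = block_integral M g A"
  unfolding block_integral_def using assms
  by (intro integral_cong_AE) (auto elim!: eventually_mono)

lemma block_integral_cmult: "block_integral M (\<lambda>x. c * f x) A = c * block_integral M f A"
  unfolding block_integral_def by (subst integral_mult_right_zero[symmetric]) (simp add: mult_ac)

text \<open>
  For a system \<open>\<pi>\<close> of blocks, \<open>V \<pi> F\<close> is the sum of the truncated functions
  \<open>G A\<close>, weighted by the integrals of \<open>F\<close> over the blocks. It differs by at most
  \<open>a\<close> times the norm of \<open>F\<close> from \<open>T\<close> applied to the average of
  \<open>F\<close>. Along an ultrafilter on which the averages of every \<open>F\<close> converge to
  \<open>F\<close>, the functions \<open>V \<pi> F\<close> have a weak limit, which is linear in
  \<open>F\<close> and inherits the norm estimates and the common modulus.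
\<close>

lemma approximate_by_equi_bounded:
  fixes T :: "('a \<Rightarrow> 'k::{real_normed_field,euclidean_space}) set \<Rightarrow> ('b \<Rightarrow> 'k) set" and w :: "'b \<Rightarrow> real"
  assumes T: "bounded_op (L1 M) (L1 N) T"
    and w: "integrable N w" and w_nonneg: "\<And>x. 0 \<le> w x" and a: "0 \<le> a"
    and \<rho>: "\<And>e. 0 < e \<Longrightarrow> 0 < \<rho> e"
    and small: "\<And>e A F. 0 < e \<Longrightarrow> A \<in> sets N \<Longrightarrow> mass N w A < \<rho> e \<Longrightarrow> F \<in> unit_ball (L1 M) \<Longrightarrow>
      mass N (rep (T F)) A \<le> a + e"
  shows "\<exists>W. weakly_compact_op (L1 M) (L1 N) W \<and>
    (\<forall>F\<in>vecs (L1 M). mass N (\<lambda>y. rep (T F) y - rep (W F) y) (space N) \<le> a * vnorm (L1 M) F)"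
proof -
  obtain K where K: "0 \<le> K" and T_le: "\<And>F. F \<in> vecs (L1 M) \<Longrightarrow> vnorm (L1 N) (T F) \<le> K * vnorm (L1 M) F"
    using op_bound[OF T] by blast
  note T_in = op_in[OF T]
  note repT = integrable_rep[OF op_in[OF T]]
  define \<omega> where "\<omega> = trunc_modulus K \<rho>"
  have \<omega>: "0 < \<omega> e" if "0 < e" for e
    unfolding \<omega>_def by (rule trunc_modulus_pos[of K e \<rho>, OF K that \<rho>[OF that]])
  define good where "good A \<longleftrightarrow> A \<in> sets M \<and> 0 < emeasure M A \<and> emeasure M A < \<infinity>" for A
  define t where "t A = rep (T (ae_class M (normalized M A)))" for A
  have norm_in: "ae_class M (normalized M A :: 'a \<Rightarrow> 'k) \<in> vecs (L1 M)" if "good A" for A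
    using that by (intro ae_class_in_L1 normalized_integrable) (auto simp: good_def)
  have norm_le: "vnorm (L1 M) (ae_class M (normalized M A :: 'a \<Rightarrow> 'k)) \<le> 1" if "good A" for A
  proof -
    have i: "integrable M (normalized M A :: 'a \<Rightarrow> 'k)" using that by (intro normalized_integrable) (auto simp: good_def)
    show ?thesis using that mass_normalized[of A M "space M"]
      by (simp only: L1_norm[OF i] mass_space[OF i, symmetric]) (auto simp: good_def)
  qed
  have t: "integrable N (t A)" if "good A" for A unfolding t_def by (rule repT[OF norm_in[OF that]])
  have "\<exists>g. integrable N g \<and> mass N (\<lambda>x. t A x - g x) (space N) \<le> a \<and> equi_bounded N w \<omega> K g" if A: "good A" for A
    unfolding \<omega>_def
  proof (rule truncation[OF w w_nonneg t[OF A] _ \<rho> _ a])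
    have "mass N (t A) (space N) \<le> K * vnorm (L1 M) (ae_class M (normalized M A :: 'a \<Rightarrow> 'k))"
      using T_le[OF norm_in[OF A]] by (simp add: t_def vnorm_L1[OF T_in[OF norm_in[OF A]]])
    also have "\<dots> \<le> K" using mult_left_mono[OF norm_le[OF A] K] by simp
    finally show "mass N (t A) (space N) \<le> K" .
    fix e B assume e: "(0::real) < e" and B: "B \<in> sets N" "mass N w B < \<rho> e"
    show "mass N (t A) B \<le> a + e"
      unfolding t_def using norm_in[OF A] norm_le[OF A]
      by (intro small[OF e B]) (simp add: unit_ball_def)
  qed
  then obtain G where G: "\<And>A. good A \<Longrightarrow> integrable N (G A)"
    and tG: "\<And>A. good A \<Longrightarrow> mass N (\<lambda>x. t A x - G A x) (space N) \<le> a"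
    and G_equi: "\<And>A. good A \<Longrightarrow> equi_bounded N w \<omega> K (G A)" by metis
  define V where "V \<pi> F y = (\<Sum>A\<in>\<pi>. block_integral M (rep F) A * G A y)" for \<pi> F y
  have blocks_good: "good A" if "blocks M \<pi>" "A \<in> \<pi>" for \<pi> A using that by (auto simp: blocks_def good_def)
  have V: "integrable N (V \<pi> F)" if "blocks M \<pi>" for \<pi> F
    unfolding V_def using G blocks_good[OF that]
    by (intro Bochner_Integration.integrable_sum integrable_mult_right) auto
  have V_mass: "mass N (V \<pi> F) C \<le> vnorm (L1 M) F * b"
    if "blocks M \<pi>" "F \<in> vecs (L1 M)" "C \<in> sets N" "0 \<le> b" "\<And>A. good A \<Longrightarrow> mass N (G A) C \<le> b" for \<pi> F C b
    unfolding vnorm_L1[OF that(2)] V_def[abs_def]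
    by (rule mass_block_sum_le[OF integrable_rep[OF that(2)] that(1,3) _ _ that(4)])
       (use G that blocks_good in auto)
  \<comment> \<open>Finitely many of the sets \<open>P p\<close> always have a common member, so one ultrafilter contains all of them.\<close>
  define P :: "('a \<Rightarrow> 'k) set \<times> real \<Rightarrow> 'a set set set"
    where "P = (\<lambda>(F, e). {\<pi>. blocks M \<pi> \<and> mass M (\<lambda>x. average M \<pi> (rep F) x - rep F x) (space M) \<le> e})"
  define I where "I = (vecs (L1 M) :: ('a \<Rightarrow> 'k) set set) \<times> {0::real<..}"
  have "(INF p\<in>I. principal (P p)) \<noteq> bot"
  proof (rule INF_filter_not_bot)
    fix J assume J: "J \<subseteq> I" "finite J"
    define e where "e = Min (insert 1 (snd ` J))"
    have e: "0 < e" unfolding e_def using J by (subst Min_gr_iff) (auto simp: I_def)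
    have e_le: "e \<le> snd p" if "p \<in> J" for p unfolding e_def using J that by (intro Min_le) auto
    obtain \<pi> where \<pi>: "blocks M \<pi>" "\<And>f. f \<in> (rep \<circ> fst) ` J \<Longrightarrow> mass M (\<lambda>x. average M \<pi> f x - f x) (space M) \<le> e"
    proof -
      have "integrable M f" if "f \<in> (rep \<circ> fst) ` J" for f
        using that J(1) by (auto simp: I_def intro!: integrable_rep)
      then show thesis using ex_blocks_average[of "(rep \<circ> fst) ` J" M e] J(2) e that by blast
    qed
    have "\<pi> \<in> P p" if "p \<in> J" for p
      using \<pi>(1) \<pi>(2)[of "rep (fst p)"] that e_le[OF that] by (force simp: P_def split: prod.splits)
    then have "(\<Inter>p\<in>J. P p) \<noteq> {}" by blast
    then show "(INF p\<in>J. principal (P p)) \<noteq> bot"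
      using J(2) by (simp add: INF_principal_finite principal_eq_bot_iff)
  qed
  then obtain U where U: "ultrafilter U" "U \<le> (INF p\<in>I. principal (P p))" using ex_ultrafilter by blast
  have Ubot: "U \<noteq> bot" using U(1) by (simp add: ultrafilter_def)
  have ev: "eventually (\<lambda>\<pi>. blocks M \<pi> \<and> mass M (\<lambda>x. average M \<pi> (rep F) x - rep F x) (space M) \<le> e) U"
    if "F \<in> vecs (L1 M)" "0 < e" for F :: "('a \<Rightarrow> 'k) set" and e
  proof -
    have "(F, e) \<in> I" using that by (simp add: I_def)
    then have "U \<le> principal (P (F, e))" using order_trans[OF U(2) INF_lower] by blast
    then show ?thesis by (simp add: le_principal P_def)
  qed
  have ev_blocks: "eventually (blocks M) U"
    by (rule eventually_mono[OF ev[of "ae_class M (\<lambda>_. 0)" 1]]) (auto intro: ae_class_in_L1)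
  have vnorm_nonneg: "0 \<le> vnorm (L1 M) F" if "F \<in> vecs (L1 M)" for F :: "('a \<Rightarrow> 'k) set"
    by (simp add: vnorm_L1[OF that] mass_nonneg)
  have "\<exists>u. weak_lim U N (\<lambda>\<pi>. V \<pi> F) u" if F: "F \<in> vecs (L1 M)" for F
  proof (rule equi_bounded_weak_lim[OF U(1) w])
    \<comment> \<open>The modulus is rescaled by the norm of \<open>F\<close>; adding \<open>1\<close> keeps the factor positive.\<close>
    let ?s = "vnorm (L1 M) F + 1"
    have s: "0 < ?s" using vnorm_nonneg[OF F] by linarith
    show "0 < \<omega> (e / ?s)" if "0 < e" for e using s that by (intro \<omega>) simp
    show "eventually (\<lambda>\<pi>. integrable N (V \<pi> F) \<and> equi_bounded N w (\<lambda>e. \<omega> (e / ?s)) (vnorm (L1 M) F * K) (V \<pi> F)) U"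
      using ev_blocks
    proof eventually_elim
      case (elim \<pi>)
      show ?case
        unfolding equi_bounded_def
      proof (intro conjI V[OF elim] allI impI ballI)
        show "mass N (V \<pi> F) (space N) \<le> vnorm (L1 M) F * K"
          using G_equi by (intro V_mass elim F K) (auto simp: equi_bounded_def)
        fix e A assume e: "(0::real) < e" and A: "A \<in> sets N" "mass N w A < \<omega> (e / ?s)"
        have e': "0 < e / ?s" using e s by simp
        have "mass N (V \<pi> F) A \<le> vnorm (L1 M) F * (e / ?s)"
          using G_equi A e' by (intro V_mass elim F) (auto simp: equi_bounded_def)
        also have "\<dots> \<le> ?s * (e / ?s)" using e' by (intro mult_right_mono) auto
        also have "\<dots> = e" using s by simp
        finally show "mass N (V \<pi> F) A \<le> e" .
      qed
    qed
  qed
  then obtain u where u: "\<And>F. F \<in> vecs (L1 M) \<Longrightarrow> weak_lim U N (\<lambda>\<pi>. V \<pi> F) (u F)" by metis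
  define W where "W F = ae_class N (u F)" for F
  have ui: "integrable N (u F)" if "F \<in> vecs (L1 M)" for F using u[OF that] by (simp add: weak_lim_def)
  have W_in: "W F \<in> vecs (L1 N)" if "F \<in> vecs (L1 M)" for F
    unfolding W_def by (rule ae_class_in_L1[OF ui[OF that]])
  have W_int: "integrable N (rep (W F))" if "F \<in> vecs (L1 M)" for F by (rule integrable_rep[OF W_in[OF that]])
  have W_u: "AE y in N. rep (W F) y = u F y" if "F \<in> vecs (L1 M)" for F
    unfolding W_def by (rule rep_ae_class(2)[OF ui[OF that]])
  have W: "weak_lim U N (\<lambda>\<pi>. V \<pi> F) (rep (W F))" if F: "F \<in> vecs (L1 M)" for F
    by (rule weak_lim_cong_AE[OF u[OF F] W_int[OF F]]) (use W_u[OF F] in \<open>auto elim!: eventually_mono\<close>)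
  have W_mass: "mass N (rep (W F)) C \<le> vnorm (L1 M) F * b"
    if "F \<in> vecs (L1 M)" "C \<in> sets N" "0 \<le> b" "\<And>A. good A \<Longrightarrow> mass N (G A) C \<le> b" for F C b
    by (rule weak_lim_mass_le[OF W[OF that(1)] Ubot that(2)])
       (use ev_blocks V V_mass[OF _ that] in \<open>auto elim!: eventually_mono\<close>)
  have W_vnorm: "vnorm (L1 N) (W F) \<le> K * vnorm (L1 M) F" if F: "F \<in> vecs (L1 M)" for F
    using W_mass[OF F sets.top K] G_equi by (simp add: vnorm_L1[OF W_in[OF F]] equi_bounded_def mult.commute)
  have W_op: "bounded_op (L1 M) (L1 N) W"
    unfolding bounded_op_def
  proof (intro conjI ballI allI exI[of _ K])
    fix F :: "('a \<Rightarrow> 'k) set" assume F: "F \<in> vecs (L1 M)"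
    show "vnorm (L1 N) (W F) \<le> K * vnorm (L1 M) F" by (rule W_vnorm[OF F])
    fix c :: 'k
    have "AE y in N. u (vscale (L1 M) c F) y = c * u F y"
    proof (rule weak_lim_unique[OF Ubot u[OF vscale_in[OF F]] weak_lim_cmult[OF u[OF F]]])
      show "eventually (\<lambda>\<pi>. integrable N (V \<pi> (vscale (L1 M) c F)) \<and> V \<pi> (vscale (L1 M) c F) = (\<lambda>y. c * V \<pi> F y)) U"
        using ev_blocks
      proof eventually_elim
        case (elim \<pi>)
        have "block_integral M (rep (vscale (L1 M) c F)) A = c * block_integral M (rep F) A" if "A \<in> \<pi>" for A
          using that elim F block_integral_cong_AE[OF integrable_rep[OF vscale_in[OF F]] integrable_mult_right[OF integrable_rep[OF F]] _ rep_vscale[OF F]]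
          by (auto simp: block_integral_cmult blocks_def)
        then show ?case using V[OF elim] by (auto simp: V_def fun_eq_iff sum_distrib_left mult.assoc)
      qed
    qed
    then have "W (vscale (L1 M) c F) = ae_class N (\<lambda>y. c * u F y)"
      unfolding W_def using ui[OF vscale_in[OF F]] ui[OF F] by (intro ae_class_eqI) auto
    then show "W (vscale (L1 M) c F) = vscale (L1 N) c (W F)"
      unfolding W_def L1_scale[OF ui[OF F]] .
    fix F' :: "('a \<Rightarrow> 'k) set" assume F': "F' \<in> vecs (L1 M)"
    have "AE y in N. u (vadd (L1 M) F F') y = u F y + u F' y"
    proof (rule weak_lim_unique[OF Ubot u[OF vadd_in[OF F F']] weak_lim_add[OF u[OF F] u[OF F']]])
      show "eventually (\<lambda>\<pi>. integrable N (V \<pi> F) \<and> integrable N (V \<pi> F')) U"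
        using ev_blocks by eventually_elim (simp add: V)
      show "eventually (\<lambda>\<pi>. integrable N (V \<pi> (vadd (L1 M) F F')) \<and> V \<pi> (vadd (L1 M) F F') = (\<lambda>y. V \<pi> F y + V \<pi> F' y)) U"
        using ev_blocks
      proof eventually_elim
        case (elim \<pi>)
        have "block_integral M (rep (vadd (L1 M) F F')) A = block_integral M (rep F) A + block_integral M (rep F') A" if "A \<in> \<pi>" for A
        proof -
          have A: "A \<in> sets M" using that elim by (auto simp: blocks_def)
          show ?thesis
            using block_integral_cong_AE[OF integrable_rep[OF vadd_in[OF F F']] Bochner_Integration.integrable_add[OF integrable_rep[OF F] integrable_rep[OF F']] A rep_vadd[OF F F']]
              block_integral_add[OF integrable_rep[OF F] integrable_rep[OF F'] A] by simp
        qed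
        then show ?case using V[OF elim] by (auto simp: V_def fun_eq_iff sum.distrib[symmetric] distrib_right)
      qed
    qed
    then have "W (vadd (L1 M) F F') = ae_class N (\<lambda>y. u F y + u F' y)"
      unfolding W_def using ui[OF vadd_in[OF F F']] ui[OF F] ui[OF F'] by (intro ae_class_eqI) auto
    then show "W (vadd (L1 M) F F') = vadd (L1 N) (W F) (W F')"
      unfolding W_def L1_add[OF ui[OF F] ui[OF F']] .
  qed (use W_in in auto)
  have W_ball: "W ` unit_ball (L1 M) \<subseteq> equi_ball N w \<omega> K"
  proof (rule image_subsetI)
    fix F :: "('a \<Rightarrow> 'k) set" assume "F \<in> unit_ball (L1 M)"
    then have F: "F \<in> vecs (L1 M)" "vnorm (L1 M) F \<le> 1" by (auto simp: unit_ball_def)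
    have le: "vnorm (L1 M) F * b \<le> b" if "0 \<le> b" for b using mult_right_mono[OF F(2) that] by simp
    show "W F \<in> equi_ball N w \<omega> K"
      unfolding equi_ball_def equi_bounded_def
    proof (intro CollectI conjI allI impI ballI)
      show "W F \<in> vecs (L1 N)" by (rule W_in[OF F(1)])
      have "mass N (rep (W F)) (space N) \<le> vnorm (L1 M) F * K"
        using G_equi by (intro W_mass[OF F(1) _ K]) (auto simp: equi_bounded_def)
      then show "mass N (rep (W F)) (space N) \<le> K" using le[OF K] by linarith
      fix e A assume e: "(0::real) < e" and A: "A \<in> sets N" "mass N w A < \<omega> e"
      have "mass N (rep (W F)) A \<le> vnorm (L1 M) F * e"
        using G_equi A e by (intro W_mass[OF F(1) A(1)]) (auto simp: equi_bounded_def)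
      then show "mass N (rep (W F)) A \<le> e" using le[of e] e by linarith
    qed
  qed
  have "weakly_compact_op (L1 M) (L1 N) W"
    unfolding weakly_compact_op_def
  proof (intro conjI W_op closed_compactin[OF compactin_equi_ball[OF w w_nonneg \<omega>]])
    show "weak_topology (L1 N) closure_of W ` unit_ball (L1 M) \<subseteq> equi_ball N w \<omega> K"
      by (rule closure_of_minimal[OF W_ball closedin_equi_ball])
  qed auto
  moreover have "mass N (\<lambda>y. rep (T F) y - rep (W F) y) (space N) \<le> a * vnorm (L1 M) F" if F: "F \<in> vecs (L1 M)" for F
  proof (rule field_le_epsilon)
    fix d :: real assume d: "0 < d"
    define e where "e = d / (K + 1)"
    have e: "0 < e" "K * e \<le> d" using d K by (simp_all add: e_def field_simps)
    have i: "integrable N (rep (T F))" by (rule repT[OF F])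
    have lim: "weak_lim U N (\<lambda>\<pi> y. rep (T F) y + (-1) * V \<pi> F y) (\<lambda>y. rep (T F) y + (-1) * rep (W F) y)"
      using ev_blocks i V by (intro weak_lim_add weak_lim_cmult weak_lim_const W F) (auto elim!: eventually_mono)
    have "mass N (\<lambda>y. rep (T F) y + (-1) * rep (W F) y) (space N) \<le> a * vnorm (L1 M) F + d"
    proof (rule weak_lim_mass_le[OF lim Ubot sets.top])
      show "eventually (\<lambda>\<pi>. integrable N (\<lambda>y. rep (T F) y + (-1) * V \<pi> F y) \<and>
          mass N (\<lambda>y. rep (T F) y + (-1) * V \<pi> F y) (space N) \<le> a * vnorm (L1 M) F + d) U"
        using ev[OF F e(1)]
      proof eventually_elim
        case (elim \<pi>)
        then have \<pi>: "blocks M \<pi>" by simp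
        have ni: "integrable M (normalized M A :: 'a \<Rightarrow> 'k)" if "A \<in> \<pi>" for A
          using that \<pi> by (intro normalized_integrable) (auto simp: blocks_def)
        let ?E = "average M \<pi> (rep F)"
        have Ei: "integrable M ?E" by (rule average_integrable[OF \<pi>])
        have Fi: "integrable M (rep F)" by (rule integrable_rep[OF F])
        let ?D = "\<lambda>x. ?E x + (-1) * rep F x"
        have Di: "integrable M ?D" using Ei Fi by simp
        define S where "S y = (\<Sum>A\<in>\<pi>. block_integral M (rep F) A * t A y)" for y
        have Si: "integrable N S" unfolding S_def using t blocks_good[OF \<pi>]
          by (intro Bochner_Integration.integrable_sum integrable_mult_right) auto
        have "AE y in N. rep (T (ae_class M ?E)) y = S y"
          unfolding average_def S_def t_def using \<pi> ni by (intro op_rep_sum[OF T]) (auto simp: blocks_def)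
        moreover have "AE y in N. rep (T (ae_class M ?D)) y = rep (T (ae_class M ?E)) y + rep (T (ae_class M (\<lambda>x. (-1) * rep F x))) y"
          by (rule op_rep_add[OF T Ei integrable_mult_right[OF Fi]])
        moreover have "AE y in N. rep (T (ae_class M (\<lambda>x. (-1) * rep F x))) y = (-1) * rep (T (ae_class M (rep F))) y"
          by (rule op_rep_scale[OF T Fi])
        ultimately have D: "AE y in N. S y + (-1) * rep (T F) y = rep (T (ae_class M ?D)) y"
          by eventually_elim (simp add: ae_class_rep[OF F])
        have "mass N (\<lambda>y. S y + (-1) * rep (T F) y) (space N) = vnorm (L1 N) (T (ae_class M ?D))"
          unfolding vnorm_L1[OF T_in[OF ae_class_in_L1[OF Di]]]
          by (rule mass_cong_AE[OF _ repT[OF ae_class_in_L1[OF Di]] D]) (use Si i in auto)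
        also have "\<dots> \<le> K * vnorm (L1 M) (ae_class M ?D)" by (rule T_le[OF ae_class_in_L1[OF Di]])
        also have "vnorm (L1 M) (ae_class M ?D) = mass M (\<lambda>x. ?E x - rep F x) (space M)"
          unfolding L1_norm[OF Di] mass_space[OF Di, symmetric] by simp
        also have "K * \<dots> \<le> K * e" using elim K by (intro mult_left_mono) auto
        finally have 1: "mass N (\<lambda>y. S y + (-1) * rep (T F) y) (space N) \<le> d" using e(2) by linarith
        have SV: "mass N (\<lambda>y. S y + (-1) * V \<pi> F y) (space N) \<le> vnorm (L1 M) F * a"
        proof -
          have "(\<lambda>y. S y + (-1) * V \<pi> F y) = (\<lambda>y. \<Sum>A\<in>\<pi>. block_integral M (rep F) A * (t A y - G A y))"
            by (simp add: S_def V_def sum_subtractf[symmetric] right_diff_distrib)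
          then show ?thesis
            unfolding vnorm_L1[OF F]
            using mass_block_sum_le[OF Fi \<pi> sets.top[of N], of "\<lambda>A y. t A y - G A y" a] t G tG blocks_good[OF \<pi>] a
            by simp
        qed
        have "mass N (\<lambda>y. rep (T F) y + (-1) * V \<pi> F y) (space N)
            = mass N (\<lambda>y. (-1) * (S y + (-1) * rep (T F) y) + (S y + (-1) * V \<pi> F y)) (space N)"
          by (simp add: algebra_simps)
        also have "\<dots> \<le> mass N (\<lambda>y. (-1) * (S y + (-1) * rep (T F) y)) (space N) + mass N (\<lambda>y. S y + (-1) * V \<pi> F y) (space N)"
          using Si i V[OF \<pi>] by (intro mass_add) auto
        also have "mass N (\<lambda>y. (-1) * (S y + (-1) * rep (T F) y)) (space N) = mass N (\<lambda>y. S y + (-1) * rep (T F) y) (space N)"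
          by (subst mass_cmult) simp
        finally show ?case using 1 SV i V[OF \<pi>] by (simp add: mult.commute)
      qed
    qed
    then show "mass N (\<lambda>y. rep (T F) y - rep (W F) y) (space N) \<le> a * vnorm (L1 M) F + d" by simp
  qed
  ultimately show ?thesis by blast
qed

section \<open>The cut-off norms of an operator\<close>

lemma Lim_at_right_INF:
  fixes s :: "real \<Rightarrow> real"
  assumes mono: "\<And>x y. 0 < x \<Longrightarrow> x \<le> y \<Longrightarrow> s x \<le> s y" and bdd: "\<And>x. 0 < x \<Longrightarrow> 0 \<le> s x"
  shows "Lim (at_right 0) s = (INF x\<in>{0<..}. s x)"
proof (rule tendsto_Lim)
  have b: "bdd_below (s ` {0<..})" using bdd by (intro bdd_belowI[of _ 0]) auto
  show "(s \<longlongrightarrow> (INF x\<in>{0<..}. s x)) (at_right 0)"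
  proof (rule order_tendstoI)
    fix y assume "y < (INF x\<in>{0<..}. s x)"
    then have "y < s x" if "0 < x" for x using cINF_lower[OF b, of x] that by simp
    then show "eventually (\<lambda>x. y < s x) (at_right 0)" by (intro eventually_at_rightI[of 0 1]) auto
  next
    fix y assume "(INF x\<in>{0<..}. s x) < y"
    then obtain x where x: "0 < x" "s x < y" using b by (subst (asm) cINF_less_iff) auto
    have "s z < y" if "z \<in> {0<..<x}" for z using mono[of z x] that x by simp
    then show "eventually (\<lambda>z. s z < y) (at_right 0)" using x(1) by (rule eventually_at_rightI)
  qed
qed simp

lemma zero_in_unit_ball:
  "ae_class M (\<lambda>_. 0 :: 'k::{real_normed_field,banach,second_countable_topology}) \<in> unit_ball (L1 M)"
proof -
  have i: "integrable M (\<lambda>_. 0 :: 'k)" by simp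
  have "vnorm (L1 M) (ae_class M (\<lambda>_. 0 :: 'k)) = 0"
    using L1_norm[OF i] by (simp only: norm_zero integral_zero)
  then show ?thesis
    unfolding unit_ball_def by (intro CollectI conjI ae_class_in_L1[OF i]) linarith
qed

lemma op_norm_le:
  assumes "\<And>F. F \<in> unit_ball (L1 M) \<Longrightarrow> vnorm (L1 N) (S F) \<le> c"
  shows "op_norm (L1 M) (L1 N) S \<le> c"
  unfolding op_norm_def using zero_in_unit_ball[of M] assms by (intro cSUP_least) auto

lemma vnorm_le_op_norm:
  assumes "\<And>F. F \<in> unit_ball (L1 M) \<Longrightarrow> vnorm (L1 N) (S F) \<le> c" "F \<in> unit_ball (L1 M)"
  shows "vnorm (L1 N) (S F) \<le> op_norm (L1 M) (L1 N) S"
  unfolding op_norm_def using assms by (intro cSUP_upper bdd_aboveI[of _ c]) auto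

lemma vnorm_op_diff:
  assumes "F \<in> vecs (L1 N)" "G \<in> vecs (L1 N)"
  shows "vnorm (L1 N) (vadd (L1 N) F (vscale (L1 N) (-1) G)) = mass N (\<lambda>y. rep F y - rep G y) (space N)"
proof -
  note G' = vscale_in[OF assms(2), of "-1"]
  show ?thesis
    unfolding vnorm_L1[OF vadd_in[OF assms(1) G']]
  proof (rule mass_cong_AE)
    show "AE y in N. rep (vadd (L1 N) F (vscale (L1 N) (-1) G)) y = rep F y - rep G y"
      using rep_vadd[OF assms(1) G'] rep_vscale[OF assms(2), of "-1"] by eventually_elim simp
  qed (use integrable_rep[OF vadd_in[OF assms(1) G']] assms[THEN integrable_rep] in auto)
qed

lemma vnorm_chi_sum:
  assumes F: "F \<in> vecs (L1 N)" and A: "A \<in> sets N" "B \<in> sets N" "A \<inter> B = {}"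
  shows "vnorm (L1 N) (vadd (L1 N) (chi N A F) (chi N B F)) = mass N (rep F) (A \<union> B)"
proof -
  note A' = rep_chi[OF F A(1)] and B' = rep_chi[OF F A(2)]
  note S = vadd_in[OF A'(1) B'(1)]
  have i: "integrable N (\<lambda>y. indicator (A \<union> B) y * rep F y)"
    by (rule integrable_bounded_mult[OF integrable_rep[OF F], of _ 1]) (use A in \<open>auto simp: indicator_def\<close>)
  have "mass N (rep (vadd (L1 N) (chi N A F) (chi N B F))) (space N)
      = mass N (\<lambda>y. indicator (A \<union> B) y * rep F y) (space N)"
  proof (rule mass_cong_AE[OF integrable_rep[OF S] i])
    show "AE y in N. rep (vadd (L1 N) (chi N A F) (chi N B F)) y = indicator (A \<union> B) y * rep F y"
      using rep_vadd[OF A'(1) B'(1)] A'(2) B'(2)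
      by eventually_elim (use A(3) in \<open>auto simp: indicator_def\<close>)
  qed simp
  also have "\<dots> = mass N (rep F) (A \<union> B)"
    unfolding mass_def using A sets.sets_into_space
    by (intro Bochner_Integration.integral_cong refl) (auto simp: indicator_def norm_mult)
  finally show ?thesis by (simp add: vnorm_L1[OF S])
qed

context
  fixes M :: "'a measure" and N :: "'b measure"
    and T :: "('a \<Rightarrow> 'k::{real_normed_field,banach,second_countable_topology}) set \<Rightarrow> ('b \<Rightarrow> 'k) set"
    and \<Theta> :: "'b set"
  assumes T: "bounded_op (L1 M) (L1 N) T" and \<Theta>: "\<Theta> \<in> sets N"
begin

private definition cut :: "'b set \<Rightarrow> real" where
  "cut B = op_norm (L1 M) (L1 N) (op_add (L1 N) (chi N (space N - \<Theta>) \<circ> T) (chi N B \<circ> T))"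

private definition small_sets :: "real \<Rightarrow> 'b set set" where
  "small_sets \<delta> = {B \<in> sets N. B \<subseteq> \<Theta> \<and> emeasure N B < ennreal \<delta>}"

private lemma cut_vnorm:
  assumes "B \<in> sets N" "B \<subseteq> \<Theta>" "F \<in> unit_ball (L1 M)"
  shows "vnorm (L1 N) (op_add (L1 N) (chi N (space N - \<Theta>) \<circ> T) (chi N B \<circ> T) F)
    = mass N (rep (T F)) ((space N - \<Theta>) \<union> B)"
proof -
  have "T F \<in> vecs (L1 N)" using op_in[OF T] assms(3) by (auto simp: unit_ball_def)
  then show ?thesis unfolding op_add_def o_def using assms \<Theta> by (intro vnorm_chi_sum) auto
qed

private lemma mass_le_bound:
  obtains K where "\<And>F C. F \<in> unit_ball (L1 M) \<Longrightarrow> C \<in> sets N \<Longrightarrow> mass N (rep (T F)) C \<le> K"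
proof -
  obtain K where K: "0 \<le> K" "\<And>F. F \<in> vecs (L1 M) \<Longrightarrow> vnorm (L1 N) (T F) \<le> K * vnorm (L1 M) F"
    using op_bound[OF T] by blast
  have "mass N (rep (T F)) C \<le> K" if F: "F \<in> unit_ball (L1 M)" and C: "C \<in> sets N" for F C
  proof -
    have F': "F \<in> vecs (L1 M)" "vnorm (L1 M) F \<le> 1" using F by (auto simp: unit_ball_def)
    have "mass N (rep (T F)) C \<le> mass N (rep (T F)) (space N)"
      using sets.sets_into_space[OF C] C by (intro mass_mono integrable_rep op_in[OF T] F') auto
    also have "\<dots> \<le> K * vnorm (L1 M) F" using K(2)[OF F'(1)] by (simp add: vnorm_L1[OF op_in[OF T F'(1)]])
    also have "\<dots> \<le> K" using mult_left_mono[OF F'(2) K(1)] by simp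
    finally show ?thesis .
  qed
  then show thesis using that by blast
qed

private lemma mass_le_cut:
  assumes "B \<in> sets N" "B \<subseteq> \<Theta>" "F \<in> unit_ball (L1 M)"
  shows "mass N (rep (T F)) ((space N - \<Theta>) \<union> B) \<le> cut B"
proof -
  obtain K where K: "\<And>F C. F \<in> unit_ball (L1 M) \<Longrightarrow> C \<in> sets N \<Longrightarrow> mass N (rep (T F)) C \<le> K"
    using mass_le_bound by blast
  show ?thesis
    unfolding cut_def cut_vnorm[OF assms, symmetric]
    by (rule vnorm_le_op_norm[OF _ assms(3), of _ _ K]) (use assms \<Theta> K cut_vnorm in auto)
qed

private lemma cut_le:
  assumes "B \<in> sets N" "B \<subseteq> \<Theta>"
    and "\<And>F. F \<in> unit_ball (L1 M) \<Longrightarrow> mass N (rep (T F)) ((space N - \<Theta>) \<union> B) \<le> c"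
  shows "cut B \<le> c"
  unfolding cut_def by (rule op_norm_le) (use assms cut_vnorm in auto)

private lemma cut_nonneg: "B \<in> sets N \<Longrightarrow> B \<subseteq> \<Theta> \<Longrightarrow> 0 \<le> cut B"
  by (rule order_trans[OF mass_nonneg mass_le_cut[OF _ _ zero_in_unit_ball]])

private lemma bdd_above_cut: "bdd_above (cut ` small_sets \<delta>)"
proof -
  obtain K where K: "\<And>F C. F \<in> unit_ball (L1 M) \<Longrightarrow> C \<in> sets N \<Longrightarrow> mass N (rep (T F)) C \<le> K"
    using mass_le_bound by blast
  show ?thesis
    using \<Theta> K by (intro bdd_aboveI[of _ K]) (auto simp: small_sets_def intro!: cut_le)
qed

private lemma empty_small: "0 < \<delta> \<Longrightarrow> {} \<in> small_sets \<delta>"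
  by (simp add: small_sets_def)

lemma alpha_eq_INF: "alpha M N \<Theta> T = (INF \<delta>\<in>{0<..}. SUP B\<in>small_sets \<delta>. cut B)"
proof -
  have "alpha M N \<Theta> T = Lim (at_right 0) (\<lambda>\<delta>. SUP B\<in>small_sets \<delta>. cut B)"
    by (simp add: alpha_def cut_def small_sets_def)
  also have "\<dots> = (INF \<delta>\<in>{0<..}. SUP B\<in>small_sets \<delta>. cut B)"
  proof (rule Lim_at_right_INF)
    fix x y :: real assume xy: "0 < x" "x \<le> y"
    then have "small_sets x \<subseteq> small_sets y"
      by (auto simp: small_sets_def intro: less_le_trans ennreal_leI)
    then show "(SUP B\<in>small_sets x. cut B) \<le> (SUP B\<in>small_sets y. cut B)"
      using empty_small[OF xy(1)] bdd_above_cut by (intro cSUP_subset_mono) auto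
  next
    fix x :: real assume "0 < x"
    then show "0 \<le> (SUP B\<in>small_sets x. cut B)"
      using empty_small cut_nonneg[of "{}"] bdd_above_cut by (intro cSUP_upper2[of _ _ "{}"]) auto
  qed
  finally show ?thesis .
qed

private lemma SUP_cut_nonneg: "0 < \<delta> \<Longrightarrow> 0 \<le> (SUP B\<in>small_sets \<delta>. cut B)"
  using empty_small cut_nonneg[of "{}"] bdd_above_cut by (intro cSUP_upper2[of _ _ "{}"]) auto

lemma alpha_nonneg: "0 \<le> alpha M N \<Theta> T"
  unfolding alpha_eq_INF using SUP_cut_nonneg by (intro cINF_greatest) auto

lemma alpha_le:
  assumes "0 < \<delta>"
    and "\<And>F B. F \<in> unit_ball (L1 M) \<Longrightarrow> B \<in> sets N \<Longrightarrow> B \<subseteq> \<Theta> \<Longrightarrow> emeasure N B < ennreal \<delta> \<Longrightarrow>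
      mass N (rep (T F)) ((space N - \<Theta>) \<union> B) \<le> c"
  shows "alpha M N \<Theta> T \<le> c"
proof -
  have "bdd_below ((\<lambda>\<delta>. SUP B\<in>small_sets \<delta>. cut B) ` {0<..})"
    using SUP_cut_nonneg by (intro bdd_belowI[of _ 0]) auto
  then have "alpha M N \<Theta> T \<le> (SUP B\<in>small_sets \<delta>. cut B)"
    unfolding alpha_eq_INF using assms(1) by (intro cINF_lower) auto
  also have "\<dots> \<le> c"
    using empty_small[OF assms(1)] assms(2)
    by (intro cSUP_least) (auto simp: small_sets_def intro!: cut_le)
  finally show ?thesis .
qed

text \<open>
  Both this lemma and \<open>alpha_le\<close> speak of masses on \<open>(Y - \<Theta>) \<union> B\<close>: since
  \<open>B\<close> lies inside \<open>\<Theta>\<close>, the two multiplications in the definition of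
  \<open>alpha\<close> act on disjoint sets and add up to a single restriction.
\<close>

lemma mass_le_alpha:
  assumes "alpha M N \<Theta> T < c"
  shows "\<exists>\<delta>>0. \<forall>F\<in>unit_ball (L1 M). \<forall>B\<in>sets N. B \<subseteq> \<Theta> \<longrightarrow> emeasure N B < ennreal \<delta> \<longrightarrow>
    mass N (rep (T F)) ((space N - \<Theta>) \<union> B) \<le> c"
proof -
  have "bdd_below ((\<lambda>\<delta>. SUP B\<in>small_sets \<delta>. cut B) ` {0<..})"
    using SUP_cut_nonneg by (intro bdd_belowI[of _ 0]) auto
  then obtain \<delta> where \<delta>: "0 < \<delta>" "(SUP B\<in>small_sets \<delta>. cut B) < c"
    using assms unfolding alpha_eq_INF by (subst (asm) cINF_less_iff) auto
  have "mass N (rep (T F)) ((space N - \<Theta>) \<union> B) \<le> c"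
    if "F \<in> unit_ball (L1 M)" "B \<in> sets N" "B \<subseteq> \<Theta>" "emeasure N B < ennreal \<delta>" for F B
  proof -
    have "cut B \<le> (SUP B\<in>small_sets \<delta>. cut B)"
      using that bdd_above_cut by (intro cSUP_upper) (auto simp: small_sets_def)
    then show ?thesis using mass_le_cut[OF that(2,3,1)] \<delta>(2) by linarith
  qed
  with \<delta>(1) show ?thesis by blast
qed

end

section \<open>The best weakly compact approximation\<close>

text \<open>
  The factors \<open>(1/2)\<^sup>n / (1 + N(\<Theta>\<^sub>n))\<close> make the sum of the indicators
  integrable. As \<open>w\<close> is at least \<open>c\<^sub>n\<close> on \<open>\<Theta>\<^sub>n\<close>, a
  small \<open>w\<close>-mass forces a small measure inside \<open>\<Theta>\<^sub>n\<close>.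
\<close>

lemma ex_weight:
  fixes \<Theta> :: "nat \<Rightarrow> 'b set" and \<delta> :: "nat \<Rightarrow> real"
  assumes \<Theta>: "\<And>n. \<Theta> n \<in> sets N" "\<And>n. emeasure N (\<Theta> n) < \<infinity>" and \<delta>: "\<And>n. 0 < \<delta> n"
  shows "\<exists>(w :: 'b \<Rightarrow> real) r. integrable N w \<and> (\<forall>x. 0 \<le> w x) \<and> (\<forall>n. 0 < r n \<and>
    (\<forall>A\<in>sets N. mass N w A < r n \<longrightarrow> emeasure N (A \<inter> \<Theta> n) < ennreal (\<delta> n)))"
proof -
  define c where "c n = (1/2) ^ n / (1 + measure N (\<Theta> n))" for n
  have c: "0 < c n" for n using measure_nonneg[of N "\<Theta> n"] by (auto simp: c_def intro!: divide_pos_pos add_pos_nonneg)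
  have c_le: "c n \<le> (1/2) ^ n" for n
    using divide_left_mono[of 1 "1 + measure N (\<Theta> n)" "(1/2) ^ n"] by (simp add: c_def add_pos_nonneg)
  have cm_le: "c n * measure N (\<Theta> n) \<le> (1/2) ^ n" for n
    using mult_left_mono[of "measure N (\<Theta> n) / (1 + measure N (\<Theta> n))" 1 "(1/2) ^ n"]
    by (simp add: c_def divide_le_eq_1_pos add_pos_nonneg)
  have geo: "summable (\<lambda>n. (1/2::real) ^ n)" by (rule summable_geometric) simp
  define w where "w x = (\<Sum>n. c n * indicator (\<Theta> n) x)" for x
  have s: "summable (\<lambda>n. c n * indicator (\<Theta> n) x)" for x
    by (rule summable_comparison_test'[OF geo, of 0])
       (use c c_le in \<open>auto simp: indicator_def less_imp_le abs_mult\<close>)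
  have w_nonneg: "0 \<le> w x" for x
    unfolding w_def using c s by (intro suminf_nonneg) (auto simp: less_imp_le)
  have w: "integrable N w"
    unfolding w_def[abs_def]
  proof (rule integrable_suminf)
    show "integrable N (\<lambda>x. c n * indicator (\<Theta> n) x)" for n
      using \<Theta> by (intro integrable_mult_right integrable_real_indicator)
    show "AE x in N. summable (\<lambda>n. norm (c n * indicator (\<Theta> n) x))"
      using s c by (auto simp: abs_mult less_imp_le abs_of_pos)
    show "summable (\<lambda>n. LINT x|N. norm (c n * indicator (\<Theta> n) x))"
      using c cm_le \<Theta> by (intro summable_comparison_test'[OF geo, of 0]) (auto simp: abs_mult abs_of_pos)
  qed
  have w_ge: "c n * indicator (\<Theta> n) x \<le> w x" for n x
  proof (cases "x \<in> \<Theta> n")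
    case True
    have "(\<Sum>i\<in>{n}. c i * indicator (\<Theta> i) x) \<le> w x"
      unfolding w_def using c by (intro sum_le_suminf s) (auto simp: less_imp_le)
    then show ?thesis using True by (simp cong: conj_cong)
  qed (simp add: w_nonneg)
  have "emeasure N (A \<inter> \<Theta> n) < ennreal (\<delta> n)"
    if A: "A \<in> sets N" and le: "mass N w A < c n * \<delta> n" for A n
  proof -
    have fin: "emeasure N (A \<inter> \<Theta> n) < \<infinity>"
      by (rule le_less_trans[OF emeasure_mono \<Theta>(2)[of n]]) (use \<Theta> in auto)
    have "c n * measure N (A \<inter> \<Theta> n) = (LINT x|N. c n * indicator (A \<inter> \<Theta> n) x)"
      using A \<Theta> fin sets.sets_into_space[OF A] by (simp add: Int_absorb2 le_infI1)
    also have "\<dots> \<le> mass N w A"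
      unfolding mass_def
    proof (rule integral_mono)
      show "integrable N (\<lambda>x. c n * indicator (A \<inter> \<Theta> n) x)"
        using A \<Theta> fin by (intro integrable_mult_right integrable_real_indicator) auto
      show "integrable N (\<lambda>x. indicator A x * norm (w x) :: real)" by (rule integrable_mass[OF w A])
      show "c n * indicator (A \<inter> \<Theta> n) x \<le> indicator A x * norm (w x)" for x
        using w_ge[of n x] w_nonneg[of x] by (auto simp: indicator_def)
    qed
    finally have "c n * measure N (A \<inter> \<Theta> n) < c n * \<delta> n" using le by linarith
    then have "measure N (A \<inter> \<Theta> n) < \<delta> n" using mult_less_cancel_left_pos[OF c] by blast
    then show ?thesis
      using fin by (simp add: emeasure_eq_ennreal_measure less_top ennreal_less_iff)
  qed
  then show ?thesis using w w_nonneg c \<delta> by (intro exI[of _ w] exI[of _ "\<lambda>n. c n * \<delta> n"]) auto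
qed

lemma weakly_compact_best_approximation:
  fixes M :: "'a measure" and N :: "'b measure"
    and T :: "('a \<Rightarrow> 'k::{real_normed_field,euclidean_space}) set \<Rightarrow> ('b \<Rightarrow> 'k) set"
  assumes T: "bounded_op (L1 M) (L1 N) T"
  shows "\<exists>W. weakly_compact_op (L1 M) (L1 N) W \<and>
                 weak_ess_norm (L1 M) (L1 N) T = op_norm (L1 M) (L1 N) (op_diff (L1 N) T W) \<and>
                 op_norm (L1 M) (L1 N) (op_diff (L1 N) T W) =
                   (INF \<Theta>\<in>{\<Theta> \<in> sets N. emeasure N \<Theta> < \<infinity>}. alpha M N \<Theta> T)"
proof -
  let ?fin = "{\<Theta> \<in> sets N. emeasure N \<Theta> < \<infinity>}"
  define a where "a = (INF \<Theta>\<in>?fin. alpha M N \<Theta> T)"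
  have ne: "?fin \<noteq> {}" by auto
  have bdd: "bdd_below ((\<lambda>\<Theta>. alpha M N \<Theta> T) ` ?fin)"
    using alpha_nonneg[OF T] by (intro bdd_belowI[of _ 0]) auto
  have a0: "0 \<le> a" unfolding a_def using alpha_nonneg[OF T] by (intro cINF_greatest[OF ne]) auto
  have diff_vnorm: "vnorm (L1 N) (op_diff (L1 N) T W F) = mass N (\<lambda>y. rep (T F) y - rep (W F) y) (space N)"
    if "bounded_op (L1 M) (L1 N) W" "F \<in> unit_ball (L1 M)" for W F
    unfolding op_diff_def using that op_in[OF T] op_in[OF that(1)]
    by (intro vnorm_op_diff) (auto simp: unit_ball_def)
  have lower: "a \<le> op_norm (L1 M) (L1 N) (op_diff (L1 N) T W)" if W: "weakly_compact_op (L1 M) (L1 N) W" for W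
  proof (rule field_le_epsilon)
    fix e :: real assume e: "0 < e"
    have W_op: "bounded_op (L1 M) (L1 N) W" and
      K: "compactin (weak_topology (L1 N)) (weak_topology (L1 N) closure_of (W ` unit_ball (L1 M)))"
      using W by (auto simp: weakly_compact_op_def)
    obtain R where R: "0 \<le> R" "\<And>F. F \<in> vecs (L1 M) \<Longrightarrow> vnorm (L1 N) (W F) \<le> R * vnorm (L1 M) F"
      using op_bound[OF W_op] by blast
    obtain R' where R': "0 \<le> R'" "\<And>F. F \<in> vecs (L1 M) \<Longrightarrow> vnorm (L1 N) (T F) \<le> R' * vnorm (L1 M) F"
      using op_bound[OF T] by blast
    have W_le: "vnorm (L1 N) (W F) \<le> R" and T_le: "vnorm (L1 N) (T F) \<le> R'" if "F \<in> unit_ball (L1 M)" for F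
      using R(2)[of F] R'(2)[of F] mult_left_mono[of "vnorm (L1 M) F" 1 R] mult_left_mono[of "vnorm (L1 M) F" 1 R'] that R(1) R'(1)
      by (auto simp: unit_ball_def)
    have "W ` unit_ball (L1 M) \<subseteq> vecs (L1 N)" using op_in[OF W_op] by (auto simp: unit_ball_def)
    then have sub: "W ` unit_ball (L1 M) \<subseteq> weak_topology (L1 N) closure_of (W ` unit_ball (L1 M))"
      using topspace_weak_topology_L1[of N] by (intro closure_of_subset) auto
    obtain \<Theta> \<delta> where \<Theta>: "\<Theta> \<in> sets N" "emeasure N \<Theta> < \<infinity>" and \<delta>: "0 < \<delta>"
      and small: "\<And>F B. F \<in> unit_ball (L1 M) \<Longrightarrow> B \<in> sets N \<Longrightarrow> emeasure N B < ennreal \<delta> \<Longrightarrow>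
        mass N (rep (W F)) ((space N - \<Theta>) \<union> B) \<le> e"
      using weakly_compact_imp_mass_small[OF K sub, of R e] W_le e by blast
    have "a \<le> alpha M N \<Theta> T" unfolding a_def by (rule cINF_lower[OF bdd]) (use \<Theta> in auto)
    also have "\<dots> \<le> op_norm (L1 M) (L1 N) (op_diff (L1 N) T W) + e"
    proof (rule alpha_le[OF T \<Theta>(1) \<delta>])
      fix F :: "('a \<Rightarrow> 'k) set" and B assume F: "F \<in> unit_ball (L1 M)" and B: "B \<in> sets N" "emeasure N B < ennreal \<delta>"
      have Fv: "F \<in> vecs (L1 M)" using F by (simp add: unit_ball_def)
      note iT = integrable_rep[OF op_in[OF T Fv]] and iW = integrable_rep[OF op_in[OF W_op Fv]]
      let ?C = "(space N - \<Theta>) \<union> B"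
      have C: "?C \<in> sets N" using \<Theta> B by auto
      have "mass N (rep (T F)) ?C = mass N (\<lambda>y. (rep (T F) y - rep (W F) y) + rep (W F) y) ?C" by simp
      also have "\<dots> \<le> mass N (\<lambda>y. rep (T F) y - rep (W F) y) ?C + mass N (rep (W F)) ?C"
        using iT iW C by (intro mass_add) auto
      also have "mass N (rep (W F)) ?C \<le> e" by (rule small[OF F B])
      also have "mass N (\<lambda>y. rep (T F) y - rep (W F) y) ?C \<le> mass N (\<lambda>y. rep (T F) y - rep (W F) y) (space N)"
        using iT iW C sets.sets_into_space[OF C] by (intro mass_mono) auto
      also have "\<dots> \<le> op_norm (L1 M) (L1 N) (op_diff (L1 N) T W)"
        unfolding diff_vnorm[OF W_op F, symmetric]
      proof (rule vnorm_le_op_norm[OF _ F])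
        fix F :: "('a \<Rightarrow> 'k) set" assume F: "F \<in> unit_ball (L1 M)"
        then have Fv: "F \<in> vecs (L1 M)" by (simp add: unit_ball_def)
        note T' = op_in[OF T Fv] and W' = op_in[OF W_op Fv]
        have "mass N (\<lambda>y. rep (T F) y - rep (W F) y) (space N)
            = mass N (\<lambda>y. rep (T F) y + (-1) * rep (W F) y) (space N)" by simp
        also have "\<dots> \<le> mass N (rep (T F)) (space N) + mass N (\<lambda>y. (-1) * rep (W F) y) (space N)"
          using integrable_rep[OF T'] integrable_rep[OF W'] by (intro mass_add) auto
        also have "\<dots> = vnorm (L1 N) (T F) + vnorm (L1 N) (W F)"
          unfolding mass_cmult vnorm_L1[OF T'] vnorm_L1[OF W'] by simp
        also have "\<dots> \<le> R' + R" using T_le[OF F] W_le[OF F] by linarith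
        finally show "vnorm (L1 N) (op_diff (L1 N) T W F) \<le> R' + R" unfolding diff_vnorm[OF W_op F] .
      qed
      finally show "mass N (rep (T F)) ?C \<le> op_norm (L1 M) (L1 N) (op_diff (L1 N) T W) + e" by simp
    qed
    finally show "a \<le> op_norm (L1 M) (L1 N) (op_diff (L1 N) T W) + e" .
  qed
  define good where "good n \<Theta> \<delta> \<longleftrightarrow> \<Theta> \<in> sets N \<and> emeasure N \<Theta> < \<infinity> \<and> 0 < \<delta> \<and>
      (\<forall>F\<in>unit_ball (L1 M). \<forall>B\<in>sets N. B \<subseteq> \<Theta> \<longrightarrow> emeasure N B < ennreal \<delta> \<longrightarrow>
        mass N (rep (T F)) ((space N - \<Theta>) \<union> B) \<le> a + 1 / real (Suc n))" for n \<Theta> \<delta>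
  have "\<exists>\<Theta> \<delta>. good n \<Theta> \<delta>" for n
  proof -
    have "a < a + 1 / real (Suc n)" by simp
    then obtain \<Theta> where \<Theta>: "\<Theta> \<in> ?fin" "alpha M N \<Theta> T < a + 1 / real (Suc n)"
      unfolding a_def by (subst (asm) cINF_less_iff[OF ne bdd]) auto
    then show ?thesis using mass_le_alpha[OF T _ \<Theta>(2)] unfolding good_def by blast
  qed
  then obtain \<Theta> \<delta> where good: "\<And>n. good n (\<Theta> n) (\<delta> n)" by metis
  have \<Theta>: "\<Theta> n \<in> sets N" "emeasure N (\<Theta> n) < \<infinity>" and \<delta>: "0 < \<delta> n" for n
    using good[of n] by (auto simp: good_def)
  have le: "mass N (rep (T F)) ((space N - \<Theta> n) \<union> B) \<le> a + 1 / real (Suc n)"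
    if "F \<in> unit_ball (L1 M)" "B \<in> sets N" "B \<subseteq> \<Theta> n" "emeasure N B < ennreal (\<delta> n)" for n F B
    using good[of n] that unfolding good_def by blast
  obtain w :: "'b \<Rightarrow> real" and r where weight: "integrable N w" "\<forall>x. 0 \<le> w x" "\<forall>n. 0 < r n \<and>
      (\<forall>A\<in>sets N. mass N w A < r n \<longrightarrow> emeasure N (A \<inter> \<Theta> n) < ennreal (\<delta> n))"
    using ex_weight[where \<Theta> = \<Theta> and \<delta> = \<delta> and N = N, OF \<Theta> \<delta>] by (elim exE conjE)
  have w: "integrable N w" "\<And>x. 0 \<le> w x" and r: "\<And>n. 0 < r n"
    and wr: "\<And>n A. A \<in> sets N \<Longrightarrow> mass N w A < r n \<Longrightarrow> emeasure N (A \<inter> \<Theta> n) < ennreal (\<delta> n)"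
    using weight by auto
  define \<rho> where "\<rho> e = r (nat \<lceil>1 / e\<rceil>)" for e :: real
  have "\<exists>W. weakly_compact_op (L1 M) (L1 N) W \<and>
    (\<forall>F\<in>vecs (L1 M). mass N (\<lambda>y. rep (T F) y - rep (W F) y) (space N) \<le> a * vnorm (L1 M) F)"
  proof (rule approximate_by_equi_bounded[OF T w a0, of \<rho>])
    show "0 < \<rho> e" for e by (simp add: \<rho>_def r)
    fix e A and F :: "('a \<Rightarrow> 'k) set" assume e: "(0::real) < e" and A: "A \<in> sets N" "mass N w A < \<rho> e" and F: "F \<in> unit_ball (L1 M)"
    define n where "n = nat \<lceil>1 / e\<rceil>"
    have Fv: "F \<in> vecs (L1 M)" using F by (simp add: unit_ball_def)
    have "1 / e \<le> real n" unfolding n_def by linarith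
    then have n: "1 / real (Suc n) \<le> e" using e by (simp add: field_simps)
    have "mass N (rep (T F)) A \<le> mass N (rep (T F)) ((space N - \<Theta> n) \<union> (A \<inter> \<Theta> n))"
      using A \<Theta>(1) sets.sets_into_space[OF A(1)] by (intro mass_mono integrable_rep op_in[OF T Fv]) auto
    also have "\<dots> \<le> a + 1 / real (Suc n)"
      using A \<Theta>(1) wr[of A n] by (intro le F) (auto simp: \<rho>_def n_def)
    finally show "mass N (rep (T F)) A \<le> a + e" using n by linarith
  qed
  then obtain W where W: "weakly_compact_op (L1 M) (L1 N) W"
    and WT: "\<And>F. F \<in> vecs (L1 M) \<Longrightarrow> mass N (\<lambda>y. rep (T F) y - rep (W F) y) (space N) \<le> a * vnorm (L1 M) F"
    by blast
  have W_op: "bounded_op (L1 M) (L1 N) W" using W by (simp add: weakly_compact_op_def)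
  have upper: "op_norm (L1 M) (L1 N) (op_diff (L1 N) T W) \<le> a"
  proof (rule op_norm_le)
    fix F :: "('a \<Rightarrow> 'k) set" assume F: "F \<in> unit_ball (L1 M)"
    then have F': "F \<in> vecs (L1 M)" "vnorm (L1 M) F \<le> 1" by (auto simp: unit_ball_def)
    show "vnorm (L1 N) (op_diff (L1 N) T W F) \<le> a"
      unfolding diff_vnorm[OF W_op F] using WT[OF F'(1)] mult_left_mono[OF F'(2) a0] by linarith
  qed
  have eq: "op_norm (L1 M) (L1 N) (op_diff (L1 N) T W) = a" using upper lower[OF W] by linarith
  moreover have "weak_ess_norm (L1 M) (L1 N) T = a"
    unfolding weak_ess_norm_def
  proof (rule antisym)
    show "(INF W\<in>{W. weakly_compact_op (L1 M) (L1 N) W}. op_norm (L1 M) (L1 N) (op_diff (L1 N) T W)) \<le> a"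
    proof -
      have "bdd_below ((\<lambda>W. op_norm (L1 M) (L1 N) (op_diff (L1 N) T W)) ` {W. weakly_compact_op (L1 M) (L1 N) W})"
        using lower by (intro bdd_belowI[of _ a]) auto
      from cINF_lower[OF this, of W] show ?thesis using W eq by simp
    qed
    show "a \<le> (INF W\<in>{W. weakly_compact_op (L1 M) (L1 N) W}. op_norm (L1 M) (L1 N) (op_diff (L1 N) T W))"
      using W lower by (intro cINF_greatest) auto
  qed
  ultimately show ?thesis using W unfolding a_def by (intro exI[of _ W]) simp
qed

theorem theorem1p1:
  fixes \<mu> :: "'a measure" and \<nu> :: "'b measure"
  assumes "strictly_localizable \<mu>" and "strictly_localizable \<nu>"
  shows "(\<forall>T :: ('a \<Rightarrow> real) set \<Rightarrow> ('b \<Rightarrow> real) set.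
            bounded_op (L1 \<mu>) (L1 \<nu>) T \<longrightarrow>
            (\<exists>W. weakly_compact_op (L1 \<mu>) (L1 \<nu>) W \<and>
                 weak_ess_norm (L1 \<mu>) (L1 \<nu>) T = op_norm (L1 \<mu>) (L1 \<nu>) (op_diff (L1 \<nu>) T W) \<and>
                 op_norm (L1 \<mu>) (L1 \<nu>) (op_diff (L1 \<nu>) T W) =
                   (INF \<Theta>\<in>{\<Theta> \<in> sets \<nu>. emeasure \<nu> \<Theta> < \<infinity>}. alpha \<mu> \<nu> \<Theta> T))) \<and>
         (\<forall>T :: ('a \<Rightarrow> complex) set \<Rightarrow> ('b \<Rightarrow> complex) set.
            bounded_op (L1 \<mu>) (L1 \<nu>) T \<longrightarrow>
            (\<exists>W. weakly_compact_op (L1 \<mu>) (L1 \<nu>) W \<and>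
                 weak_ess_norm (L1 \<mu>) (L1 \<nu>) T = op_norm (L1 \<mu>) (L1 \<nu>) (op_diff (L1 \<nu>) T W) \<and>
                 op_norm (L1 \<mu>) (L1 \<nu>) (op_diff (L1 \<nu>) T W) =
                   (INF \<Theta>\<in>{\<Theta> \<in> sets \<nu>. emeasure \<nu> \<Theta> < \<infinity>}. alpha \<mu> \<nu> \<Theta> T)))"
  by (intro conjI allI impI weakly_compact_best_approximation)

end
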